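(* Let $\widehat\beta_n$ be the penalized estimator described in the context with the Sign penalty $I_\lambda(\beta)=\lambda\,\|\beta\|_1/\|\beta\|_2$, where $\rho$ satisfies (R3): $\rho$ is twice continuously differentiable with $\psi=\rho'$ and $\psi'=\rho''$ bounded. Assume that: (H2) $w$ is a non-negative bounded function, with $\|w\|_\infty=1$, whose support $\mathcal{C}_w=\{x:w(x)>0\}$ satisfies $\mathbb{P}(x\in\mathcal{C}_w)>0$; (H3) $\mathbb{E}[w(x)\|x\|^2]<\infty$; (H4) the matrix $A$ is non-singular; and that $\sqrt n(\widehat\beta_n-\beta_0)=O_{\mathbb{P}}(1)$ and $\sqrt n\,\lambda_n\to b$ in probability. Then, if $\|\beta_0\|\ne0$, $$\sqrt n(\widehat\beta_n-\beta_0)\ \text{ converges in distribution to }\ \operatorname{argmin}_{z\in\mathbb{R}^p}R(z),$$ where the process $R:\mathbb{R}^p\to\mathbb{R}$ is $$R(z)=z^{T}\mathbf{w}+\tfrac12 z^{T}Az+b\,z^{T}q(z),$$ with $\mathbf{w}\sim N_p(0,B)$ and $$q(z)=\sum_{\ell=1}^p\Big\{\nabla J_\ell(\beta_0)\,\mathbf 1_{\{\beta_{0,\ell}\ne0\}}+\frac{\operatorname{sign}(z_\ell)}{\|\beta_0\|_2}\,\mathbf 1_{\{\beta_{0,\ell}=0\}}\,e_\ell\Big\},\qquad \nabla J_\ell(\beta)=-\frac{|\beta_\ell|}{\|\beta\|_2^3}\,\beta+\frac{\operatorname{sign}(\beta_\ell)}{\|\beta\|_2}\,e_\ell,$$ where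 $J_\ell(\beta)=|\beta_\ell|/\|\beta\|_2$.
   Context: Model: $p\ge1$ is fixed; $(y_i,x_i)$, $i\ge 1$, are i.i.d. copies of $(y,x)$ with $x\in\mathbb{R}^p$, $y\in\{0,1\}$ and $\mathbb{P}(y=1\mid x)=F(x^{T}\beta_0)$, where $F(t)=e^t/(1+e^t)$ and $\beta_0\in\mathbb{R}^p$. Loss: $\rho:[0,\infty)\to\mathbb{R}$ is a bounded, differentiable, nondecreasing function with derivative $\psi=\rho'$, and $$\phi(y,t)=y\,\rho(-\log F(t))+(1-y)\,\rho(-\log(1-F(t)))+G(F(t))+G(1-F(t)),\qquad G(t)=\int_0^t\psi(-\log u)\,du .$$ With $\nu(t)=\psi(-\log F(t))[1-F(t)]+\psi(-\log[1-F(t)])F(t)$, define $$A=\mathbb{E}\big(F(x^{T}\beta_0)[1-F(x^{T}\beta_0)]\nu(x^{T}\beta_0)w(x)xx^{T}\big),\quad B=\mathbb{E}\big(F(x^{T}\beta_0)[1-F(x^{T}\beta_0)]\nu^2(x^{T}\beta_0)w^2(x)xx^{T}\big).$$ Weight: $w:\mathbb{R}^p\to[0,\infty)$ measurable. The Sign penalty is set to $0$ at $\beta=0$. $\lambda_n>0$ is a (possibly random) sequence of tuning parameters. $e_\ell$ is the $\ell$-th canonical vector; $\operatorname{sign}(z)=z/|z|$ for $z\ne0$, $\operatorname{sign}(0)=0$. Estimator: $L_n(\beta)=\frac1n\sum_{i=1}^n\phi(y_i,x_i^{T}\beta)\,w(x_i)$ and $\widehat\beta_n$ is a minimizer, $\widehat\beta_n=\operatorname{argmin}_{\beta\in\mathbb{R}^p}\{L_n(\beta)+I_{\lambda_n}(\beta)\}$.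 *)

theory Defs
  imports "HOL-Probability.Probability"
begin

definition converges_in_probability ::
  "'w measure \<Rightarrow> (nat \<Rightarrow> 'w \<Rightarrow> 'a::metric_space) \<Rightarrow> 'a \<Rightarrow> bool" where
  "converges_in_probability M Z c \<longleftrightarrow>
     (\<forall>\<epsilon>>0. (\<lambda>n. measure M {\<omega> \<in> space M. dist (Z n \<omega>) c > \<epsilon>}) \<longlonglongrightarrow> 0)"

definition bounded_in_probability ::
  "'w measure \<Rightarrow> (nat \<Rightarrow> 'w \<Rightarrow> 'a::real_normed_vector) \<Rightarrow> bool" where
  "bounded_in_probability M Z \<longleftrightarrow>
     (\<forall>\<epsilon>>0. \<exists>K. \<forall>\<^sub>F n in sequentially. measure M {\<omega> \<in> space M. norm (Z n \<omega>) > K} < \<epsilon>)"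

text \<open>The library's \<open>weak_conv_m\<close> is restricted to laws on the real line; this is the
  bounded-continuous-function definition for vector-valued random variables. The limit may
  live on another probability space.\<close>

definition converges_in_distribution ::
  "'w measure \<Rightarrow> (nat \<Rightarrow> 'w \<Rightarrow> 'a::topological_space) \<Rightarrow> 'v measure \<Rightarrow> ('v \<Rightarrow> 'a) \<Rightarrow> bool" where
  "converges_in_distribution M Z N Z0 \<longleftrightarrow>
     (\<forall>n. Z n \<in> borel_measurable M) \<and> Z0 \<in> borel_measurable N \<and>
     (\<forall>f::'a \<Rightarrow> real. continuous_on UNIV f \<longrightarrow> bounded (range f) \<longrightarrow>
        (\<lambda>n. \<integral>\<omega>. f (Z n \<omega>) \<partial>M) \<longlonglongrightarrow> (\<integral>\<omega>. f (Z0 \<omega>) \<partial>N))"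

text \<open>\<open>W\<close> has law \<open>N\<^sub>p(m, \<Sigma>)\<close>, with \<open>\<Sigma>\<close> possibly singular: every linear
  combination of the coordinates is univariate normal, a point mass being the normal law of
  variance zero.\<close>

definition multivariate_normal ::
  "'v measure \<Rightarrow> ('v \<Rightarrow> real ^ 'p) \<Rightarrow> real ^ 'p \<Rightarrow> real ^ 'p ^ 'p \<Rightarrow> bool" where
  "multivariate_normal N W m \<Sigma> \<longleftrightarrow>
     W \<in> borel_measurable N \<and> transpose \<Sigma> = \<Sigma> \<and> (\<forall>a. 0 \<le> a \<bullet> (\<Sigma> *v a)) \<and>
     (\<forall>a. distr N borel (\<lambda>\<omega>. a \<bullet> W \<omega>) =
        (if a \<bullet> (\<Sigma> *v a) = 0 then return borel (a \<bullet> m)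
         else density lborel (\<lambda>s. ennreal (normal_density (a \<bullet> m) (sqrt (a \<bullet> (\<Sigma> *v a))) s))))"

definition logistic :: "real \<Rightarrow> real" where
  "logistic t = exp t / (1 + exp t)"

text \<open>At \<open>u = 0\<close> the integrand takes a junk value (\<open>ln 0 = 0\<close>), which does not affect the
  integral.\<close>

definition G_fun :: "(real \<Rightarrow> real) \<Rightarrow> real \<Rightarrow> real" where
  "G_fun \<psi> t = integral {0..t} (\<lambda>u. \<psi> (- ln u))"

definition phi_loss :: "(real \<Rightarrow> real) \<Rightarrow> (real \<Rightarrow> real) \<Rightarrow> real \<Rightarrow> real \<Rightarrow> real" where
  "phi_loss \<rho> \<psi> y t =
     y * \<rho> (- ln (logistic t)) + (1 - y) * \<rho> (- ln (1 - logistic t))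
     + G_fun \<psi> (logistic t) + G_fun \<psi> (1 - logistic t)"

definition nu_fun :: "(real \<Rightarrow> real) \<Rightarrow> real \<Rightarrow> real" where
  "nu_fun \<psi> t = \<psi> (- ln (logistic t)) * (1 - logistic t) + \<psi> (- ln (1 - logistic t)) * logistic t"

definition A_matrix ::
  "'w measure \<Rightarrow> ('w \<Rightarrow> real ^ 'p) \<Rightarrow> (real \<Rightarrow> real) \<Rightarrow> (real ^ 'p \<Rightarrow> real) \<Rightarrow> real ^ 'p
     \<Rightarrow> real ^ 'p ^ 'p" where
  "A_matrix M x \<psi> w \<beta>0 = (\<chi> j k. \<integral>\<omega>.
     logistic (x \<omega> \<bullet> \<beta>0) * (1 - logistic (x \<omega> \<bullet> \<beta>0)) * nu_fun \<psi> (x \<omega> \<bullet> \<beta>0)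
     * w (x \<omega>) * (x \<omega> $ j * x \<omega> $ k) \<partial>M)"

definition B_matrix ::
  "'w measure \<Rightarrow> ('w \<Rightarrow> real ^ 'p) \<Rightarrow> (real \<Rightarrow> real) \<Rightarrow> (real ^ 'p \<Rightarrow> real) \<Rightarrow> real ^ 'p
     \<Rightarrow> real ^ 'p ^ 'p" where
  "B_matrix M x \<psi> w \<beta>0 = (\<chi> j k. \<integral>\<omega>.
     logistic (x \<omega> \<bullet> \<beta>0) * (1 - logistic (x \<omega> \<bullet> \<beta>0)) * (nu_fun \<psi> (x \<omega> \<bullet> \<beta>0))\<^sup>2
     * (w (x \<omega>))\<^sup>2 * (x \<omega> $ j * x \<omega> $ k) \<partial>M)"

definition sign_penalty :: "real \<Rightarrow> real ^ 'p \<Rightarrow> real" where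
  "sign_penalty l \<beta> = (if \<beta> = 0 then 0 else l * ((\<Sum>j\<in>UNIV. \<bar>\<beta> $ j\<bar>) / norm \<beta>))"

definition empirical_loss ::
  "(real \<Rightarrow> real) \<Rightarrow> (real \<Rightarrow> real) \<Rightarrow> (real ^ 'p \<Rightarrow> real)
     \<Rightarrow> (nat \<Rightarrow> real) \<Rightarrow> (nat \<Rightarrow> real ^ 'p) \<Rightarrow> nat \<Rightarrow> real ^ 'p \<Rightarrow> real" where
  "empirical_loss \<rho> \<psi> w ys xs n \<beta> =
     (1 / real n) * (\<Sum>i=1..n. phi_loss \<rho> \<psi> (ys i) (xs i \<bullet> \<beta>) * w (xs i))"

definition is_penalized_estimate ::
  "(real \<Rightarrow> real) \<Rightarrow> (real \<Rightarrow> real) \<Rightarrow> (real ^ 'p \<Rightarrow> real)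
     \<Rightarrow> (nat \<Rightarrow> real) \<Rightarrow> (nat \<Rightarrow> real ^ 'p) \<Rightarrow> nat \<Rightarrow> real \<Rightarrow> real ^ 'p \<Rightarrow> bool" where
  "is_penalized_estimate \<rho> \<psi> w ys xs n l b \<longleftrightarrow>
     is_arg_min (\<lambda>\<beta>. empirical_loss \<rho> \<psi> w ys xs n \<beta> + sign_penalty l \<beta>) (\<lambda>_. True) b"

text \<open>\<open>\<beta>hat\<close> is a penalized estimator: for every sample size it is a random vector, and it
  minimizes the penalized objective with probability tending to one (in particular if it does
  so for every sample size and every outcome). Minimization at every outcome is not demanded:
  on a separated sample the loss typically decreases strictly along some rays, on which the
  penalty is constant, so that no minimizer exists unless the tuning parameter is large; and
  for every fixed \<open>n\<close> such samples usually have positive probability.\<close>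

definition penalized_estimator ::
  "'w measure \<Rightarrow> (real \<Rightarrow> real) \<Rightarrow> (real \<Rightarrow> real) \<Rightarrow> (real ^ 'p \<Rightarrow> real)
     \<Rightarrow> (nat \<Rightarrow> 'w \<Rightarrow> real) \<Rightarrow> (nat \<Rightarrow> 'w \<Rightarrow> real ^ 'p) \<Rightarrow> (nat \<Rightarrow> 'w \<Rightarrow> real)
     \<Rightarrow> (nat \<Rightarrow> 'w \<Rightarrow> real ^ 'p) \<Rightarrow> bool" where
  "penalized_estimator M \<rho> \<psi> w ys xs l \<beta>hat \<longleftrightarrow>
     (\<forall>n. \<beta>hat n \<in> borel_measurable M) \<and>
     (\<lambda>n. measure M {\<omega> \<in> space M.
        is_penalized_estimate \<rho> \<psi> w (\<lambda>i. ys i \<omega>) (\<lambda>i. xs i \<omega>) n (l n \<omega>) (\<beta>hat n \<omega>)}) \<longlonglongrightarrow> 1"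

definition J_ratio :: "'p \<Rightarrow> real ^ 'p \<Rightarrow> real" where
  "J_ratio l \<beta> = \<bar>\<beta> $ l\<bar> / norm \<beta>"

definition grad_J :: "'p \<Rightarrow> real ^ 'p \<Rightarrow> real ^ 'p" where
  "grad_J l \<beta> = - (\<bar>\<beta> $ l\<bar> / norm \<beta> ^ 3) *\<^sub>R \<beta> + (sgn (\<beta> $ l) / norm \<beta>) *\<^sub>R axis l 1"

lemma has_derivative_J_ratio:
  assumes "\<beta> $ l \<noteq> 0"
  shows "(J_ratio l has_derivative (\<lambda>h. grad_J l \<beta> \<bullet> h)) (at \<beta>)"
proof -
  have nz: "\<beta> \<noteq> 0" using assms by auto
  have nm: "(norm has_derivative (\<lambda>h. sgn \<beta> \<bullet> h)) (at \<beta>)"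
    using has_derivative_norm[OF nz] by (simp add: inner_commute)
  have "((\<lambda>v. v $ l) has_derivative (\<lambda>h. h $ l)) (at \<beta>)"
    by (intro bounded_linear_imp_has_derivative bounded_linear_vec_nth)
  from has_derivative_compose[OF this has_derivative_norm[OF assms]]
  have ab: "((\<lambda>v. \<bar>v $ l\<bar>) has_derivative (\<lambda>h. sgn (\<beta> $ l) * h $ l)) (at \<beta>)"
    by (simp add: mult.commute)
  have "((\<lambda>v. \<bar>v $ l\<bar> / norm v) has_derivative (\<lambda>h. grad_J l \<beta> \<bullet> h)) (at \<beta>)"
    by (rule has_derivative_eq_rhs[OF has_derivative_divide[OF ab nm]])
      (use nz in \<open>auto simp: grad_J_def fun_eq_iff inner_diff_left inner_add_left inner_axis'
        sgn_div_norm field_simps power3_eq_cube\<close>)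
  thus ?thesis by (simp add: J_ratio_def[abs_def])
qed

definition q_vec :: "real ^ 'p \<Rightarrow> real ^ 'p \<Rightarrow> real ^ 'p" where
  "q_vec \<beta>0 z = (\<Sum>l\<in>UNIV.
     (if \<beta>0 $ l \<noteq> 0 then grad_J l \<beta>0 else 0)
     + (if \<beta>0 $ l = 0 then (sgn (z $ l) / norm \<beta>0) *\<^sub>R axis l 1 else 0))"

definition R_process ::
  "real ^ 'p ^ 'p \<Rightarrow> real \<Rightarrow> real ^ 'p \<Rightarrow> real ^ 'p \<Rightarrow> real ^ 'p \<Rightarrow> real" where
  "R_process A b \<beta>0 W z = z \<bullet> W + (1 / 2) * (z \<bullet> (A *v z)) + b * (z \<bullet> q_vec \<beta>0 z)"

end

theory Submission
  imports Defs
begin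

text \<open>With \<open>z = sqrt n (\<beta> - \<beta>0)\<close>, a second-order expansion of the loss shows that \<open>n\<close> times the
  change of the penalized objective is, uniformly for bounded \<open>z\<close>, within \<open>o\<^sub>P(1)\<close> of the limit
  process \<open>R\<close> with the Gaussian vector replaced by the normalized score \<open>W\<^sub>n\<close>; the non-smooth part
  of the penalty survives because it is positively homogeneous of degree one. The process is
  uniformly strongly convex, so its minimizer is a Lipschitz function \<open>\<Phi>\<close> of the vector, and
  \<open>sqrt n (\<beta>hat - \<beta>0) - \<Phi>(W\<^sub>n)\<close> tends to zero in probability. The claim follows from
  the multivariate central limit theorem for \<open>W\<^sub>n\<close>, the continuous mapping theorem and
  Slutsky's lemma. No functional limit theorem is needed.\<close>

subsection \<open>Weak convergence of random vectors\<close>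

text \<open>Neither the penalty nor the loss is assumed convex; only the limit process is. The
  assumed root-n rate takes the place of convexity: with large probability the rescaled estimator
  and \<Phi>(W_n) lie in one fixed ball, and the objective is compared at just these two points.
  Minimality transfers to R up to twice the approximation error, and the quadratic growth of R turns
  that error into a bound on the distance of the two points. Strong convexity of R has two sources.
  The limit b is nonnegative because the tuning parameters are positive, and the quadratic form of A
  integrates a nonnegative kernel, so that a nonsingular A is positive definite. That A is the
  limiting Hessian rests on the residual y - F having conditional mean zero. The moment hypothesis
  controls w(x)|x|^2 and not its square. The score still has a second moment, as w^2 <= w, but the
  Hessian average is guaranteed only a first one. Hence the weak law is proved by truncation, and
  the Taylor remainder is split at a level of |x|.\<close>

text \<open>The phase \<open>c\<close> puts constants and sines into the same clause as cosines, so
  the product-to-sum formula alone yields closure under products. These are the real trigonometric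
  polynomials with arbitrary frequencies.\<close>

inductive trig_sum :: "(real ^ 'p \<Rightarrow> real) \<Rightarrow> bool" where
  wave: "trig_sum (\<lambda>v. a * cos (t \<bullet> v + c))"
| add: "trig_sum f \<Longrightarrow> trig_sum g \<Longrightarrow> trig_sum (\<lambda>v. f v + g v)"

lemma trig_sum_mult_wave:
  assumes "trig_sum f"
  shows "trig_sum (\<lambda>v. a * cos (t \<bullet> v + c) * f v)"
  using assms
proof (induction rule: trig_sum.induct)
  case (wave a' t' c')
  have "(\<lambda>v. a * cos (t \<bullet> v + c) * (a' * cos (t' \<bullet> v + c'))) =
    (\<lambda>v. (a * a' / 2) * cos ((t - t') \<bullet> v + (c - c')) + (a * a' / 2) * cos ((t + t') \<bullet> v + (c + c')))"
  proof
    fix v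
    have *: "(t - t') \<bullet> v + (c - c') = (t \<bullet> v + c) - (t' \<bullet> v + c')"
         "(t + t') \<bullet> v + (c + c') = (t \<bullet> v + c) + (t' \<bullet> v + c')"
      by (simp_all add: inner_diff_left inner_add_left)
    show "a * cos (t \<bullet> v + c) * (a' * cos (t' \<bullet> v + c')) =
      (a * a' / 2) * cos ((t - t') \<bullet> v + (c - c')) + (a * a' / 2) * cos ((t + t') \<bullet> v + (c + c'))"
      unfolding * cos_add[of "t \<bullet> v + c"] cos_diff[of "t \<bullet> v + c"] by (simp add: algebra_simps)
  qed
  then show ?case by (simp only:) (intro trig_sum.intros)
next
  case (add f g)
  then show ?case by (auto simp: distrib_left intro: trig_sum.intros)
qed

lemma trig_sum_mult:
  assumes "trig_sum f" "trig_sum g"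
  shows "trig_sum (\<lambda>v. f v * g v)"
  using assms
proof (induction rule: trig_sum.induct)
  case (wave a t c)
  then show ?case by (rule trig_sum_mult_wave)
next
  case (add f g)
  then show ?case by (auto simp: distrib_right intro: trig_sum.intros)
qed

lemma trig_sum_const: "trig_sum (\<lambda>v. c)"
  using trig_sum.wave[of c 0 0] by simp

lemma trig_sum_sum:
  assumes "finite S" "\<And>j. j \<in> S \<Longrightarrow> trig_sum (f j)"
  shows "trig_sum (\<lambda>v. \<Sum>j\<in>S. f j v)"
  using assms by (induction rule: finite_induct) (auto intro: trig_sum.add trig_sum_const)

text \<open>A sine is a wave of phase -pi/2, so a linear function of the coordinate sines is a sum
  of waves; closure under sums and products carries this to all polynomials.\<close>

lemma trig_sum_real_polynomial_sin:
  fixes P :: "real ^ 'p \<Rightarrow> real"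
  assumes "real_polynomial_function P"
  shows "trig_sum (\<lambda>v. P (\<chi> j. sin (v $ j / L)))"
  using assms
proof (induction rule: real_polynomial_function.induct)
  case (linear f)
  interpret f: bounded_linear f by fact
  have "(\<lambda>v. f (\<chi> j. sin (v $ j / L))) =
    (\<lambda>v. \<Sum>j\<in>UNIV. f (axis j 1) * cos (((1 / L) *\<^sub>R axis j 1) \<bullet> v + (- (pi / 2))))"
  proof
    fix v
    have "f (\<chi> j. sin (v $ j / L)) = f (\<Sum>j\<in>UNIV. sin (v $ j / L) *\<^sub>R axis j 1)"
      by (rule arg_cong[where f = f], subst basis_expansion[symmetric])
        (simp add: scalar_mult_eq_scaleR)
    also have "\<dots> = (\<Sum>j\<in>UNIV. f (axis j 1) * cos (((1 / L) *\<^sub>R axis j 1) \<bullet> v + (- (pi / 2))))"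
      by (simp add: f.sum f.scaleR inner_axis' cos_diff mult.commute)
    finally show "f (\<chi> j. sin (v $ j / L)) = \<dots>" .
  qed
  then show ?case by (simp only:) (intro trig_sum_sum trig_sum.wave finite_class.finite_UNIV)
next
  case (const c)
  show ?case by (rule trig_sum_const)
next
  case (add f g)
  show ?case by (rule trig_sum.add[OF add.IH])
next
  case (mult f g)
  show ?case by (rule trig_sum_mult[OF mult.IH])
qed

lemma trig_sum_continuous: "trig_sum f \<Longrightarrow> continuous_on UNIV f"
  by (induction rule: trig_sum.induct) (auto intro!: continuous_intros)

lemma trig_sum_bounded: "trig_sum f \<Longrightarrow> \<exists>B. \<forall>v. \<bar>f v\<bar> \<le> B"
proof (induction rule: trig_sum.induct)
  case (wave a t c)
  have "\<bar>a * cos (t \<bullet> v + c)\<bar> \<le> \<bar>a\<bar>" for v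
    by (simp add: abs_mult mult_left_le)
  then show ?case by blast
next
  case (add f g)
  then obtain B C where "\<forall>v. \<bar>f v\<bar> \<le> B" "\<forall>v. \<bar>g v\<bar> \<le> C" by blast
  then have "\<bar>f v + g v\<bar> \<le> B + C" for v
    by (meson abs_triangle_ineq add_mono order_trans)
  then show ?case by blast
qed

text \<open>\<open>E\<close> maps the whole space into the cube \<open>S\<close>, where the
  polynomial is within e of \<open>F\<close>, itself bounded by B; hence the global bound B + e. On
  the ball of radius \<open>L\<close> every v_j / L lies within pi/2 of 0, so arcsin inverts sin and
  \<open>F (E v) = f v\<close>.\<close>

lemma trig_sum_approx:
  fixes f :: "real ^ 'p \<Rightarrow> real"
  assumes f: "continuous_on UNIV f" and B: "\<And>v. \<bar>f v\<bar> \<le> B" and e: "0 < e" and L: "0 < L"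
  obtains h where "trig_sum h" "\<And>v. \<bar>h v\<bar> \<le> B + e" "\<And>v. norm v \<le> L \<Longrightarrow> \<bar>f v - h v\<bar> \<le> e"
proof -
  define S :: "(real ^ 'p) set" where "S = cbox (\<chi> j. - 1) (\<chi> j. 1)"
  define F where "F u = f (\<chi> j. L * arcsin (u $ j))" for u
  define E :: "real ^ 'p \<Rightarrow> real ^ 'p" where "E v = (\<chi> j. sin (v $ j / L))" for v
  have S_iff: "u \<in> S \<longleftrightarrow> (\<forall>j. - 1 \<le> u $ j \<and> u $ j \<le> 1)" for u
    by (simp add: S_def mem_box_cart)
  have "continuous_on S (\<lambda>u. (\<chi> j. L * arcsin (u $ j)) :: real ^ 'p)"
    by (intro continuous_on_vec_lambda continuous_intros) (auto simp: S_iff)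
  then have "continuous_on S F"
    unfolding F_def by (rule continuous_on_compose2[OF f]) auto
  moreover have "compact S" by (simp add: S_def compact_cbox)
  ultimately obtain P where P: "real_polynomial_function P" "\<And>u. u \<in> S \<Longrightarrow> \<bar>F u - P u\<bar> < e"
    using Stone_Weierstrass_real_polynomial_function[of S F e] e by blast
  have ES: "E v \<in> S" for v by (simp add: S_iff E_def)
  show ?thesis
  proof
    show "trig_sum (\<lambda>v. P (E v))"
      unfolding E_def by (rule trig_sum_real_polynomial_sin[OF P(1)])
    show "\<bar>P (E v)\<bar> \<le> B + e" for v
      using P(2)[OF ES, of v] B[of "\<chi> j. L * arcsin (E v $ j)"] unfolding F_def by linarith
    show "\<bar>f v - P (E v)\<bar> \<le> e" if v: "norm v \<le> L" for v
    proof -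
      have "L * arcsin (sin (v $ j / L)) = v $ j" for j
      proof -
        have "\<bar>v $ j / L\<bar> \<le> 1"
          using component_le_norm_cart[of v j] v L by simp
        then have "- (pi / 2) \<le> v $ j / L" "v $ j / L \<le> pi / 2"
          using pi_gt3 by linarith+
        then show ?thesis using L by (simp add: arcsin_sin)
      qed
      then have "F (E v) = f v" by (simp add: F_def E_def)
      then show ?thesis using P(2)[OF ES, of v] by simp
    qed
  qed
qed

lemma (in prob_space) expectation_close:
  fixes F G :: "'a \<Rightarrow> real"
  assumes "integrable M F" "integrable M G" "A \<in> events"
    and "\<And>\<omega>. \<omega> \<in> space M \<Longrightarrow> \<bar>F \<omega> - G \<omega>\<bar> \<le> e + C * indicator A \<omega>"
  shows "\<bar>expectation F - expectation G\<bar> \<le> e + C * prob A"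
proof -
  have "\<bar>expectation F - expectation G\<bar> = \<bar>expectation (\<lambda>\<omega>. F \<omega> - G \<omega>)\<bar>"
    using assms by simp
  also have "\<dots> \<le> expectation (\<lambda>\<omega>. \<bar>F \<omega> - G \<omega>\<bar>)"
    by (rule integral_abs_bound)
  also have "\<dots> \<le> expectation (\<lambda>\<omega>. e + C * indicator A \<omega>)"
    using assms by (intro integral_mono) (auto simp: less_top[symmetric])
  also have "\<dots> = e + C * prob A"
    using assms by (simp add: prob_space less_top[symmetric])
  finally show ?thesis .
qed

lemma (in prob_space) integrable_continuous_bounded:
  fixes f :: "'b::{second_countable_topology, topological_space} \<Rightarrow> real"
  assumes "continuous_on UNIV f" "\<And>v. \<bar>f v\<bar> \<le> B" "Z \<in> borel_measurable M"
  shows "integrable M (\<lambda>\<omega>. f (Z \<omega>))"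
proof (rule integrable_const_bound[where B = B])
  show "(\<lambda>\<omega>. f (Z \<omega>)) \<in> borel_measurable M"
    using borel_measurable_continuous_onI[OF assms(1)] assms(3) by measurable
qed (use assms in auto)

lemma (in prob_space) tight_single:
  fixes Z :: "'a \<Rightarrow> 'b::{real_normed_vector, second_countable_topology}"
  assumes [measurable]: "Z \<in> borel_measurable M" and e: "0 < e"
  obtains K where "prob {\<omega> \<in> space M. norm (Z \<omega>) > K} < e"
proof -
  define A where "A k = {\<omega> \<in> space M. norm (Z \<omega>) > real k}" for k :: nat
  have "decseq A" unfolding decseq_def A_def by (auto intro: le_less_trans)
  moreover have "range A \<subseteq> events" unfolding A_def by auto
  ultimately have "(\<lambda>k. prob (A k)) \<longlonglongrightarrow> prob (\<Inter>k. A k)"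
    by (intro finite_Lim_measure_decseq)
  moreover have "(\<Inter>k. A k) = {}"
    by (auto simp: A_def) (meson linorder_not_less real_arch_simple)
  ultimately have "\<forall>\<^sub>F k in sequentially. prob (A k) < e"
    using e by (auto dest: order_tendstoD(2))
  then obtain k where "prob (A k) < e" by (auto simp: eventually_sequentially)
  then show ?thesis using that[of "real k"] by (simp add: A_def)
qed

lemma trig_sum_expectation_tendsto:
  assumes "prob_space M" "prob_space N"
    and Z: "\<And>n. Z n \<in> borel_measurable M" and Z0: "Z0 \<in> borel_measurable N"
    and conv: "\<And>t c. (\<lambda>n. \<integral>\<omega>. cos (t \<bullet> Z n \<omega> + c) \<partial>M) \<longlonglongrightarrow> (\<integral>\<omega>. cos (t \<bullet> Z0 \<omega> + c) \<partial>N)"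
    and h: "trig_sum h"
  shows "(\<lambda>n. \<integral>\<omega>. h (Z n \<omega>) \<partial>M) \<longlonglongrightarrow> (\<integral>\<omega>. h (Z0 \<omega>) \<partial>N)"
  using h
proof (induction rule: trig_sum.induct)
  case (wave a t c)
  then show ?case using tendsto_mult_left[OF conv[of t c], of a] by simp
next
  case (add f g)
  interpret M: prob_space M by fact
  interpret N: prob_space N by fact
  obtain B C where B: "\<And>v. \<bar>f v\<bar> \<le> B" and C: "\<And>v. \<bar>g v\<bar> \<le> C"
    using trig_sum_bounded[OF add.hyps(1)] trig_sum_bounded[OF add.hyps(2)] by auto
  note fg = trig_sum_continuous[OF add.hyps(1)] trig_sum_continuous[OF add.hyps(2)]
  have "integrable M (\<lambda>\<omega>. f (Z n \<omega>))" "integrable M (\<lambda>\<omega>. g (Z n \<omega>))"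
    "integrable N (\<lambda>\<omega>. f (Z0 \<omega>))" "integrable N (\<lambda>\<omega>. g (Z0 \<omega>))" for n
    by (rule M.integrable_continuous_bounded[OF fg(1) B Z] M.integrable_continuous_bounded[OF fg(2) C Z]
        N.integrable_continuous_bounded[OF fg(1) B Z0] N.integrable_continuous_bounded[OF fg(2) C Z0])+
  then show ?case using tendsto_add[OF add.IH] by simp
qed

text \<open>Sines of the rescaled coordinates turn polynomials into trigonometric sums, so that an
  approximation on a ball by Stone--Weierstrass remains bounded off that ball.\<close>

lemma cramer_wold:
  fixes Z :: "nat \<Rightarrow> 'w \<Rightarrow> real ^ 'p" and Z0 :: "'v \<Rightarrow> real ^ 'p"
  assumes "prob_space M" "prob_space N"
    and Z: "\<And>n. Z n \<in> borel_measurable M" and Z0: "Z0 \<in> borel_measurable N"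
    and tight: "bounded_in_probability M Z"
    and conv: "\<And>t c. (\<lambda>n. \<integral>\<omega>. cos (t \<bullet> Z n \<omega> + c) \<partial>M) \<longlonglongrightarrow> (\<integral>\<omega>. cos (t \<bullet> Z0 \<omega> + c) \<partial>N)"
  shows "converges_in_distribution M Z N Z0"
  unfolding converges_in_distribution_def
proof (intro conjI allI impI Z Z0)
  fix f :: "real ^ 'p \<Rightarrow> real"
  assume f: "continuous_on UNIV f" and "bounded (range f)"
  then obtain B where B: "\<And>v. \<bar>f v\<bar> \<le> B" unfolding bounded_iff real_norm_def by blast
  have "0 \<le> B" using abs_ge_zero[of "f 0"] B[of 0] by linarith
  interpret M: prob_space M by fact
  interpret N: prob_space N by fact
  note [measurable] = Z Z0
  show "(\<lambda>n. \<integral>\<omega>. f (Z n \<omega>) \<partial>M) \<longlonglongrightarrow> (\<integral>\<omega>. f (Z0 \<omega>) \<partial>N)"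
  proof (rule tendstoI)
    fix r :: real assume "0 < r"
    \<comment> \<open>Each of the two replacements of \<open>f\<close> by a trigonometric sum will
      cost at most e + (2B + 1) e, and the convergence for that sum costs e: in total (5 + 4B) e.
      The minimum with 1 bounds 2B + e by 2B + 1.\<close>
    define e where "e = min 1 (r / (5 + 4 * B))"
    have e: "0 < e" "e \<le> 1" using \<open>0 \<le> B\<close> \<open>0 < r\<close> unfolding e_def by (simp_all add: add_pos_nonneg)
    have "e \<le> r / (5 + 4 * B)" by (simp add: e_def)
    then have er: "e * (5 + 4 * B) \<le> r" using \<open>0 \<le> B\<close> by (simp add: pos_le_divide_eq)
    obtain K1 where K1: "\<forall>\<^sub>F n in sequentially. M.prob {\<omega> \<in> space M. norm (Z n \<omega>) > K1} < e"
      using tight e(1) unfolding bounded_in_probability_def by blast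
    obtain K2 where K2: "N.prob {\<omega> \<in> space N. norm (Z0 \<omega>) > K2} < e"
      using N.tight_single[OF Z0 e(1)] .
    define L where "L = max 1 (max K1 K2)"
    have L: "0 < L" "K1 \<le> L" "K2 \<le> L" by (auto simp: L_def)
    have tM: "\<forall>\<^sub>F n in sequentially. M.prob {\<omega> \<in> space M. norm (Z n \<omega>) > L} < e"
      using K1
    proof eventually_elim
      case (elim n)
      have "M.prob {\<omega> \<in> space M. norm (Z n \<omega>) > L} \<le> M.prob {\<omega> \<in> space M. norm (Z n \<omega>) > K1}"
        using L(2) by (intro M.finite_measure_mono) (force, measurable)
      with elim show ?case by simp
    qed
    have "N.prob {\<omega> \<in> space N. norm (Z0 \<omega>) > L} \<le> N.prob {\<omega> \<in> space N. norm (Z0 \<omega>) > K2}"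
      using L(3) by (intro N.finite_measure_mono) (force, measurable)
    with K2 have tN: "N.prob {\<omega> \<in> space N. norm (Z0 \<omega>) > L} \<le> e" by simp
    obtain h where h: "trig_sum h" "\<And>v. \<bar>h v\<bar> \<le> B + e" "\<And>v. norm v \<le> L \<Longrightarrow> \<bar>f v - h v\<bar> \<le> e"
      using trig_sum_approx[OF f B e(1) L(1)] by metis
    have diff: "\<bar>f v - h v\<bar> \<le> e + (2 * B + e) * indicator {v. norm v > L} v" for v
    proof (cases "norm v > L")
      case True
      then show ?thesis using B[of v] h(2)[of v] e by (simp add: indicator_def)
    next
      case False
      then show ?thesis using h(3)[of v] by (simp add: indicator_def)
    qed
    have hc: "continuous_on UNIV h" by (rule trig_sum_continuous[OF h(1)])
    have dM: "\<bar>(\<integral>\<omega>. f (Z n \<omega>) \<partial>M) - (\<integral>\<omega>. h (Z n \<omega>) \<partial>M)\<bar>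
        \<le> e + (2 * B + e) * M.prob {\<omega> \<in> space M. norm (Z n \<omega>) > L}" for n
    proof (rule M.expectation_close)
      show "\<bar>f (Z n \<omega>) - h (Z n \<omega>)\<bar> \<le> e + (2 * B + e) * indicator {\<omega> \<in> space M. L < norm (Z n \<omega>)} \<omega>"
        if "\<omega> \<in> space M" for \<omega>
        using diff[of "Z n \<omega>"] that by (simp add: indicator_def)
      show "{\<omega> \<in> space M. L < norm (Z n \<omega>)} \<in> M.events" by measurable
    qed (rule M.integrable_continuous_bounded[OF f B Z] M.integrable_continuous_bounded[OF hc h(2) Z])+
    have dN: "\<bar>(\<integral>\<omega>. f (Z0 \<omega>) \<partial>N) - (\<integral>\<omega>. h (Z0 \<omega>) \<partial>N)\<bar>
        \<le> e + (2 * B + e) * N.prob {\<omega> \<in> space N. norm (Z0 \<omega>) > L}"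
    proof (rule N.expectation_close)
      show "\<bar>f (Z0 \<omega>) - h (Z0 \<omega>)\<bar> \<le> e + (2 * B + e) * indicator {\<omega> \<in> space N. L < norm (Z0 \<omega>)} \<omega>"
        if "\<omega> \<in> space N" for \<omega>
        using diff[of "Z0 \<omega>"] that by (simp add: indicator_def)
      show "{\<omega> \<in> space N. L < norm (Z0 \<omega>)} \<in> N.events" by measurable
    qed (rule N.integrable_continuous_bounded[OF f B Z0] N.integrable_continuous_bounded[OF hc h(2) Z0])+
    have bound: "e + (2 * B + e) * p \<le> e + (2 * B + 1) * e" if "0 \<le> p" "p \<le> e" for p
      using mult_mono[of "2 * B + e" "2 * B + 1" p e] that e \<open>0 \<le> B\<close> by simp
    have dN': "\<bar>(\<integral>\<omega>. f (Z0 \<omega>) \<partial>N) - (\<integral>\<omega>. h (Z0 \<omega>) \<partial>N)\<bar> \<le> e + (2 * B + 1) * e"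
      by (rule order_trans[OF dN bound[OF measure_nonneg tN]])
    have "(\<lambda>n. \<integral>\<omega>. h (Z n \<omega>) \<partial>M) \<longlonglongrightarrow> (\<integral>\<omega>. h (Z0 \<omega>) \<partial>N)"
      by (rule trig_sum_expectation_tendsto[OF assms(1,2) Z Z0 conv h(1)])
    then have "\<forall>\<^sub>F n in sequentially. dist (\<integral>\<omega>. h (Z n \<omega>) \<partial>M) (\<integral>\<omega>. h (Z0 \<omega>) \<partial>N) < e"
      using e(1) by (rule tendstoD)
    with tM show "\<forall>\<^sub>F n in sequentially. dist (\<integral>\<omega>. f (Z n \<omega>) \<partial>M) (\<integral>\<omega>. f (Z0 \<omega>) \<partial>N) < r"
    proof eventually_elim
      case (elim n)
      have dM': "\<bar>(\<integral>\<omega>. f (Z n \<omega>) \<partial>M) - (\<integral>\<omega>. h (Z n \<omega>) \<partial>M)\<bar> \<le> e + (2 * B + 1) * e"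
        by (rule order_trans[OF dM bound[OF measure_nonneg less_imp_le[OF elim(1)]]])
      have aux: "\<bar>p - q\<bar> \<le> d \<Longrightarrow> \<bar>p' - q'\<bar> \<le> d \<Longrightarrow> \<bar>q - q'\<bar> < e \<Longrightarrow> \<bar>p - p'\<bar> < e + 2 * d"
        for p q p' q' d :: real by linarith
      have "\<bar>(\<integral>\<omega>. f (Z n \<omega>) \<partial>M) - (\<integral>\<omega>. f (Z0 \<omega>) \<partial>N)\<bar> < e + 2 * (e + (2 * B + 1) * e)"
        by (rule aux[OF dM' dN' elim(2)[unfolded dist_real_def]])
      also have "\<dots> = e * (5 + 4 * B)" by (simp add: algebra_simps)
      finally show ?case using er by (simp add: dist_real_def)
    qed
  qed
qed

subsection \<open>Limit theorems for independent copies\<close>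

text \<open>Serves to pass from the sample numbered from 1 to one numbered by all naturals. A finite
  subfamily of the reindexed variables is a finite subfamily of the original ones, with the test
  sets carried over by the inverse of the injection.\<close>

lemma (in prob_space) indep_vars_reindex:
  assumes X: "indep_vars M' X (f ` I)" and f: "inj_on f I"
  shows "indep_vars (\<lambda>i. M' (f i)) (\<lambda>i. X (f i)) I"
proof -
  let ?F = "\<lambda>i. {X i -` A \<inter> space M |A. A \<in> sets (M' i)}"
  have rv: "\<And>i. i \<in> I \<Longrightarrow> random_variable (M' (f i)) (X (f i))"
    and ev: "\<And>i. i \<in> I \<Longrightarrow> ?F (f i) \<subseteq> events"
    and pr: "\<And>J A. J \<subseteq> f ` I \<Longrightarrow> J \<noteq> {} \<Longrightarrow> finite J \<Longrightarrow> A \<in> Pi J ?F \<Longrightarrow>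
      prob (\<Inter>j\<in>J. A j) = (\<Prod>j\<in>J. prob (A j))"
    using X unfolding indep_vars_def2 indep_sets_def by auto
  have "prob (\<Inter>j\<in>J. A j) = (\<Prod>j\<in>J. prob (A j))"
    if J: "J \<subseteq> I" "J \<noteq> {}" "finite J" and A: "A \<in> (\<Pi> j\<in>J. ?F (f j))" for J A
  proof -
    have inj: "inj_on f J" using f J(1) by (rule inj_on_subset)
    have inv: "the_inv_into J f (f j) = j" if "j \<in> J" for j
      using inj that by (rule the_inv_into_f_f)
    have "prob (\<Inter>i\<in>f ` J. A (the_inv_into J f i)) = (\<Prod>i\<in>f ` J. prob (A (the_inv_into J f i)))"
      using J A by (intro pr) (auto simp: inv Pi_iff)
    then show ?thesis
      by (simp add: inv prod.reindex[OF inj] image_image cong: INF_cong_simp)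
  qed
  then show ?thesis
    using rv ev unfolding indep_vars_def2 indep_sets_def by blast
qed

lemma (in prob_space) expectation_sum_square:
  fixes X :: "'i \<Rightarrow> 'a \<Rightarrow> real"
  assumes I: "finite I" and indep: "indep_vars (\<lambda>_. borel) X I"
    and sq: "\<And>i. i \<in> I \<Longrightarrow> integrable M (\<lambda>\<omega>. (X i \<omega>)\<^sup>2)"
    and mean: "\<And>i. i \<in> I \<Longrightarrow> expectation (X i) = 0"
  shows "integrable M (\<lambda>\<omega>. (\<Sum>i\<in>I. X i \<omega>)\<^sup>2)"
    and "expectation (\<lambda>\<omega>. (\<Sum>i\<in>I. X i \<omega>)\<^sup>2) = (\<Sum>i\<in>I. expectation (\<lambda>\<omega>. (X i \<omega>)\<^sup>2))"
proof -
  have rv: "random_variable borel (X i)" if "i \<in> I" for i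
    using indep that unfolding indep_vars_def2 by simp
  have int: "integrable M (X i)" if "i \<in> I" for i
    by (rule square_integrable_imp_integrable[OF rv sq]) (use that in auto)
  have pair: "integrable M (\<lambda>\<omega>. X i \<omega> * X j \<omega>) \<and> expectation (\<lambda>\<omega>. X i \<omega> * X j \<omega>)
      = (if i = j then expectation (\<lambda>\<omega>. (X i \<omega>)\<^sup>2) else 0)" if "i \<in> I" "j \<in> I" for i j
  proof (cases "i = j")
    case True
    then show ?thesis using sq that by (simp add: power2_eq_square)
  next
    case False
    have "indep_vars (\<lambda>_. borel) X {i, j}"
      using indep by (rule indep_vars_subset) (use that in auto)
    from indep_vars_integrable[OF _ this] indep_vars_lebesgue_integral[OF _ this] False mean int that
    show ?thesis by auto
  qed
  have eq: "(\<lambda>\<omega>. (\<Sum>i\<in>I. X i \<omega>)\<^sup>2) = (\<lambda>\<omega>. \<Sum>i\<in>I. \<Sum>j\<in>I. X i \<omega> * X j \<omega>)"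
    by (simp add: power2_eq_square sum_product)
  show "integrable M (\<lambda>\<omega>. (\<Sum>i\<in>I. X i \<omega>)\<^sup>2)"
    unfolding eq using pair by auto
  show "expectation (\<lambda>\<omega>. (\<Sum>i\<in>I. X i \<omega>)\<^sup>2) = (\<Sum>i\<in>I. expectation (\<lambda>\<omega>. (X i \<omega>)\<^sup>2))"
    unfolding eq using pair I by (simp add: sum.delta)
qed

lemma (in prob_space) prob_le_sum2:
  assumes "\<And>\<omega>. \<omega> \<in> space M \<Longrightarrow> P \<omega> \<Longrightarrow> Q \<omega> \<or> R \<omega>"
    and "{\<omega> \<in> space M. Q \<omega>} \<in> events" "{\<omega> \<in> space M. R \<omega>} \<in> events"
  shows "prob {\<omega> \<in> space M. P \<omega>} \<le> prob {\<omega> \<in> space M. Q \<omega>} + prob {\<omega> \<in> space M. R \<omega>}"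
proof -
  have "prob {\<omega> \<in> space M. P \<omega>} \<le> prob ({\<omega> \<in> space M. Q \<omega>} \<union> {\<omega> \<in> space M. R \<omega>})"
    using assms by (intro finite_measure_mono) auto
  also have "\<dots> \<le> prob {\<omega> \<in> space M. Q \<omega>} + prob {\<omega> \<in> space M. R \<omega>}"
    using assms by (intro measure_Un_le)
  finally show ?thesis .
qed

section \<open>Weak law and central limit theorem for functions of an i.i.d. sample\<close>

text \<open>The common law is a parameter of its own, so that moment conditions are stated once, as
  integrals over \<open>D\<close>, and not for every index.\<close>

locale iid_sample = prob_space M for M :: "'a measure" +
  fixes U :: "nat \<Rightarrow> 'a \<Rightarrow> 'b::{second_countable_topology, topological_space}" and D :: "'b measure"
  assumes indep: "indep_vars (\<lambda>_. borel) U UNIV"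
    and law: "\<And>i. distr M borel (U i) = D"
begin

lemma measurable_U [measurable]: "U i \<in> borel_measurable M"
  using indep unfolding indep_vars_def2 by simp

lemma sets_D [measurable_cong]: "sets D = sets borel"
  using law[of 0] by (metis sets_distr)

lemma prob_space_D: "prob_space D"
  using prob_space_distr[OF measurable_U, of 0] law by simp

lemma integrable_U_iff:
  fixes h :: "'b \<Rightarrow> real"
  assumes [measurable]: "h \<in> borel_measurable borel"
  shows "integrable M (\<lambda>\<omega>. h (U i \<omega>)) \<longleftrightarrow> integrable D h"
  unfolding law[of i, symmetric] by (rule integrable_distr_eq[symmetric]) auto

lemma expectation_U:
  fixes h :: "'b \<Rightarrow> real"
  assumes [measurable]: "h \<in> borel_measurable borel"
  shows "expectation (\<lambda>\<omega>. h (U i \<omega>)) = integral\<^sup>L D h"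
  unfolding law[of i, symmetric] by (rule integral_distr[symmetric]) auto

lemma AE_U:
  assumes "AE u in D. P u" "Measurable.pred borel P"
  shows "AE \<omega> in M. P (U i \<omega>)"
  using assms unfolding law[of i, symmetric] by (subst (asm) AE_distr_iff) auto

lemma indep_h:
  fixes h :: "'b \<Rightarrow> real"
  assumes [measurable]: "h \<in> borel_measurable borel"
  shows "indep_vars (\<lambda>_. borel) (\<lambda>i \<omega>. h (U i \<omega>)) I"
  by (rule indep_vars_subset[OF indep_vars_compose2[OF indep]]) auto

lemma expectation_sum_square_U:
  fixes h :: "'b \<Rightarrow> real"
  assumes h: "h \<in> borel_measurable borel" and sq: "integrable D (\<lambda>u. (h u)\<^sup>2)"
    and mean: "integral\<^sup>L D h = 0"
  shows "integrable M (\<lambda>\<omega>. (\<Sum>i<n. h (U i \<omega>))\<^sup>2)"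
    and "expectation (\<lambda>\<omega>. (\<Sum>i<n. h (U i \<omega>))\<^sup>2) = n * (\<integral>u. (h u)\<^sup>2 \<partial>D)"
proof -
  have [measurable]: "h \<in> borel_measurable borel" by fact
  have sqU: "integrable M (\<lambda>\<omega>. (h (U i \<omega>))\<^sup>2)" "expectation (\<lambda>\<omega>. (h (U i \<omega>))\<^sup>2) = (\<integral>u. (h u)\<^sup>2 \<partial>D)" for i
    using integrable_U_iff[of "\<lambda>u. (h u)\<^sup>2" i] expectation_U[of "\<lambda>u. (h u)\<^sup>2" i] sq by auto
  note * = expectation_sum_square[OF finite_lessThan indep_h[OF h], of n]
  show "integrable M (\<lambda>\<omega>. (\<Sum>i<n. h (U i \<omega>))\<^sup>2)"
    by (rule *(1)) (use sqU expectation_U[OF h] mean in auto)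
  show "expectation (\<lambda>\<omega>. (\<Sum>i<n. h (U i \<omega>))\<^sup>2) = n * (\<integral>u. (h u)\<^sup>2 \<partial>D)"
    by (subst *(2)) (use sqU expectation_U[OF h] mean in auto)
qed

text \<open>Markov's inequality. The bound is the same for all n, so a function with small integral
  has small averages at every sample size. At n = 0 the average is 0, as division by zero gives
  0.\<close>

lemma prob_mean_gt_le:
  fixes h :: "'b \<Rightarrow> real"
  assumes h: "h \<in> borel_measurable borel" "\<And>u. 0 \<le> h u" and int: "integrable D h" and c: "0 < c"
  shows "prob {\<omega> \<in> space M. (\<Sum>i<n. h (U i \<omega>)) / n > c} \<le> integral\<^sup>L D h / c"
proof (cases "n = 0")
  case True
  then show ?thesis using c by (simp add: integral_nonneg_AE h)
next
  case False
  have [measurable]: "h \<in> borel_measurable borel" by fact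
  have intU: "integrable M (\<lambda>\<omega>. h (U i \<omega>))" for i using integrable_U_iff h int by blast
  have "prob {\<omega> \<in> space M. (\<Sum>i<n. h (U i \<omega>)) / n > c} \<le> prob {\<omega> \<in> space M. (\<Sum>i<n. h (U i \<omega>)) / n \<ge> c}"
    by (intro finite_measure_mono) auto
  also have "\<dots> \<le> expectation (\<lambda>\<omega>. (\<Sum>i<n. h (U i \<omega>)) / n) / c"
    using intU h c by (intro integral_Markov_inequality_measure[where A = "{}"]) (auto intro!: divide_nonneg_nonneg sum_nonneg)
  also have "expectation (\<lambda>\<omega>. (\<Sum>i<n. h (U i \<omega>)) / n) = integral\<^sup>L D h"
    using intU False by (simp add: expectation_U[OF h(1)])
  finally show ?thesis .
qed

text \<open>Chebyshev's inequality: the second moment of the sum grows like n, while the threshold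
  squared grows like n^2.\<close>

lemma prob_mean_bounded_tendsto_0:
  fixes h :: "'b \<Rightarrow> real"
  assumes h: "h \<in> borel_measurable borel" and sq: "integrable D (\<lambda>u. (h u)\<^sup>2)"
    and mean: "integral\<^sup>L D h = 0" and e: "0 < e"
  shows "(\<lambda>n. prob {\<omega> \<in> space M. \<bar>(\<Sum>i<n. h (U i \<omega>)) / n\<bar> > e}) \<longlonglongrightarrow> 0"
proof (rule tendsto_sandwich[where f = "\<lambda>_. 0" and h = "\<lambda>n. ((\<integral>u. (h u)\<^sup>2 \<partial>D) / e\<^sup>2) / real n"])
  have [measurable]: "h \<in> borel_measurable borel" by fact
  show "\<forall>\<^sub>F n in sequentially. prob {\<omega> \<in> space M. \<bar>(\<Sum>i<n. h (U i \<omega>)) / n\<bar> > e} \<le> ((\<integral>u. (h u)\<^sup>2 \<partial>D) / e\<^sup>2) / n"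
    using eventually_gt_at_top[of 0]
  proof eventually_elim
    case (elim n)
    have "prob {\<omega> \<in> space M. \<bar>(\<Sum>i<n. h (U i \<omega>)) / n\<bar> > e} \<le> prob {\<omega> \<in> space M. \<bar>\<Sum>i<n. h (U i \<omega>)\<bar> \<ge> n * e}"
      using elim by (intro finite_measure_mono) (auto simp: field_simps)
    also have "\<dots> \<le> expectation (\<lambda>\<omega>. (\<Sum>i<n. h (U i \<omega>))\<^sup>2) / (n * e)\<^sup>2"
      using elim e by (intro second_moment_method expectation_sum_square_U[OF h sq mean]) auto
    also have "\<dots> = ((\<integral>u. (h u)\<^sup>2 \<partial>D) / e\<^sup>2) / n"
      using elim by (simp add: expectation_sum_square_U[OF h sq mean] power_mult_distrib)
        (simp add: power2_eq_square)
    finally show ?case .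
  qed
  show "(\<lambda>n. ((\<integral>u. (h u)\<^sup>2 \<partial>D) / e\<^sup>2) / real n) \<longlonglongrightarrow> 0"
    by (rule lim_const_over_n)
qed auto

text \<open>The truncating function \<open>k\<close> is separate from \<open>h\<close> because two
  cuts are made later: the weak law cuts where |h| itself is large, the Taylor remainder where the
  covariate is large.\<close>

lemma truncated_tail_small:
  fixes h :: "'b \<Rightarrow> real" and k :: "'b \<Rightarrow> real"
  assumes [measurable]: "h \<in> borel_measurable borel" "k \<in> borel_measurable borel"
    and int: "integrable D h" and e: "0 < e"
  obtains T :: real where "0 < T" "(\<integral>u. \<bar>h u\<bar> * indicator {u. k u > T} u \<partial>D) < e"
proof -
  have "(\<lambda>m. \<integral>u. \<bar>h u\<bar> * indicator {u. k u > real m} u \<partial>D) \<longlonglongrightarrow> (\<integral>u. 0 \<partial>D)"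
  proof (rule integral_dominated_convergence)
    show "integrable D (\<lambda>u. \<bar>h u\<bar>)" using int by simp
    show "AE u in D. (\<lambda>m. \<bar>h u\<bar> * indicator {u. k u > real m} u) \<longlonglongrightarrow> 0"
    proof (rule AE_I2)
      fix u
      have "\<forall>\<^sub>F m in sequentially. k u < real m"
        using filterlim_real_sequentially unfolding filterlim_at_top_dense by blast
      then have "\<forall>\<^sub>F m in sequentially. \<bar>h u\<bar> * indicator {u. k u > real m} u = 0"
        by eventually_elim simp
      then show "(\<lambda>m. \<bar>h u\<bar> * indicator {u. k u > real m} u) \<longlonglongrightarrow> 0"
        by (rule tendsto_eventually)
    qed
  qed (auto simp: indicator_def)
  then have "\<forall>\<^sub>F m in sequentially. (\<integral>u. \<bar>h u\<bar> * indicator {u. k u > real m} u \<partial>D) < e"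
    using e by (auto dest: order_tendstoD(2))
  with eventually_gt_at_top[of 0]
  have "\<forall>\<^sub>F m in sequentially. 0 < m \<and> (\<integral>u. \<bar>h u\<bar> * indicator {u. k u > real m} u \<partial>D) < e"
    by eventually_elim simp
  then obtain m :: nat where "0 < m" "(\<integral>u. \<bar>h u\<bar> * indicator {u. k u > real m} u \<partial>D) < e"
    by (auto simp: eventually_sequentially)
  then show ?thesis using that[of "real m"] by simp
qed

text \<open>Truncation at \<open>T\<close>: the centred bounded part \<open>g\<close> is handled by
  Chebyshev's inequality, the tail \<open>t\<close> by Markov's inequality, which asks only for a
  first moment.\<close>

lemma weak_law:
  fixes h :: "'b \<Rightarrow> real"
  assumes h [measurable]: "h \<in> borel_measurable borel" and int: "integrable D h"
  shows "converges_in_probability M (\<lambda>n \<omega>. (\<Sum>i<n. h (U i \<omega>)) / n) (integral\<^sup>L D h)"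
  unfolding converges_in_probability_def
proof (intro allI impI)
  fix e :: real assume e: "0 < e"
  interpret D: prob_space D by (rule prob_space_D)
  let ?P = "\<lambda>n. prob {\<omega> \<in> space M. dist ((\<Sum>i<n. h (U i \<omega>)) / n) (integral\<^sup>L D h) > e}"
  show "?P \<longlonglongrightarrow> 0"
  proof (rule tendstoI)
    fix r :: real assume r: "0 < r"
    \<comment> \<open>The bound e / 4 controls the shift of the mean caused by truncation; the bound
      e r / 8 makes the Markov estimate d / (e / 4) at most r / 2.\<close>
    define d where "d = min (e / 4) (e * r / 8)"
    have d: "0 < d" "d \<le> e / 4" "d \<le> e * r / 8" using e r by (auto simp: d_def)
    obtain T where T: "0 < T" "(\<integral>u. \<bar>h u\<bar> * indicator {u. \<bar>h u\<bar> > T} u \<partial>D) < d"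
      using truncated_tail_small[of h "\<lambda>u. \<bar>h u\<bar>" d] int d by auto
    define t where "t u = \<bar>h u\<bar> * indicator {u. \<bar>h u\<bar> > T} u" for u
    define s where "s u = h u * indicator {u. \<bar>h u\<bar> \<le> T} u" for u
    have [measurable]: "t \<in> borel_measurable borel" "s \<in> borel_measurable borel"
      unfolding t_def s_def by measurable
    have ti: "integrable D t" and si: "integrable D s"
      using int by (auto intro!: Bochner_Integration.integrable_bound[OF int] simp: t_def s_def indicator_def)
    have hst: "\<bar>h u - s u\<bar> \<le> t u" for u by (auto simp: t_def s_def indicator_def)
    define m where "m = integral\<^sup>L D s"
    have "\<bar>integral\<^sup>L D h - m\<bar> = \<bar>\<integral>u. h u - s u \<partial>D\<bar>"
      using int si by (simp add: m_def)
    also have "\<dots> \<le> (\<integral>u. \<bar>h u - s u\<bar> \<partial>D)" by (rule integral_abs_bound)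
    also have "\<dots> \<le> integral\<^sup>L D t" using int si ti hst by (intro integral_mono) auto
    finally have hm: "\<bar>integral\<^sup>L D h - m\<bar> < d" using T(2) by (simp add: t_def[symmetric])
    define g where "g u = s u - m" for u
    have [measurable]: "g \<in> borel_measurable borel" unfolding g_def by measurable
    have gb: "\<bar>g u\<bar> \<le> T + \<bar>m\<bar>" for u
      using T(1) by (auto simp: g_def s_def indicator_def abs_le_iff)
    have "(\<lambda>n. prob {\<omega> \<in> space M. \<bar>(\<Sum>i<n. g (U i \<omega>)) / n\<bar> > e / 2}) \<longlonglongrightarrow> 0"
    proof (rule prob_mean_bounded_tendsto_0)
      have "(g u)\<^sup>2 \<le> (T + \<bar>m\<bar>)\<^sup>2" for u
        using gb[of u] by (intro abs_le_square_iff[THEN iffD1]) auto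
      then show "integrable D (\<lambda>u. (g u)\<^sup>2)"
        by (intro D.integrable_const_bound[where B = "(T + \<bar>m\<bar>)\<^sup>2"]) auto
      show "integral\<^sup>L D g = 0" using si unfolding g_def by (simp add: m_def D.prob_space)
    qed (use e in auto)
    then have "\<forall>\<^sub>F n in sequentially. prob {\<omega> \<in> space M. \<bar>(\<Sum>i<n. g (U i \<omega>)) / n\<bar> > e / 2} < r / 2"
      using r by (auto dest: order_tendstoD(2)[where a = "r / 2"])
    then show "\<forall>\<^sub>F n in sequentially. dist (?P n) 0 < r"
      using eventually_gt_at_top[of 0]
    proof eventually_elim
      case (elim n)
      have "?P n \<le> prob {\<omega> \<in> space M. \<bar>(\<Sum>i<n. g (U i \<omega>)) / n\<bar> > e / 2}
          + prob {\<omega> \<in> space M. (\<Sum>i<n. t (U i \<omega>)) / n > e / 4}"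
      proof (rule prob_le_sum2)
        fix \<omega> assume *: "dist ((\<Sum>i<n. h (U i \<omega>)) / n) (integral\<^sup>L D h) > e"
        have "\<bar>(\<Sum>i<n. h (U i \<omega>)) / n - (\<Sum>i<n. s (U i \<omega>)) / n\<bar> = \<bar>\<Sum>i<n. h (U i \<omega>) - s (U i \<omega>)\<bar> / n"
          by (simp add: sum_subtractf diff_divide_distrib[symmetric])
        also have "\<dots> \<le> (\<Sum>i<n. t (U i \<omega>)) / n"
          by (intro divide_right_mono order_trans[OF sum_abs] sum_mono hst) auto
        finally have 1: "\<bar>(\<Sum>i<n. h (U i \<omega>)) / n - (\<Sum>i<n. s (U i \<omega>)) / n\<bar> \<le> (\<Sum>i<n. t (U i \<omega>)) / n" .
        have 2: "(\<Sum>i<n. g (U i \<omega>)) / n = (\<Sum>i<n. s (U i \<omega>)) / n - m"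
          using elim by (simp add: g_def sum_subtractf diff_divide_distrib)
        show "\<bar>(\<Sum>i<n. g (U i \<omega>)) / n\<bar> > e / 2 \<or> (\<Sum>i<n. t (U i \<omega>)) / n > e / 4"
          using * 1 2 hm d(2) unfolding dist_real_def by arith
      qed auto
      also have "prob {\<omega> \<in> space M. (\<Sum>i<n. t (U i \<omega>)) / n > e / 4} \<le> integral\<^sup>L D t / (e / 4)"
        using e by (intro prob_mean_gt_le ti) (auto simp: t_def)
      also have "\<dots> \<le> (e * r / 8) / (e / 4)"
        using T(2) d(3) e by (intro divide_right_mono) (auto simp: t_def[symmetric])
      also have "\<dots> = r / 2" using e by simp
      finally show ?case using elim(1) by (simp add: dist_real_def)
    qed
  qed
qed

text \<open>The limit is written with the same case distinction as
  \<open>multivariate_normal\<close>. If the variance is 0 there is nothing to normalize by, but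
  then \<open>h\<close> vanishes almost surely and all sums are 0. The phase \<open>c\<close> covers
  sines too, so cosines alone determine the limit law.\<close>

lemma clt_cos:
  fixes h :: "'b \<Rightarrow> real"
  assumes h [measurable]: "h \<in> borel_measurable borel" and sq: "integrable D (\<lambda>u. (h u)\<^sup>2)"
    and mean: "integral\<^sup>L D h = 0"
  defines "v \<equiv> (\<integral>u. (h u)\<^sup>2 \<partial>D)"
  shows "(\<lambda>n. expectation (\<lambda>\<omega>. cos ((\<Sum>i<n. h (U i \<omega>)) / sqrt n + c))) \<longlonglongrightarrow>
    (\<integral>s. cos (s + c) \<partial>(if v = 0 then return borel 0
      else density lborel (\<lambda>s. ennreal (normal_density 0 (sqrt v) s))))"
proof (cases "v = 0")
  case True
  have "AE u in D. (h u)\<^sup>2 = 0"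
    using True integral_nonneg_eq_0_iff_AE[OF sq] unfolding v_def by simp
  then have 0: "AE \<omega> in M. h (U i \<omega>) = 0" for i
    by (intro AE_U) auto
  have "AE \<omega> in M. \<forall>i. h (U i \<omega>) = 0"
    using 0 by (simp add: AE_all_countable)
  then have "expectation (\<lambda>\<omega>. cos ((\<Sum>i<n. h (U i \<omega>)) / sqrt n + c)) = expectation (\<lambda>\<omega>. cos c)" for n
    by (intro integral_cong_AE) (auto elim!: eventually_mono)
  then show ?thesis
    using True by (simp add: prob_space integral_return)
next
  case False
  then have v: "0 < v" unfolding v_def
    by (metis integral_nonneg_AE AE_I2 zero_le_power2 less_eq_real_def)
  have "weak_conv_m (\<lambda>n. distr M borel (\<lambda>\<omega>. (\<Sum>i<n. h (U i \<omega>)) / sqrt (n * (sqrt v)\<^sup>2))) std_normal_distribution"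
  proof (rule central_limit_theorem_zero_mean[where \<mu> = "distr D borel h"])
    show "indep_vars (\<lambda>i. borel) (\<lambda>i \<omega>. h (U i \<omega>)) UNIV" by (rule indep_h) fact
    show E0: "expectation (\<lambda>\<omega>. h (U i \<omega>)) = 0" for i by (simp add: expectation_U mean)
    show "integrable M (\<lambda>\<omega>. (h (U i \<omega>))\<^sup>2)" for i
      using integrable_U_iff[of "\<lambda>u. (h u)\<^sup>2" i] sq by simp
    show "variance (\<lambda>\<omega>. h (U i \<omega>)) = (sqrt v)\<^sup>2" for i
      using expectation_U[of "\<lambda>u. (h u)\<^sup>2" i] v unfolding E0 by (simp add: v_def)
    show "distr M borel (\<lambda>\<omega>. h (U i \<omega>)) = distr D borel h" for i
      unfolding law[of i, symmetric] by (subst distr_distr) (auto simp: comp_def)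
  qed (use v in auto)
  then have "(\<lambda>n. \<integral>s. cos (sqrt v * s + c) \<partial>distr M borel (\<lambda>\<omega>. (\<Sum>i<n. h (U i \<omega>)) / sqrt (n * (sqrt v)\<^sup>2)))
      \<longlonglongrightarrow> (\<integral>s. cos (sqrt v * s + c) \<partial>std_normal_distribution)"
    by (intro weak_conv_imp_integral_bdd_continuous_conv[where B = 1])
      (auto intro!: real_distribution_distr real_dist_normal_dist continuous_intros)
  moreover have "(\<integral>s. cos (sqrt v * s + c) \<partial>distr M borel (\<lambda>\<omega>. (\<Sum>i<n. h (U i \<omega>)) / sqrt (n * (sqrt v)\<^sup>2)))
      = expectation (\<lambda>\<omega>. cos ((\<Sum>i<n. h (U i \<omega>)) / sqrt n + c))" for n
    using v by (subst integral_distr) (auto simp: real_sqrt_mult intro!: Bochner_Integration.integral_cong)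
  \<comment> \<open>The central limit theorem normalizes to variance 1. The factor sqrt v was put
    into the test function, and here it is moved into the law.\<close>
  moreover have "(\<integral>s. cos (sqrt v * s + c) \<partial>std_normal_distribution)
      = (\<integral>s. cos (s + c) \<partial>density lborel (\<lambda>s. ennreal (normal_density 0 (sqrt v) s)))"
  proof -
    interpret S: prob_space std_normal_distribution
      by (rule prob_space_normal_density) simp
    have "distributed std_normal_distribution lborel (\<lambda>s. s) (normal_density 0 1)"
      by (simp add: distributed_def distr_id2)
    from S.normal_density_affine[OF this, of "sqrt v" 0] v
    have eq: "distr std_normal_distribution lborel (\<lambda>s. sqrt v * s)
        = density lborel (\<lambda>s. ennreal (normal_density 0 (sqrt v) s))"
      by (simp add: distributed_def)
    then show ?thesis
      by (subst eq[symmetric], subst integral_distr) auto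
  qed
  ultimately show ?thesis using v by simp
qed

text \<open>Tightness holds because the expected squared norm of the normalized sum is at most the
  sum \<open>C\<close> of the coordinate variances, for every n. For the limit, each wave of the
  vector sum is a wave of the scalar sum of \<open>t \<bullet> h\<close>, and the variance of the
  latter is the quadratic form of the covariance matrix.\<close>

lemma
  fixes h :: "'b \<Rightarrow> real ^ 'p"
  assumes h [measurable]: "h \<in> borel_measurable borel"
    and sq: "integrable D (\<lambda>u. (norm (h u))\<^sup>2)"
    and mean: "\<And>a. (\<integral>u. a \<bullet> h u \<partial>D) = 0"
  shows bounded_in_probability_vector_sum:
      "bounded_in_probability M (\<lambda>n \<omega>. (\<Sum>i<n. h (U i \<omega>)) /\<^sub>R sqrt n)"
    and vector_clt: "prob_space N \<Longrightarrow> multivariate_normal N W 0 \<Sigma> \<Longrightarrow>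
      (\<And>a. (\<integral>u. (a \<bullet> h u)\<^sup>2 \<partial>D) = a \<bullet> (\<Sigma> *v a)) \<Longrightarrow>
      converges_in_distribution M (\<lambda>n \<omega>. (\<Sum>i<n. h (U i \<omega>)) /\<^sub>R sqrt n) N W"
proof -
  let ?S = "\<lambda>n \<omega>. (\<Sum>i<n. h (U i \<omega>)) /\<^sub>R sqrt (real n)"
  have comp: "integrable D (\<lambda>u. (a \<bullet> h u)\<^sup>2)" for a
  proof (rule Bochner_Integration.integrable_bound[OF integrable_mult_right[OF sq, of "(norm a)\<^sup>2"]])
    show "AE u in D. norm ((a \<bullet> h u)\<^sup>2) \<le> norm ((norm a)\<^sup>2 * (norm (h u))\<^sup>2)"
      using Cauchy_Schwarz_ineq by (auto simp: power2_norm_eq_inner)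
  qed auto
  note sum_sq = expectation_sum_square_U[OF _ comp mean]
  have comp_nth: "h u $ j = axis j 1 \<bullet> h u" for u j by (simp add: inner_axis')
  have norm_S: "(norm (?S n \<omega>))\<^sup>2 = (\<Sum>j\<in>UNIV. (\<Sum>i<n. axis j 1 \<bullet> h (U i \<omega>))\<^sup>2 / n)" for n \<omega>
  proof -
    have "(norm (?S n \<omega>))\<^sup>2 = (\<Sum>j\<in>UNIV. (?S n \<omega> $ j)\<^sup>2)"
      by (simp add: norm_vec_def L2_set_def sum_nonneg)
    also have "\<dots> = (\<Sum>j\<in>UNIV. (\<Sum>i<n. h (U i \<omega>) $ j)\<^sup>2 / n)"
      by (simp add: power_mult_distrib power_inverse divide_inverse mult.commute)
    finally show ?thesis by (simp only: comp_nth)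
  qed
  have S_int: "integrable M (\<lambda>\<omega>. (norm (?S n \<omega>))\<^sup>2)" for n
    unfolding norm_S by (intro Bochner_Integration.integrable_sum integrable_divide sum_sq) auto
  define C where "C = (\<Sum>j\<in>UNIV. \<integral>u. (axis j 1 \<bullet> h u)\<^sup>2 \<partial>D)"
  have C0: "0 \<le> C" unfolding C_def by (intro sum_nonneg integral_nonneg_AE) auto
  have S_exp: "expectation (\<lambda>\<omega>. (norm (?S n \<omega>))\<^sup>2) \<le> C" for n
    unfolding norm_S C_def using C0[unfolded C_def]
    by (cases "n = 0") (auto simp: sum_sq)
  have tail: "prob {\<omega> \<in> space M. norm (?S n \<omega>) > K} \<le> C / K\<^sup>2" if "0 < K" for n K
  proof -
    have "prob {\<omega> \<in> space M. norm (?S n \<omega>) > K} \<le> prob {\<omega> \<in> space M. \<bar>norm (?S n \<omega>)\<bar> \<ge> K}"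
      by (intro finite_measure_mono) auto
    also have "\<dots> \<le> expectation (\<lambda>\<omega>. (norm (?S n \<omega>))\<^sup>2) / K\<^sup>2"
      using that S_int by (intro second_moment_method) auto
    also have "\<dots> \<le> C / K\<^sup>2" using S_exp by (intro divide_right_mono) auto
    finally show ?thesis .
  qed
  show tight: "bounded_in_probability M ?S"
    unfolding bounded_in_probability_def
  proof (intro allI impI)
    fix e :: real assume e: "0 < e"
    \<comment> \<open>Then C / K^2 = e C / (C + 1) < e. The summand 1 keeps \<open>K\<close>
      positive when C = 0.\<close>
    define K where "K = sqrt ((C + 1) / e)"
    have K: "0 < K" "K\<^sup>2 = (C + 1) / e" using C0 e by (auto simp: K_def)
    have "C / K\<^sup>2 < e" using C0 e unfolding K(2) by (simp add: field_simps)
    then show "\<exists>K. \<forall>\<^sub>F n in sequentially. prob {\<omega> \<in> space M. norm (?S n \<omega>) > K} < e"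
      using tail[OF K(1)] by (intro exI[of _ K] always_eventually) (auto intro: le_less_trans)
  qed
  assume N: "prob_space N" and W: "multivariate_normal N W 0 \<Sigma>"
    and cov: "\<And>a. (\<integral>u. (a \<bullet> h u)\<^sup>2 \<partial>D) = a \<bullet> (\<Sigma> *v a)"
  interpret N: prob_space N by fact
  have [measurable]: "W \<in> borel_measurable N" using W by (simp add: multivariate_normal_def)
  show "converges_in_distribution M ?S N W"
  proof (rule cramer_wold[OF prob_space_axioms N _ _ tight])
    fix t :: "real ^ 'p" and c
    have distr_W: "(if a \<bullet> (\<Sigma> *v a) = 0 then return borel 0
      else density lborel (\<lambda>s. ennreal (normal_density 0 (sqrt (a \<bullet> (\<Sigma> *v a))) s)))
      = distr N borel (\<lambda>\<omega>. a \<bullet> W \<omega>)" for a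
      using W by (simp add: multivariate_normal_def)
    have "(\<integral>\<omega>. cos (t \<bullet> W \<omega> + c) \<partial>N) = (\<integral>s. cos (s + c) \<partial>distr N borel (\<lambda>\<omega>. t \<bullet> W \<omega>))"
      by (subst integral_distr) auto
    moreover have "(\<lambda>n. expectation (\<lambda>\<omega>. cos ((\<Sum>i<n. t \<bullet> h (U i \<omega>)) / sqrt n + c)))
      \<longlonglongrightarrow> (\<integral>s. cos (s + c) \<partial>distr N borel (\<lambda>\<omega>. t \<bullet> W \<omega>))"
      using clt_cos[OF _ comp mean, of t c] unfolding cov distr_W by simp
    ultimately show "(\<lambda>n. expectation (\<lambda>\<omega>. cos (t \<bullet> ?S n \<omega> + c))) \<longlonglongrightarrow> (\<integral>\<omega>. cos (t \<bullet> W \<omega> + c) \<partial>N)"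
      by (simp add: inner_sum_right divide_inverse mult.commute)
  qed auto
qed

end

subsection \<open>The penalty and the limit process\<close>

lemma sign_penalty_scale: "sign_penalty l \<beta> = l * sign_penalty 1 \<beta>"
  by (simp add: sign_penalty_def)

lemma sign_penalty_eq_sum_J_ratio:
  "\<beta> \<noteq> 0 \<Longrightarrow> sign_penalty 1 \<beta> = (\<Sum>l\<in>UNIV. J_ratio l \<beta>)"
  by (simp add: sign_penalty_def J_ratio_def sum_divide_distrib)

lemma inner_q_vec:
  "v \<bullet> q_vec \<beta> z = (\<Sum>l\<in>UNIV. if \<beta> $ l = 0 then v $ l * sgn (z $ l) / norm \<beta> else v \<bullet> grad_J l \<beta>)"
  unfolding q_vec_def inner_sum_right
  by (intro sum.cong) (auto simp: inner_axis)

text \<open>Paired with \<open>z\<close> itself, the jumps of the sign disappear, since z_l sgn(z_l)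
  = |z_l|. The penalty part of the limit process is therefore continuous and convex, although
  \<open>q_vec\<close> is discontinuous in general.\<close>

lemma inner_q_vec_self:
  "z \<bullet> q_vec \<beta> z = (\<Sum>l\<in>UNIV. if \<beta> $ l = 0 then \<bar>z $ l\<bar> / norm \<beta> else z \<bullet> grad_J l \<beta>)"
  unfolding inner_q_vec by (intro sum.cong) (auto simp: abs_sgn)

text \<open>Homogeneity of degree one is what balances the rates: with h = z / sqrt n, the product
  of n \<lambda> and h.q(h) equals (sqrt n \<lambda>) z.q(z).\<close>

lemma inner_q_vec_scale:
  "0 \<le> c \<Longrightarrow> (c *\<^sub>R z) \<bullet> q_vec \<beta> (c *\<^sub>R z) = c * (z \<bullet> q_vec \<beta> z)"
  unfolding inner_q_vec_self sum_distrib_left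
  by (intro sum.cong) (auto simp: abs_mult)

text \<open>At a zero coordinate the numerator is |h_l| exactly and only the denominator varies,
  continuously because \<beta> is nonzero. At a nonzero coordinate this is differentiability. The
  error is o(|h|) uniformly in direction, as needed for uniformity over bounded z.\<close>

lemma J_ratio_expansion:
  fixes \<beta> :: "real ^ 'p"
  assumes \<beta>: "\<beta> \<noteq> 0" and e: "0 < e"
  shows "\<forall>\<^sub>F h in nhds 0. \<bar>J_ratio l (\<beta> + h) - J_ratio l \<beta>
    - (if \<beta> $ l = 0 then \<bar>h $ l\<bar> / norm \<beta> else h \<bullet> grad_J l \<beta>)\<bar> \<le> e * norm h"
proof (cases "\<beta> $ l = 0")
  case True
  have "((\<lambda>h. inverse (norm (\<beta> + h))) \<longlongrightarrow> inverse (norm (\<beta> + 0))) (nhds 0)"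
    using \<beta> by (intro tendsto_intros tendsto_ident_at filterlim_ident) auto
  then have "\<forall>\<^sub>F h in nhds 0. dist (inverse (norm (\<beta> + h))) (inverse (norm \<beta>)) < e"
    using e by (auto dest: tendstoD)
  then show ?thesis
  proof eventually_elim
    case (elim h)
    have "J_ratio l (\<beta> + h) - J_ratio l \<beta> - \<bar>h $ l\<bar> / norm \<beta>
      = \<bar>h $ l\<bar> * (inverse (norm (\<beta> + h)) - inverse (norm \<beta>))"
      using True by (simp add: J_ratio_def divide_inverse algebra_simps)
    then have "\<bar>J_ratio l (\<beta> + h) - J_ratio l \<beta> - \<bar>h $ l\<bar> / norm \<beta>\<bar>
      = \<bar>h $ l\<bar> * dist (inverse (norm (\<beta> + h))) (inverse (norm \<beta>))"
      by (simp add: abs_mult dist_real_def)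
    also have "\<dots> \<le> norm h * e"
      using elim by (intro mult_mono component_le_norm_cart) auto
    finally show ?case using True by (simp add: mult.commute)
  qed
next
  case False
  from has_derivative_J_ratio[OF this] e obtain d where "0 < d"
    and d: "\<And>y. norm (y - \<beta>) < d \<Longrightarrow>
      norm (J_ratio l y - J_ratio l \<beta> - grad_J l \<beta> \<bullet> (y - \<beta>)) \<le> e * norm (y - \<beta>)"
    unfolding has_derivative_at_alt by blast
  have "\<forall>\<^sub>F h in nhds 0. norm h < d"
    using \<open>0 < d\<close> by (auto simp: eventually_nhds_metric)
  then show ?thesis
  proof eventually_elim
    case (elim h)
    then show ?case using d[of "\<beta> + h"] False by (simp add: inner_commute)
  qed
qed

lemma sign_penalty_expansion:
  fixes \<beta> :: "real ^ 'p"
  assumes \<beta>: "\<beta> \<noteq> 0" and e: "0 < e"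
  shows "\<forall>\<^sub>F h in nhds 0. \<bar>sign_penalty 1 (\<beta> + h) - sign_penalty 1 \<beta> - h \<bullet> q_vec \<beta> h\<bar> \<le> e * norm h"
proof -
  let ?q = "\<lambda>l h. if \<beta> $ l = 0 then \<bar>h $ l\<bar> / norm \<beta> else h \<bullet> grad_J l \<beta>"
  have e': "0 < e / CARD('p)" using e by simp
  have "\<forall>\<^sub>F h in nhds 0. \<forall>l. \<bar>J_ratio l (\<beta> + h) - J_ratio l \<beta> - ?q l h\<bar> \<le> e / CARD('p) * norm h"
    by (intro eventually_all_finite J_ratio_expansion \<beta> e')
  moreover have "\<forall>\<^sub>F h in nhds 0. norm h < norm \<beta>"
    using \<beta> by (auto simp: eventually_nhds_metric intro!: exI[of _ "norm \<beta>"])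
  ultimately show ?thesis
  proof eventually_elim
    case (elim h)
    have "\<beta> + h \<noteq> 0" using elim(2) by (metis add_eq_0_iff norm_minus_cancel order_less_irrefl)
    then have "\<bar>sign_penalty 1 (\<beta> + h) - sign_penalty 1 \<beta> - h \<bullet> q_vec \<beta> h\<bar>
      = \<bar>\<Sum>l\<in>UNIV. J_ratio l (\<beta> + h) - J_ratio l \<beta> - ?q l h\<bar>"
      using \<beta> by (simp add: sign_penalty_eq_sum_J_ratio inner_q_vec_self sum_subtractf)
    also have "\<dots> \<le> (\<Sum>l::'p\<in>UNIV. e / CARD('p) * norm h)"
      using elim(1) by (intro order_trans[OF sum_abs] sum_mono) auto
    finally show ?case by simp
  qed
qed

section \<open>Strong convexity of the limit process and its Lipschitz minimizer\<close>

text \<open>The coercive quadratic part dominates the linear lower bounds of the other two terms, so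
  a minimum over a large ball is global. The quadratic growth comes from comparing the minimizer
  with points of a segment, which also works when \<open>p\<close> has kinks.\<close>

lemma convex_quadratic_minimizer:
  fixes p :: "real ^ 'p \<Rightarrow> real" and A :: "real ^ 'p ^ 'p"
  assumes c: "0 < c" and A: "\<And>z. c * (norm z)\<^sup>2 \<le> z \<bullet> (A *v z)"
    and p: "convex_on UNIV p" "continuous_on UNIV p" "\<And>z. - (G * norm z) \<le> p z"
  defines "f \<equiv> \<lambda>u z. z \<bullet> u + (1 / 2) * (z \<bullet> (A *v z)) + p z"
  obtains z0 where "\<And>z. f u z0 + c / 2 * (norm (z - z0))\<^sup>2 \<le> f u z"
proof -
  define H where "H = norm u + \<bar>G\<bar>"
  have H: "0 \<le> H" by (simp add: H_def)
  have lower: "c / 2 * (norm z)\<^sup>2 - H * norm z \<le> f u z" for z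
  proof -
    have "- (norm z * norm u) \<le> z \<bullet> u"
      using Cauchy_Schwarz_ineq2[of z u] by linarith
    moreover have "- (\<bar>G\<bar> * norm z) \<le> p z"
      using p(3)[of z] mult_right_mono[OF abs_ge_self norm_ge_zero, of G z] by linarith
    ultimately show ?thesis using A[of z] by (simp add: f_def H_def algebra_simps)
  qed
  \<comment> \<open>For |z| >= K the factor c/2 |z| - H is at least |f u 0|, and |z| >= 1, so the
    lower bound c/2 |z|^2 - H |z| is at least \<open>f u 0\<close>.\<close>
  define K where "K = max 1 (2 / c * (H + \<bar>f u 0\<bar>))"
  have K: "1 \<le> K" "2 / c * (H + \<bar>f u 0\<bar>) \<le> K" by (auto simp: K_def)
  have far: "f u 0 \<le> f u z" if "norm z \<ge> K" for z
  proof -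
    have "2 / c * (H + \<bar>f u 0\<bar>) \<le> norm z" "1 \<le> norm z" using K that by auto
    then have "H + \<bar>f u 0\<bar> \<le> c / 2 * norm z" using c by (simp add: field_simps)
    then have "\<bar>f u 0\<bar> * 1 \<le> (c / 2 * norm z - H) * norm z"
      using \<open>1 \<le> norm z\<close> by (intro mult_mono) auto
    also have "\<dots> \<le> f u z" using lower[of z] by (simp add: algebra_simps power2_eq_square)
    finally show ?thesis by linarith
  qed
  have cont: "continuous_on S (f u)" for S
    unfolding f_def
    by (intro continuous_intros linear_continuous_on matrix_vector_mul_bounded_linear
        continuous_on_subset[OF p(2)]) auto
  obtain z0 where z0: "z0 \<in> cball 0 K" "\<And>z. z \<in> cball 0 K \<Longrightarrow> f u z0 \<le> f u z"
    using continuous_attains_inf[OF compact_cball _ cont, of 0 K] K by force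
  have min: "f u z0 \<le> f u z" for z
  proof (cases "norm z \<ge> K")
    case True
    have "f u z0 \<le> f u 0" using K by (intro z0) auto
    then show ?thesis using far[OF True] by linarith
  qed (auto intro: z0)
  have "f u z0 + c / 2 * (norm (z - z0))\<^sup>2 \<le> f u z" for z
  proof -
    define d where "d = z - z0"
    define Q where "Q = d \<bullet> (A *v d)"
    \<comment> \<open>On the segment from \<open>z0\<close> to \<open>z\<close> the quadratic part
      lies below its chord by t (1 - t) / 2 Q, and \<open>p\<close> lies on or below its chord.
      Minimality of \<open>z0\<close> and division by t leave this inequality; t tending to 0 then
      gives the full term Q / 2.\<close>
    have step: "(1 - t) / 2 * Q \<le> f u z - f u z0" if t: "0 < t" "t < 1" for t
    proof -
      have "f u z0 \<le> f u ((1 - t) *\<^sub>R z0 + t *\<^sub>R z)" by (rule min)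
      also have "\<dots> \<le> (1 - t) * f u z0 + t * f u z - t * (1 - t) / 2 * Q"
      proof -
        have "p ((1 - t) *\<^sub>R z0 + t *\<^sub>R z) \<le> (1 - t) * p z0 + t * p z"
          using convex_onD[OF p(1), of t z0 z] t by auto
        moreover have "((1 - t) *\<^sub>R z0 + t *\<^sub>R z) \<bullet> (A *v ((1 - t) *\<^sub>R z0 + t *\<^sub>R z))
          = (1 - t) * ((1 - t) * (z0 \<bullet> (A *v z0)) + t * (z0 \<bullet> (A *v z)))
            + t * ((1 - t) * (z \<bullet> (A *v z0)) + t * (z \<bullet> (A *v z)))"
          by (simp only: matrix_vector_right_distrib matrix_vector_mult_scaleR inner_add_left
              inner_add_right inner_scaleR_left inner_scaleR_right) (simp add: algebra_simps)
        moreover have "Q = z \<bullet> (A *v z) - z \<bullet> (A *v z0) - (z0 \<bullet> (A *v z) - z0 \<bullet> (A *v z0))"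
          unfolding Q_def d_def
          by (simp only: matrix_vector_mult_diff_distrib inner_diff_left inner_diff_right)
        moreover have "((1 - t) *\<^sub>R z0 + t *\<^sub>R z) \<bullet> u = (1 - t) * (z0 \<bullet> u) + t * (z \<bullet> u)"
          by (simp only: inner_add_left inner_scaleR_left)
        \<comment> \<open>The inner products are replaced by real variables, which leaves an
          identity of polynomials. The mixed terms \<open>b1\<close> and \<open>b2\<close> stay
          apart, since the matrix may be asymmetric.\<close>
        moreover have "l + 1 / 2 * m + pp \<le> (1 - t) * (l0 + 1 / 2 * a + p0) + t * (l1 + 1 / 2 * e + p1)
            - t * (1 - t) / 2 * Q"
          if "pp \<le> (1 - t) * p0 + t * p1" "m = (1 - t) * ((1 - t) * a + t * b1) + t * ((1 - t) * b2 + t * e)"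
            "Q = e - b2 - (b1 - a)" "l = (1 - t) * l0 + t * l1"
          for l m pp l0 a p0 l1 e p1 b1 b2 :: real
        proof -
          have "(1 - t) * (l0 + 1 / 2 * a + p0) + t * (l1 + 1 / 2 * e + p1) - t * (1 - t) / 2 * Q
            = l + 1 / 2 * m + ((1 - t) * p0 + t * p1)"
            unfolding that(2-4) by (simp add: field_simps)
          then show ?thesis using that(1) by linarith
        qed
        ultimately show ?thesis
          unfolding f_def by blast
      qed
      finally have "t * ((1 - t) / 2 * Q) \<le> t * (f u z - f u z0)" by (simp add: algebra_simps)
      then show ?thesis using t by (simp only: mult_le_cancel_left_pos)
    qed
    have "((\<lambda>t. (1 - t) / 2 * Q) \<longlongrightarrow> (1 - 0) / 2 * Q) (at_right 0)"
      by (intro tendsto_intros) auto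
    moreover have "\<forall>\<^sub>F t in at_right 0. (1 - t) / 2 * Q \<le> f u z - f u z0"
      using step by (auto simp: eventually_at_right_field intro!: exI[of _ 1])
    ultimately have "(1 - 0) / 2 * Q \<le> f u z - f u z0"
      by (rule tendsto_upperbound) simp
    then show ?thesis using A[of d] by (simp add: Q_def[symmetric] d_def[symmetric])
  qed
  then show ?thesis using that by blast
qed

lemma continuous_inner_q_vec: "continuous_on S (\<lambda>z. z \<bullet> q_vec \<beta> z)"
  unfolding inner_q_vec_self
proof (intro continuous_on_sum)
  fix l
  show "continuous_on S (\<lambda>z. if \<beta> $ l = 0 then \<bar>z $ l\<bar> / norm \<beta> else z \<bullet> grad_J l \<beta>)"
    by (cases "\<beta> $ l = 0") (auto intro!: continuous_intros simp: divide_inverse)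
qed

lemma convex_inner_q_vec:
  fixes \<beta> :: "real ^ 'p"
  shows "convex_on UNIV (\<lambda>z. z \<bullet> q_vec \<beta> z)"
proof (rule convex_onI)
  fix t :: real and u v :: "real ^ 'p" assume t: "0 < t" "t < 1"
  show "((1 - t) *\<^sub>R u + t *\<^sub>R v) \<bullet> q_vec \<beta> ((1 - t) *\<^sub>R u + t *\<^sub>R v)
    \<le> (1 - t) * (u \<bullet> q_vec \<beta> u) + t * (v \<bullet> q_vec \<beta> v)"
    unfolding inner_q_vec_self sum_distrib_left sum.distrib[symmetric]
  proof (intro sum_mono)
    fix l
    have "\<bar>(1 - t) * u $ l + t * v $ l\<bar> \<le> (1 - t) * \<bar>u $ l\<bar> + t * \<bar>v $ l\<bar>"
      using t by (intro order_trans[OF abs_triangle_ineq]) (simp add: abs_mult)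
    from divide_right_mono[OF this norm_ge_zero[of \<beta>]]
    show "(if \<beta> $ l = 0 then \<bar>((1 - t) *\<^sub>R u + t *\<^sub>R v) $ l\<bar> / norm \<beta>
        else ((1 - t) *\<^sub>R u + t *\<^sub>R v) \<bullet> grad_J l \<beta>)
      \<le> (1 - t) * (if \<beta> $ l = 0 then \<bar>u $ l\<bar> / norm \<beta> else u \<bullet> grad_J l \<beta>)
        + t * (if \<beta> $ l = 0 then \<bar>v $ l\<bar> / norm \<beta> else v \<bullet> grad_J l \<beta>)"
      by (auto simp: inner_add_left add_divide_distrib)
  qed
qed simp

lemma inner_q_vec_self_ge: "- ((\<Sum>l\<in>UNIV. norm (grad_J l \<beta>)) * norm z) \<le> z \<bullet> q_vec \<beta> z"
  unfolding inner_q_vec_self sum_distrib_right sum_negf[symmetric]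
proof (intro sum_mono)
  fix l
  show "- (norm (grad_J l \<beta>) * norm z) \<le> (if \<beta> $ l = 0 then \<bar>z $ l\<bar> / norm \<beta> else z \<bullet> grad_J l \<beta>)"
    using Cauchy_Schwarz_ineq2[of z "grad_J l \<beta>"]
    by (auto simp: mult.commute intro: order_trans[of _ 0])
qed

text \<open>The sign of \<open>b\<close> enters here: only for b >= 0 does the penalty part inherit
  the convexity of z.q(z). The Lipschitz bound makes the minimizer a continuous, hence measurable,
  function of the linear term, so no separate argument about measurable choice of minimizers
  arises.\<close>

lemma R_process_minimizer:
  fixes A :: "real ^ 'p ^ 'p" and \<beta> :: "real ^ 'p"
  assumes c: "0 < c" and A: "\<And>z. c * (norm z)\<^sup>2 \<le> z \<bullet> (A *v z)" and b: "0 \<le> b"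
  defines "\<Phi> \<equiv> \<lambda>u. ARG_MIN (R_process A b \<beta> u) z. True"
  shows R_process_growth: "\<And>u z. R_process A b \<beta> u (\<Phi> u) + c / 2 * (norm (z - \<Phi> u))\<^sup>2 \<le> R_process A b \<beta> u z"
    and R_process_unique: "\<And>u. \<exists>!z. is_arg_min (R_process A b \<beta> u) (\<lambda>_. True) z"
    and R_process_lipschitz: "\<And>u v. norm (\<Phi> u - \<Phi> v) \<le> norm (u - v) / c"
proof -
  have ex: "\<exists>z0. \<forall>z. R_process A b \<beta> u z0 + c / 2 * (norm (z - z0))\<^sup>2 \<le> R_process A b \<beta> u z" for u
  proof -
    have lower: "- (b * (\<Sum>l\<in>UNIV. norm (grad_J l \<beta>)) * norm z) \<le> b * (z \<bullet> q_vec \<beta> z)" for z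
      using mult_left_mono[OF inner_q_vec_self_ge[of \<beta> z] b] by (simp add: mult.assoc)
    have conv: "convex_on UNIV (\<lambda>z. b * (z \<bullet> q_vec \<beta> z))"
      by (intro convex_on_cmul b convex_inner_q_vec)
    have cont: "continuous_on UNIV (\<lambda>z. b * (z \<bullet> q_vec \<beta> z))"
      by (intro continuous_intros continuous_inner_q_vec)
    obtain z0 where "\<And>z. z0 \<bullet> u + 1 / 2 * (z0 \<bullet> (A *v z0)) + b * (z0 \<bullet> q_vec \<beta> z0) + c / 2 * (norm (z - z0))\<^sup>2
        \<le> z \<bullet> u + 1 / 2 * (z \<bullet> (A *v z)) + b * (z \<bullet> q_vec \<beta> z)"
      using convex_quadratic_minimizer[OF c A conv cont lower, of u] by auto
    then show ?thesis unfolding R_process_def by (intro exI[of _ z0] allI)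
  qed
  have min_unique: "z = z0" if z0: "\<forall>z. R_process A b \<beta> u z0 + c / 2 * (norm (z - z0))\<^sup>2 \<le> R_process A b \<beta> u z"
    and z: "is_arg_min (R_process A b \<beta> u) (\<lambda>_. True) z" for u z z0
  proof -
    have "R_process A b \<beta> u z \<le> R_process A b \<beta> u z0"
      using z by (auto simp: is_arg_min_linorder)
    with z0[rule_format, of z] have "c / 2 * (norm (z - z0))\<^sup>2 \<le> 0" by linarith
    then show ?thesis using c by (simp add: mult_le_0_iff)
  qed
  have is_min: "is_arg_min (R_process A b \<beta> u) (\<lambda>_. True) z0"
    if "\<forall>z. R_process A b \<beta> u z0 + c / 2 * (norm (z - z0))\<^sup>2 \<le> R_process A b \<beta> u z" for u z0
  proof -
    have "R_process A b \<beta> u z0 \<le> R_process A b \<beta> u z" for z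
    proof -
      have "0 \<le> c / 2 * (norm (z - z0))\<^sup>2" using c by simp
      then show ?thesis using that[rule_format, of z] by linarith
    qed
    then show ?thesis by (simp add: is_arg_min_linorder)
  qed
  show unique: "\<exists>!z. is_arg_min (R_process A b \<beta> u) (\<lambda>_. True) z" for u
    
  proof -
    obtain z0 where z0: "\<forall>z. R_process A b \<beta> u z0 + c / 2 * (norm (z - z0))\<^sup>2 \<le> R_process A b \<beta> u z"
      using ex[of u] by auto
    show ?thesis by (rule ex1I[where a = z0]) (rule is_min[OF z0], rule min_unique[OF z0])
  qed
  show growth: "R_process A b \<beta> u (\<Phi> u) + c / 2 * (norm (z - \<Phi> u))\<^sup>2 \<le> R_process A b \<beta> u z" for u z
  proof -
    have "is_arg_min (R_process A b \<beta> u) (\<lambda>_. True) (\<Phi> u)"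
      unfolding \<Phi>_def arg_min_def using unique[of u] by (rule someI_ex[OF ex1_implies_ex])
    moreover obtain z0 where z0: "\<forall>z. R_process A b \<beta> u z0 + c / 2 * (norm (z - z0))\<^sup>2 \<le> R_process A b \<beta> u z"
      using ex[of u] by auto
    ultimately have "\<Phi> u = z0" using min_unique by blast
    with z0 show ?thesis by simp
  qed
  show "norm (\<Phi> u - \<Phi> v) \<le> norm (u - v) / c" for u v
  proof -
    define d where "d = \<Phi> u - \<Phi> v"
    \<comment> \<open>The growth inequalities at \<open>u\<close> and at \<open>v\<close>, each
      taken at the other's minimizer, are added; the quadratic and the penalty terms cancel and only
      the linear terms remain.\<close>
    have "c * (norm d)\<^sup>2 \<le> d \<bullet> (v - u)"
      using growth[of u "\<Phi> v"] growth[of v "\<Phi> u"]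
      unfolding R_process_def d_def norm_minus_commute[of "\<Phi> v" "\<Phi> u"]
      by (simp add: inner_diff_left inner_diff_right)
    also have "\<dots> \<le> norm d * norm (u - v)"
      using norm_cauchy_schwarz[of d "v - u"] by (simp add: norm_minus_commute)
    finally have "norm d * (c * norm d) \<le> norm d * norm (u - v)"
      by (simp add: power2_eq_square mult.left_commute)
    then have "c * norm d \<le> norm (u - v)"
      by (cases "norm d = 0") (auto simp: mult_le_cancel_left)
    then show ?thesis using c by (simp add: d_def[symmetric] field_simps)
  qed
qed

subsection \<open>The loss function\<close>

lemma logistic_gt_0: "0 < logistic t" and logistic_lt_1: "logistic t < 1"
  by (simp_all add: logistic_def add_pos_pos divide_less_eq)

text \<open>Strict positivity keeps the arguments of \<open>\<rho>\<close> and \<open>\<psi>\<close>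
  in the interior of the half-line, where the derivatives within \<open>{0..}\<close> are two-sided
  and the chain rule applies.\<close>

lemma minus_ln_logistic_pos: "0 < - ln (logistic t)" and minus_ln_1_minus_logistic_pos: "0 < - ln (1 - logistic t)"
  using logistic_gt_0[of t] logistic_lt_1[of t] by (simp_all add: ln_less_zero)

lemma DERIV_logistic: "(logistic has_real_derivative logistic t * (1 - logistic t)) (at t)"
proof -
  have "1 + exp t \<noteq> 0" using exp_gt_zero[of t] by linarith
  then show ?thesis unfolding logistic_def [abs_def]
    by (auto intro!: derivative_eq_intros simp: field_simps)
qed

lemma DERIV_minus_ln_logistic:
  "((\<lambda>t. - ln (logistic t)) has_real_derivative - (1 - logistic t)) (at t)"
  using logistic_gt_0[of t] by (auto intro!: derivative_eq_intros DERIV_logistic)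

lemma DERIV_minus_ln_1_minus_logistic:
  "((\<lambda>t. - ln (1 - logistic t)) has_real_derivative logistic t) (at t)"
  using logistic_lt_1[of t] by (auto intro!: derivative_eq_intros DERIV_logistic)

lemma continuous_on_logistic: "continuous_on S logistic"
  by (rule DERIV_continuous_on[OF has_field_derivative_at_within[OF DERIV_logistic]])

lemma borel_measurable_logistic [measurable]: "logistic \<in> borel_measurable borel"
  by (rule borel_measurable_continuous_onI[OF continuous_on_logistic])

section \<open>Derivatives of the loss, their bounds, and the Taylor remainder\<close>

definition score :: "(real \<Rightarrow> real) \<Rightarrow> real \<Rightarrow> real \<Rightarrow> real" where
  "score \<psi> y t = - (y - logistic t) * nu_fun \<psi> t"

definition nu_deriv :: "(real \<Rightarrow> real) \<Rightarrow> (real \<Rightarrow> real) \<Rightarrow> real \<Rightarrow> real" where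
  "nu_deriv \<psi> \<psi>' t =
     logistic t * (1 - logistic t) * (\<psi> (- ln (1 - logistic t)) - \<psi> (- ln (logistic t)))
     + (logistic t)\<^sup>2 * \<psi>' (- ln (1 - logistic t)) - (1 - logistic t)\<^sup>2 * \<psi>' (- ln (logistic t))"

text \<open>The second derivative of the loss in \<open>t\<close>. The first summand does not
  involve \<open>y\<close> and is the kernel of A; the second is a multiple of the residual and has
  mean zero under the model.\<close>

definition curvature :: "(real \<Rightarrow> real) \<Rightarrow> (real \<Rightarrow> real) \<Rightarrow> real \<Rightarrow> real \<Rightarrow> real" where
  "curvature \<psi> \<psi>' y t =
     logistic t * (1 - logistic t) * nu_fun \<psi> t - (y - logistic t) * nu_deriv \<psi> \<psi>' t"

locale smooth_loss =
  fixes \<rho> \<psi> \<psi>' :: "real \<Rightarrow> real"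
  assumes rho_mono: "mono_on {0..} \<rho>"
    and rho_deriv: "\<And>t. t \<ge> 0 \<Longrightarrow> (\<rho> has_real_derivative \<psi> t) (at t within {0..})"
    and psi_deriv: "\<And>t. t \<ge> 0 \<Longrightarrow> (\<psi> has_real_derivative \<psi>' t) (at t within {0..})"
    and psi'_cont: "continuous_on {0..} \<psi>'"
    and psi_bounded: "bounded (\<psi> ` {0..})"
    and psi'_bounded: "bounded (\<psi>' ` {0..})"
begin

lemma at_within_pos: "0 < t \<Longrightarrow> at t within {0..} = at (t::real)"
  by (rule at_within_interior) (simp add: interior_real_atLeast)

lemma DERIV_rho: "0 < t \<Longrightarrow> (\<rho> has_real_derivative \<psi> t) (at t)"
  using rho_deriv[of t] by (simp add: at_within_pos)

lemma DERIV_psi: "0 < t \<Longrightarrow> (\<psi> has_real_derivative \<psi>' t) (at t)"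
  using psi_deriv[of t] by (simp add: at_within_pos)

lemma psi_cont: "continuous_on {0..} \<psi>"
  by (rule DERIV_continuous_on[OF psi_deriv]) simp

lemma psi_nonneg: assumes "0 < t" shows "0 \<le> \<psi> t"
proof -
  have "mono_on {0..} \<rho>" "t \<in> interior {0..}" using assms rho_mono by (auto simp: interior_real_atLeast)
  then show ?thesis
    using mono_on_imp_deriv_nonneg[OF _ DERIV_rho[OF assms]] by blast
qed

lemma nu_nonneg: "0 \<le> nu_fun \<psi> t"
  unfolding nu_fun_def
  using psi_nonneg[OF minus_ln_logistic_pos] psi_nonneg[OF minus_ln_1_minus_logistic_pos]
    logistic_gt_0[of t] logistic_lt_1[of t] by (intro add_nonneg_nonneg mult_nonneg_nonneg) auto

lemma psi_integrable:
  assumes "t \<le> 1"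
  shows "(\<lambda>u. \<psi> (- ln u)) integrable_on {0..t}"
proof -
  obtain B where B: "\<And>s. 0 \<le> s \<Longrightarrow> \<bar>\<psi> s\<bar> \<le> B"
    using psi_bounded unfolding bounded_iff by auto
  \<comment> \<open>Nothing is known about \<open>\<psi>\<close> on negative arguments. The constant
    extension is continuous on the whole line, hence Borel, and agrees with \<open>\<psi>\<close>
    wherever the integrand is evaluated, including u = 0, where \<open>ln 0 = 0\<close>.\<close>
  define g where "g s = \<psi> (max s 0)" for s
  have "continuous_on UNIV g"
    unfolding g_def by (rule continuous_on_compose2[OF psi_cont]) (auto intro!: continuous_intros)
  then have [measurable]: "g \<in> borel_measurable borel" by (rule borel_measurable_continuous_onI)
  have "(\<lambda>u. g (- ln u)) integrable_on {0..t}"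
  proof (rule measurable_bounded_by_integrable_imp_integrable_real)
    show "(\<lambda>u. g (- ln u)) \<in> borel_measurable (lebesgue_on {0..t})"
      by (intro measurable_restrict_space1 measurable_completion) measurable
    show "(\<lambda>u. B) integrable_on {0..t}" by (rule integrable_const_ivl)
    show "\<bar>g (- ln u)\<bar> \<le> B" for u unfolding g_def by (rule B) simp
  qed auto
  moreover have "g (- ln u) = \<psi> (- ln u)" if "u \<in> {0..t}" for u
  proof -
    have "0 \<le> - ln u" using that assms by (cases "u = 0") auto
    then show ?thesis by (simp add: g_def max_def)
  qed
  ultimately show ?thesis by (rule integrable_eq)
qed

text \<open>The integrand need not have a limit at 0, so the fundamental theorem of calculus is
  applied on an interval \<open>{a..c}\<close> inside (0, 1); the integral over
  \<open>{0..a}\<close> only adds a constant.\<close>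

lemma DERIV_G_fun:
  assumes u: "0 < u" "u < 1"
  shows "(G_fun \<psi> has_real_derivative \<psi> (- ln u)) (at u)"
proof -
  let ?f = "\<lambda>u. \<psi> (- ln u)"
  define a where "a = u / 2"
  define c where "c = (u + 1) / 2"
  have ac: "0 < a" "a < u" "u < c" "c < 1" using u by (auto simp: a_def c_def)
  have "continuous_on {a..c} ?f"
  proof (rule continuous_on_compose2[OF psi_cont])
    show "continuous_on {a..c} (\<lambda>u. - ln u)"
      using ac(1) by (intro continuous_intros) auto
    show "(\<lambda>u. - ln u) ` {a..c} \<subseteq> {0..}"
      using ac by (auto simp: ln_le_zero_iff)
  qed
  then have "((\<lambda>x. integral {a..x} ?f) has_real_derivative ?f u) (at u within {a..c})"
    by (rule integral_has_real_derivative) (use ac in simp)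
  then have "((\<lambda>x. integral {a..x} ?f) has_real_derivative ?f u) (at u)"
    by (subst (asm) at_within_interior) (use ac in simp_all)
  then have "((\<lambda>x. integral {0..a} ?f + integral {a..x} ?f) has_real_derivative ?f u) (at u)"
    using DERIV_add[OF DERIV_const] by fastforce
  then show ?thesis
  proof (rule has_field_derivative_transform_within_open)
    show "integral {0..a} ?f + integral {a..x} ?f = G_fun \<psi> x" if "x \<in> {a<..<c}" for x
      unfolding G_fun_def using that ac
      by (intro Henstock_Kurzweil_Integration.integral_combine psi_integrable) simp_all
  qed (use ac in simp_all)
qed

text \<open>This is the purpose of the correction terms with G. The derivatives of the two
  \<rho>-terms carry the coefficients -y and 1 - y; the G-terms turn both into F - y, so that the
  derivative is the residual times -\<nu> and hence centred under the model.\<close>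

lemma DERIV_phi_loss: "(phi_loss \<rho> \<psi> y has_real_derivative score \<psi> y t) (at t)"
proof -
  note pos = logistic_gt_0[of t] logistic_lt_1[of t]
  note rho1 = DERIV_chain2[OF DERIV_rho[OF minus_ln_logistic_pos] DERIV_minus_ln_logistic]
  note rho2 = DERIV_chain2[OF DERIV_rho[OF minus_ln_1_minus_logistic_pos] DERIV_minus_ln_1_minus_logistic]
  note G1 = DERIV_chain2[OF DERIV_G_fun[OF pos] DERIV_logistic]
  have "((\<lambda>t. 1 - logistic t) has_real_derivative - (logistic t * (1 - logistic t))) (at t)"
    by (auto intro!: derivative_eq_intros DERIV_logistic)
  moreover have "(G_fun \<psi> has_real_derivative \<psi> (- ln (1 - logistic t))) (at (1 - logistic t))"
    using pos by (intro DERIV_G_fun) auto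
  ultimately have G2: "((\<lambda>t. G_fun \<psi> (1 - logistic t)) has_real_derivative
      \<psi> (- ln (1 - logistic t)) * - (logistic t * (1 - logistic t))) (at t)"
    by (rule DERIV_chain2[rotated])
  show ?thesis
    unfolding phi_loss_def [abs_def]
    by (rule DERIV_cong, rule DERIV_add[OF DERIV_add[OF DERIV_add[OF DERIV_cmult[OF rho1] DERIV_cmult[OF rho2]] G1] G2])
      (simp add: score_def nu_fun_def algebra_simps)
qed

lemma DERIV_nu_fun: "(nu_fun \<psi> has_real_derivative nu_deriv \<psi> \<psi>' t) (at t)"
proof -
  note psi1 = DERIV_chain2[OF DERIV_psi[OF minus_ln_logistic_pos] DERIV_minus_ln_logistic]
  note psi2 = DERIV_chain2[OF DERIV_psi[OF minus_ln_1_minus_logistic_pos] DERIV_minus_ln_1_minus_logistic]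
  have "((\<lambda>t. 1 - logistic t) has_real_derivative - (logistic t * (1 - logistic t))) (at t)"
    by (auto intro!: derivative_eq_intros DERIV_logistic)
  from DERIV_add[OF DERIV_mult[OF psi1 this] DERIV_mult[OF psi2 DERIV_logistic]]
  show ?thesis
    unfolding nu_fun_def [abs_def]
    by (rule DERIV_cong) (simp add: nu_deriv_def algebra_simps power2_eq_square)
qed

lemma DERIV_score: "(score \<psi> y has_real_derivative curvature \<psi> \<psi>' y t) (at t)"
proof -
  have "((\<lambda>t. - (y - logistic t)) has_real_derivative logistic t * (1 - logistic t)) (at t)"
    by (auto intro!: derivative_eq_intros DERIV_logistic)
  from DERIV_mult[OF this DERIV_nu_fun]
  show ?thesis
    unfolding score_def [abs_def]
    by (rule DERIV_cong) (simp add: curvature_def algebra_simps)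
qed

lemma phi_loss_taylor:
  obtains \<xi> where "\<bar>\<xi>\<bar> \<le> \<bar>s\<bar>"
    "phi_loss \<rho> \<psi> y (t + s) = phi_loss \<rho> \<psi> y t + score \<psi> y t * s + curvature \<psi> \<psi>' y (t + \<xi>) / 2 * s\<^sup>2"
proof -
  define diff where "diff m = (\<lambda>s. (if m = 0 then phi_loss \<rho> \<psi> y else if m = 1 then score \<psi> y
      else curvature \<psi> \<psi>' y) (t + s))" for m :: nat
  have "(\<lambda>s. f (t + s)) = (\<lambda>s. f (s + t))" for f :: "real \<Rightarrow> real" by (simp add: add.commute)
  then have "DERIV (diff m) s :> diff (Suc m) s" if "m < 2" for m s
    using that DERIV_phi_loss[of y "s + t"] DERIV_score[of y "s + t"]
    by (auto simp: diff_def DERIV_shift less_2_cases_iff add.commute)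
  then have "\<forall>m s'. m < 2 \<and> \<bar>s'\<bar> \<le> \<bar>s\<bar> \<longrightarrow> DERIV (diff m) s' :> diff (Suc m) s'" by blast
  from Maclaurin_bi_le[OF refl this] obtain \<xi> where "\<bar>\<xi>\<bar> \<le> \<bar>s\<bar>"
    "diff 0 s = (\<Sum>m<2. diff m 0 / fact m * s ^ m) + diff 2 \<xi> / fact 2 * s ^ 2" by blast
  then show ?thesis
    using that[of \<xi>] by (simp add: diff_def numeral_2_eq_2)
qed

lemma continuous_on_nu_fun: "continuous_on S (nu_fun \<psi>)"
  by (rule DERIV_continuous_on[OF has_field_derivative_at_within[OF DERIV_nu_fun]])

lemma continuous_on_nu_deriv: "continuous_on S (nu_deriv \<psi> \<psi>')"
proof -
  have 1: "continuous_on S (\<lambda>t. - ln (logistic t))"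
    by (rule DERIV_continuous_on[OF has_field_derivative_at_within[OF DERIV_minus_ln_logistic]])
  have 2: "continuous_on S (\<lambda>t. - ln (1 - logistic t))"
    by (rule DERIV_continuous_on[OF has_field_derivative_at_within[OF DERIV_minus_ln_1_minus_logistic]])
  have im: "(\<lambda>t. - ln (logistic t)) ` S \<subseteq> {0..}" "(\<lambda>t. - ln (1 - logistic t)) ` S \<subseteq> {0..}"
    using less_imp_le[OF minus_ln_logistic_pos] less_imp_le[OF minus_ln_1_minus_logistic_pos]
    by (auto simp only: image_subset_iff atLeast_iff)
  show ?thesis
    unfolding nu_deriv_def [abs_def]
    by (intro continuous_intros continuous_on_logistic
        continuous_on_compose2[OF psi_cont 1 im(1)] continuous_on_compose2[OF psi_cont 2 im(2)]
        continuous_on_compose2[OF psi'_cont 1 im(1)] continuous_on_compose2[OF psi'_cont 2 im(2)])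
qed

lemma continuous_on_curvature: "continuous_on S (curvature \<psi> \<psi>' y)"
  unfolding curvature_def [abs_def]
  by (intro continuous_intros continuous_on_logistic continuous_on_nu_fun continuous_on_nu_deriv)

lemma borel_measurable_nu_fun [measurable]: "nu_fun \<psi> \<in> borel_measurable borel"
  by (rule borel_measurable_continuous_onI[OF continuous_on_nu_fun])

lemma borel_measurable_nu_deriv [measurable]: "nu_deriv \<psi> \<psi>' \<in> borel_measurable borel"
  by (rule borel_measurable_continuous_onI[OF continuous_on_nu_deriv])

lemma loss_bounds:
  obtains C where "0 \<le> C" "\<And>t. \<bar>nu_fun \<psi> t\<bar> \<le> C" "\<And>t. \<bar>nu_deriv \<psi> \<psi>' t\<bar> \<le> C"
    "\<And>y t. y \<in> {0, 1} \<Longrightarrow> \<bar>score \<psi> y t\<bar> \<le> C" "\<And>y t. y \<in> {0, 1} \<Longrightarrow> \<bar>curvature \<psi> \<psi>' y t\<bar> \<le> C"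
proof -
  obtain B B' where B: "\<And>s. 0 \<le> s \<Longrightarrow> \<bar>\<psi> s\<bar> \<le> B" and B': "\<And>s. 0 \<le> s \<Longrightarrow> \<bar>\<psi>' s\<bar> \<le> B'"
    using psi_bounded psi'_bounded unfolding bounded_iff by auto
  have BB: "0 \<le> B" "0 \<le> B'" using B[of 0] B'[of 0] by auto
  have mul: "\<bar>k * z\<bar> \<le> Z" if "\<bar>k\<bar> \<le> 1" "\<bar>z\<bar> \<le> Z" for k z Z :: real
    using mult_mono[OF that] that by (simp add: abs_mult)
  \<comment> \<open>The largest of the four bounds, reached by the curvature: 2B for \<nu> plus 2B +
    2B' for its derivative, the remaining factors being at most 1 in absolute value.\<close>
  define C where "C = 4 * B + 2 * B'"
  have psi: "\<bar>\<psi> (- ln (logistic t))\<bar> \<le> B" "\<bar>\<psi> (- ln (1 - logistic t))\<bar> \<le> B"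
    "\<bar>\<psi>' (- ln (logistic t))\<bar> \<le> B'" "\<bar>\<psi>' (- ln (1 - logistic t))\<bar> \<le> B'" for t
    by (intro B B' less_imp_le minus_ln_logistic_pos minus_ln_1_minus_logistic_pos)+
  have F: "\<bar>logistic t\<bar> \<le> 1" "\<bar>1 - logistic t\<bar> \<le> 1" for t
    using logistic_gt_0[of t] logistic_lt_1[of t] by auto
  have F2: "\<bar>logistic t * (1 - logistic t)\<bar> \<le> 1" "\<bar>(logistic t)\<^sup>2\<bar> \<le> 1" "\<bar>(1 - logistic t)\<^sup>2\<bar> \<le> 1" for t
    unfolding power2_eq_square by (intro mul F)+
  have nu: "\<bar>nu_fun \<psi> t\<bar> \<le> 2 * B" for t
    using mul[OF F(2) psi(1), of t t] mul[OF F(1) psi(2), of t t]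
    unfolding nu_fun_def by (simp add: mult.commute)
  have nu': "\<bar>nu_deriv \<psi> \<psi>' t\<bar> \<le> 2 * B + 2 * B'" for t
  proof -
    have "\<bar>\<psi> (- ln (1 - logistic t)) - \<psi> (- ln (logistic t))\<bar> \<le> 2 * B" using psi[of t] by linarith
    from mul[OF F2(1)[of t] this] mul[OF F2(2) psi(4), of t t] mul[OF F2(3) psi(3), of t t]
    show ?thesis unfolding nu_deriv_def by linarith
  qed
  have y: "\<bar>y - logistic t\<bar> \<le> 1" if "y \<in> {0, 1}" for y t
    using that F[of t] by auto
  show ?thesis
  proof
    show "0 \<le> C" "\<bar>nu_fun \<psi> t\<bar> \<le> C" "\<bar>nu_deriv \<psi> \<psi>' t\<bar> \<le> C" for t
      using BB nu[of t] nu'[of t] by (auto simp: C_def)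
    show "\<bar>score \<psi> y t\<bar> \<le> C" if "y \<in> {0, 1}" for y t
      using mul[OF y[OF that] nu, of t t] BB unfolding score_def mult_minus_left abs_minus_cancel C_def by linarith
    show "\<bar>curvature \<psi> \<psi>' y t\<bar> \<le> C" if "y \<in> {0, 1}" for y t
      using mul[OF F2(1) nu, of t t] mul[OF y[OF that] nu', of t t] BB
      unfolding curvature_def C_def by linarith
  qed
qed

lemma curvature_equicontinuous:
  assumes e: "0 < e"
  obtains d where "0 < d"
    "\<And>y t \<xi>. y \<in> {0, 1} \<Longrightarrow> \<bar>t\<bar> \<le> T \<Longrightarrow> \<bar>\<xi>\<bar> \<le> d \<Longrightarrow> \<bar>curvature \<psi> \<psi>' y (t + \<xi>) - curvature \<psi> \<psi>' y t\<bar> \<le> e"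
proof -
  have "\<exists>d>0. \<forall>t \<xi>. \<bar>t\<bar> \<le> T \<longrightarrow> \<bar>\<xi>\<bar> \<le> d \<longrightarrow> \<bar>curvature \<psi> \<psi>' y (t + \<xi>) - curvature \<psi> \<psi>' y t\<bar> \<le> e" for y
  proof -
    have "uniformly_continuous_on {- (T + 1)..T + 1} (curvature \<psi> \<psi>' y)"
      by (intro compact_uniformly_continuous continuous_on_curvature) simp
    then obtain d where d: "0 < d" "\<And>s t. s \<in> {- (T + 1)..T + 1} \<Longrightarrow> t \<in> {- (T + 1)..T + 1} \<Longrightarrow>
      dist s t < d \<Longrightarrow> dist (curvature \<psi> \<psi>' y s) (curvature \<psi> \<psi>' y t) < e"
      using e unfolding uniformly_continuous_on_def by metis
    \<comment> \<open>The bound 1 keeps the shifted point in the interval enlarged by 1; half of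
      \<open>d\<close> turns a weak into a strict inequality.\<close>
    have "\<bar>curvature \<psi> \<psi>' y (t + \<xi>) - curvature \<psi> \<psi>' y t\<bar> \<le> e"
      if "\<bar>t\<bar> \<le> T" "\<bar>\<xi>\<bar> \<le> min 1 (d / 2)" for t \<xi>
    proof -
      have "t + \<xi> \<in> {- (T + 1)..T + 1}" "t \<in> {- (T + 1)..T + 1}"
        using that by (simp_all add: abs_le_iff)
      moreover have "dist (t + \<xi>) t < d"
        using that(2) d(1) by (simp add: dist_real_def)
      ultimately show ?thesis using d(2)[of "t + \<xi>" t] by (simp add: dist_real_def)
    qed
    then show ?thesis using d(1) by (intro exI[of _ "min 1 (d / 2)"]) auto
  qed
  then obtain d where d: "\<And>y. 0 < d y" "\<And>y t \<xi>. \<bar>t\<bar> \<le> T \<Longrightarrow> \<bar>\<xi>\<bar> \<le> d y \<Longrightarrow>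
      \<bar>curvature \<psi> \<psi>' y (t + \<xi>) - curvature \<psi> \<psi>' y t\<bar> \<le> e" by metis
  show ?thesis
    by (rule that[of "min (d 0) (d 1)"]) (use d in auto)
qed

definition loss_remainder :: "real ^ 'p \<Rightarrow> real \<Rightarrow> real ^ 'p \<Rightarrow> real ^ 'p \<Rightarrow> real" where
  "loss_remainder \<beta> y x h = phi_loss \<rho> \<psi> y (x \<bullet> (\<beta> + h)) - phi_loss \<rho> \<psi> y (x \<bullet> \<beta>)
     - score \<psi> y (x \<bullet> \<beta>) * (x \<bullet> h) - curvature \<psi> \<psi>' y (x \<bullet> \<beta>) / 2 * (x \<bullet> h)\<^sup>2"

text \<open>The remainder is half the change of the curvature between x.\<beta> and a nearby point,
  times (x.h)^2. For |x| <= T this change is uniformly small; for larger |x| only its bound 2C is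
  available. \<open>C\<close> is fixed before \<open>T\<close> and \<open>e\<close>, because the
  application picks \<open>T\<close> according to \<open>C\<close>.\<close>

lemma loss_quadratic_expansion:
  fixes \<beta> :: "real ^ 'p"
  shows "\<exists>C\<ge>0. \<forall>T. \<forall>e>0. \<exists>d>0. \<forall>y\<in>{0, 1}. \<forall>x h. norm h \<le> d \<longrightarrow>
      \<bar>loss_remainder \<beta> y x h\<bar> \<le> (e + C * indicator {x. norm x > T} x) * (norm x)\<^sup>2 * (norm h)\<^sup>2"
proof -
  obtain C where C: "0 \<le> C" "\<And>y t. y \<in> {0, 1} \<Longrightarrow> \<bar>curvature \<psi> \<psi>' y t\<bar> \<le> C"
    using loss_bounds by metis
  have "\<exists>d>0. \<forall>y\<in>{0, 1}. \<forall>x h. norm h \<le> d \<longrightarrow>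
      \<bar>loss_remainder \<beta> y x h\<bar>
      \<le> (e + C * indicator {x. norm x > T} x) * (norm x)\<^sup>2 * (norm h)\<^sup>2" if e: "0 < e" for T e
  proof -
    obtain d where d: "0 < d" "\<And>y t \<xi>. y \<in> {0, 1} \<Longrightarrow> \<bar>t\<bar> \<le> T * norm \<beta> \<Longrightarrow> \<bar>\<xi>\<bar> \<le> d \<Longrightarrow>
        \<bar>curvature \<psi> \<psi>' y (t + \<xi>) - curvature \<psi> \<psi>' y t\<bar> \<le> e"
      using curvature_equicontinuous[OF e] by metis
    \<comment> \<open>The radius d / (1 + |T|) makes |\<xi>| <= |x||h| <= d whenever |x| <= T, and
      it is positive for every real \<open>T\<close>.\<close>
    have "\<bar>loss_remainder \<beta> y x h\<bar>
      \<le> (e + C * indicator {x. norm x > T} x) * (norm x)\<^sup>2 * (norm h)\<^sup>2"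
      if y: "y \<in> {0, 1}" and h: "norm h \<le> d / (1 + \<bar>T\<bar>)" for y x h
    proof -
      obtain \<xi> where \<xi>: "\<bar>\<xi>\<bar> \<le> \<bar>x \<bullet> h\<bar>"
        "phi_loss \<rho> \<psi> y (x \<bullet> \<beta> + x \<bullet> h) = phi_loss \<rho> \<psi> y (x \<bullet> \<beta>) + score \<psi> y (x \<bullet> \<beta>) * (x \<bullet> h)
          + curvature \<psi> \<psi>' y (x \<bullet> \<beta> + \<xi>) / 2 * (x \<bullet> h)\<^sup>2"
        using phi_loss_taylor by metis
      have osc: "\<bar>curvature \<psi> \<psi>' y (x \<bullet> \<beta> + \<xi>) - curvature \<psi> \<psi>' y (x \<bullet> \<beta>)\<bar> / 2
        \<le> e + C * indicator {x. norm x > T} x"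
      proof (cases "norm x > T")
        case True
        then show ?thesis
          using C(2)[OF y, of "x \<bullet> \<beta> + \<xi>"] C(2)[OF y, of "x \<bullet> \<beta>"] e by simp
      next
        case False
        have "\<bar>x \<bullet> \<beta>\<bar> \<le> norm x * norm \<beta>" by (rule Cauchy_Schwarz_ineq2)
        also have "\<dots> \<le> T * norm \<beta>" using False by (intro mult_right_mono) auto
        finally have 1: "\<bar>x \<bullet> \<beta>\<bar> \<le> T * norm \<beta>" .
        have "\<bar>\<xi>\<bar> \<le> norm x * norm h" using \<xi>(1) Cauchy_Schwarz_ineq2[of x h] by linarith
        also have "\<dots> \<le> (1 + \<bar>T\<bar>) * (d / (1 + \<bar>T\<bar>))" using False h by (intro mult_mono) auto
        also have "\<dots> = d" by (simp add: add_nonneg_eq_0_iff)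
        finally have 2: "\<bar>\<xi>\<bar> \<le> d" .
        show ?thesis using d(2)[OF y 1 2] False e by simp
      qed
      have "\<bar>loss_remainder \<beta> y x h\<bar>
        = \<bar>curvature \<psi> \<psi>' y (x \<bullet> \<beta> + \<xi>) - curvature \<psi> \<psi>' y (x \<bullet> \<beta>)\<bar> / 2 * (x \<bullet> h)\<^sup>2"
        unfolding loss_remainder_def inner_add_right \<xi>(2)
        by (simp add: abs_mult left_diff_distrib[symmetric] diff_divide_distrib[symmetric])
      also have "\<dots> \<le> (e + C * indicator {x. norm x > T} x) * ((norm x)\<^sup>2 * (norm h)\<^sup>2)"
        using osc Cauchy_Schwarz_ineq[of x h] e C(1)
        by (intro mult_mono) (auto simp: power2_norm_eq_inner)
      finally show ?thesis by (simp add: mult.assoc)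
    qed
    moreover have "0 < d / (1 + \<bar>T\<bar>)" using d(1) by (simp add: add_pos_nonneg)
    ultimately show ?thesis by blast
  qed
  with C(1) show ?thesis by blast
qed

end

subsection \<open>Moments in the logistic model\<close>

lemma quadratic_form_coercive:
  fixes A :: "real ^ 'p ^ 'p"
  assumes pos: "\<And>z. z \<noteq> 0 \<Longrightarrow> 0 < z \<bullet> (A *v z)"
  obtains c where "0 < c" "\<And>z. c * (norm z)\<^sup>2 \<le> z \<bullet> (A *v z)"
proof -
  have "continuous_on (sphere 0 1) (\<lambda>z. z \<bullet> (A *v z))"
    by (intro continuous_intros linear_continuous_on matrix_vector_mul_bounded_linear)
  moreover have "axis undefined 1 \<in> (sphere 0 1 :: (real ^ 'p) set)" by (simp add: norm_axis_1)
  ultimately obtain z0 :: "real ^ 'p" where z0: "z0 \<in> sphere 0 1"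
      "\<And>z. z \<in> sphere 0 1 \<Longrightarrow> z0 \<bullet> (A *v z0) \<le> z \<bullet> (A *v z)"
    using continuous_attains_inf[OF compact_sphere, of "0 :: real ^ 'p" 1 "\<lambda>z. z \<bullet> (A *v z)"] by blast
  show ?thesis
  proof
    show "0 < z0 \<bullet> (A *v z0)" using z0(1) by (intro pos) auto
    show "z0 \<bullet> (A *v z0) * (norm z)\<^sup>2 \<le> z \<bullet> (A *v z)" for z
    proof (cases "z = 0")
      case False
      define v where "v = (1 / norm z) *\<^sub>R z"
      have "v \<in> sphere 0 1" using False by (simp add: v_def)
      moreover have zv: "z = norm z *\<^sub>R v" using False by (simp add: v_def)
      moreover have "z \<bullet> (A *v z) = (norm z)\<^sup>2 * (v \<bullet> (A *v v))"
        by (subst zv, subst (2) zv)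
          (simp only: matrix_vector_mult_scaleR inner_scaleR_left inner_scaleR_right power2_eq_square mult.assoc)
      ultimately show ?thesis
        using mult_right_mono[OF z0(2), of v "(norm z)\<^sup>2"] by (simp add: mult.commute)
    qed simp
  qed
qed

text \<open>Bilinear rather than quadratic, because the proof that A is positive definite tests A z
  against arbitrary vectors u. The measure is arbitrary, so counting measure later gives the same
  identity for empirical averages.\<close>

lemma inner_integral_matrix:
  fixes x :: "'w \<Rightarrow> real ^ 'p" and \<kappa> :: "'w \<Rightarrow> real"
  assumes "\<And>j k. integrable M (\<lambda>\<omega>. \<kappa> \<omega> * (x \<omega> $ j * x \<omega> $ k))"
  shows "integrable M (\<lambda>\<omega>. \<kappa> \<omega> * ((u \<bullet> x \<omega>) * (v \<bullet> x \<omega>)))"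
    and "u \<bullet> ((\<chi> j k. \<integral>\<omega>. \<kappa> \<omega> * (x \<omega> $ j * x \<omega> $ k) \<partial>M) *v v)
      = (\<integral>\<omega>. \<kappa> \<omega> * ((u \<bullet> x \<omega>) * (v \<bullet> x \<omega>)) \<partial>M)"
proof -
  have eq: "(\<lambda>\<omega>. \<kappa> \<omega> * ((u \<bullet> x \<omega>) * (v \<bullet> x \<omega>)))
      = (\<lambda>\<omega>. \<Sum>j\<in>UNIV. \<Sum>k\<in>UNIV. u $ j * v $ k * (\<kappa> \<omega> * (x \<omega> $ j * x \<omega> $ k)))"
  proof
    fix \<omega>
    have "(u \<bullet> x \<omega>) * (v \<bullet> x \<omega>) = (\<Sum>j\<in>UNIV. \<Sum>k\<in>UNIV. (u $ j * x \<omega> $ j) * (v $ k * x \<omega> $ k))"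
      by (simp only: inner_vec_def inner_real_def sum_product)
    then show "\<kappa> \<omega> * ((u \<bullet> x \<omega>) * (v \<bullet> x \<omega>))
      = (\<Sum>j\<in>UNIV. \<Sum>k\<in>UNIV. u $ j * v $ k * (\<kappa> \<omega> * (x \<omega> $ j * x \<omega> $ k)))"
      by (simp only: sum_distrib_left) (intro sum.cong refl, simp)
  qed
  show "integrable M (\<lambda>\<omega>. \<kappa> \<omega> * ((u \<bullet> x \<omega>) * (v \<bullet> x \<omega>)))"
    unfolding eq by (intro Bochner_Integration.integrable_sum integrable_mult_right assms)
  show "u \<bullet> ((\<chi> j k. \<integral>\<omega>. \<kappa> \<omega> * (x \<omega> $ j * x \<omega> $ k) \<partial>M) *v v)
      = (\<integral>\<omega>. \<kappa> \<omega> * ((u \<bullet> x \<omega>) * (v \<bullet> x \<omega>)) \<partial>M)"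
  proof -
    let ?g = "\<lambda>j k \<omega>. \<kappa> \<omega> * (x \<omega> $ j * x \<omega> $ k)"
    have "(\<integral>\<omega>. \<kappa> \<omega> * ((u \<bullet> x \<omega>) * (v \<bullet> x \<omega>)) \<partial>M)
        = (\<Sum>j\<in>UNIV. \<integral>\<omega>. (\<Sum>k\<in>UNIV. u $ j * v $ k * ?g j k \<omega>) \<partial>M)"
      unfolding eq
      by (intro Bochner_Integration.integral_sum Bochner_Integration.integrable_sum integrable_mult_right assms)
    also have "\<dots> = (\<Sum>j\<in>UNIV. \<Sum>k\<in>UNIV. \<integral>\<omega>. u $ j * v $ k * ?g j k \<omega> \<partial>M)"
      by (intro sum.cong refl Bochner_Integration.integral_sum integrable_mult_right assms)
    also have "\<dots> = (\<Sum>j\<in>UNIV. \<Sum>k\<in>UNIV. u $ j * v $ k * (\<integral>\<omega>. ?g j k \<omega> \<partial>M))"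
      by (simp only: integral_mult_right_zero)
    also have "\<dots> = u \<bullet> ((\<chi> j k. \<integral>\<omega>. ?g j k \<omega> \<partial>M) *v v)"
      unfolding inner_vec_def matrix_vector_mult_def
      by (simp add: sum_distrib_left) (intro sum.cong refl, simp)
    finally show ?thesis by (rule sym)
  qed
qed

locale logistic_model = smooth_loss \<rho> \<psi> \<psi>' + prob_space M
  for \<rho> \<psi> \<psi>' :: "real \<Rightarrow> real" and M :: "'w measure" +
  fixes y :: "'w \<Rightarrow> real" and x :: "'w \<Rightarrow> real ^ 'p" and \<beta>0 :: "real ^ 'p"
    and w :: "real ^ 'p \<Rightarrow> real"
  assumes rv_y [measurable]: "y \<in> borel_measurable M" and rv_x [measurable]: "x \<in> borel_measurable M"
    and binary: "\<And>\<omega>. \<omega> \<in> space M \<Longrightarrow> y \<omega> \<in> {0, 1}"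
    and model: "AE \<omega> in M.
      real_cond_exp M (vimage_algebra (space M) x borel)
        (indicator {\<omega>' \<in> space M. y \<omega>' = 1}) \<omega> = logistic (x \<omega> \<bullet> \<beta>0)"
    and w_meas [measurable]: "w \<in> borel_measurable borel"
    and w_nonneg: "\<And>v. 0 \<le> w v" and w_le_1: "\<And>v. w v \<le> 1"
    and moment: "integrable M (\<lambda>\<omega>. w (x \<omega>) * (norm (x \<omega>))\<^sup>2)"
begin

text \<open>The conditional model is converted here into an identity of moments. A function of
  \<open>x\<close> is measurable for the sigma-algebra generated by \<open>x\<close>, so it can be
  moved through the conditional expectation; \<open>y\<close> agrees with the indicator of y =
  1.\<close>

lemma expectation_response:
  fixes f :: "real ^ 'p \<Rightarrow> real"
  assumes [measurable]: "f \<in> borel_measurable borel" and int: "integrable M (\<lambda>\<omega>. f (x \<omega>))"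
  shows "integrable M (\<lambda>\<omega>. f (x \<omega>) * y \<omega>)" "integrable M (\<lambda>\<omega>. f (x \<omega>) * logistic (x \<omega> \<bullet> \<beta>0))"
    and "expectation (\<lambda>\<omega>. f (x \<omega>) * y \<omega>) = expectation (\<lambda>\<omega>. f (x \<omega>) * logistic (x \<omega> \<bullet> \<beta>0))"
proof -
  let ?F = "vimage_algebra (space M) x borel"
  let ?I = "indicator {\<omega>' \<in> space M. y \<omega>' = 1} :: 'w \<Rightarrow> real"
  have "subalgebra M ?F"
    unfolding subalgebra_def using rv_x by (auto simp: sets_vimage_algebra2 measurable_space)
  then interpret finite_measure_subalgebra M ?F
    by unfold_locales
  have f_meas: "(\<lambda>\<omega>. f (x \<omega>)) \<in> borel_measurable ?F"
    by (rule measurable_compose[OF measurable_vimage_algebra1]) auto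
  have y_eq: "f (x \<omega>) * y \<omega> = f (x \<omega>) * ?I \<omega>" if "\<omega> \<in> space M" for \<omega>
    using binary[OF that] that by (auto simp: indicator_def)
  show int_y: "integrable M (\<lambda>\<omega>. f (x \<omega>) * y \<omega>)"
  proof (rule Bochner_Integration.integrable_bound[OF int])
    show "AE \<omega> in M. norm (f (x \<omega>) * y \<omega>) \<le> norm (f (x \<omega>))"
    proof (rule AE_I2)
      fix \<omega> assume "\<omega> \<in> space M"
      from binary[OF this] show "norm (f (x \<omega>) * y \<omega>) \<le> norm (f (x \<omega>))" by auto
    qed
  qed measurable
  have int_I: "integrable M (\<lambda>\<omega>. f (x \<omega>) * ?I \<omega>)"
    by (rule iffD1[OF Bochner_Integration.integrable_cong[OF refl y_eq] int_y])
  show int_F: "integrable M (\<lambda>\<omega>. f (x \<omega>) * logistic (x \<omega> \<bullet> \<beta>0))"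
  proof (rule Bochner_Integration.integrable_bound[OF int])
    show "AE \<omega> in M. norm (f (x \<omega>) * logistic (x \<omega> \<bullet> \<beta>0)) \<le> norm (f (x \<omega>))"
      by (simp add: abs_mult mult_left_le abs_of_pos[OF logistic_gt_0] less_imp_le[OF logistic_lt_1])
  qed measurable
  have "expectation (\<lambda>\<omega>. f (x \<omega>) * y \<omega>) = expectation (\<lambda>\<omega>. f (x \<omega>) * ?I \<omega>)"
    by (rule Bochner_Integration.integral_cong[OF refl y_eq])
  also have "\<dots> = expectation (\<lambda>\<omega>. f (x \<omega>) * real_cond_exp M ?F ?I \<omega>)"
    by (rule real_cond_exp_intg(2)[symmetric, OF int_I f_meas]) measurable
  also have "\<dots> = expectation (\<lambda>\<omega>. f (x \<omega>) * logistic (x \<omega> \<bullet> \<beta>0))"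
    using model int_F real_cond_exp_intg(1)[OF int_I f_meas]
    by (intro integral_cong_AE) auto
  finally show "expectation (\<lambda>\<omega>. f (x \<omega>) * y \<omega>) = expectation (\<lambda>\<omega>. f (x \<omega>) * logistic (x \<omega> \<bullet> \<beta>0))" .
qed

lemma expectation_residual:
  fixes f :: "real ^ 'p \<Rightarrow> real"
  assumes "f \<in> borel_measurable borel" and "integrable M (\<lambda>\<omega>. f (x \<omega>))"
  shows "integrable M (\<lambda>\<omega>. f (x \<omega>) * (y \<omega> - logistic (x \<omega> \<bullet> \<beta>0)))"
    and "expectation (\<lambda>\<omega>. f (x \<omega>) * (y \<omega> - logistic (x \<omega> \<bullet> \<beta>0))) = 0"
  using expectation_response[OF assms] by (auto simp: right_diff_distrib)

lemma expectation_residual_square: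
  fixes f :: "real ^ 'p \<Rightarrow> real"
  assumes f [measurable]: "f \<in> borel_measurable borel" and int: "integrable M (\<lambda>\<omega>. f (x \<omega>))"
  shows "integrable M (\<lambda>\<omega>. f (x \<omega>) * (y \<omega> - logistic (x \<omega> \<bullet> \<beta>0))\<^sup>2)"
    and "expectation (\<lambda>\<omega>. f (x \<omega>) * (y \<omega> - logistic (x \<omega> \<bullet> \<beta>0))\<^sup>2)
      = expectation (\<lambda>\<omega>. f (x \<omega>) * (logistic (x \<omega> \<bullet> \<beta>0) * (1 - logistic (x \<omega> \<bullet> \<beta>0))))"
proof -
  let ?F = "\<lambda>\<omega>. logistic (x \<omega> \<bullet> \<beta>0)"
  have g: "(\<lambda>v. f v * (1 - 2 * logistic (v \<bullet> \<beta>0))) \<in> borel_measurable borel" by measurable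
  have int_F: "integrable M (\<lambda>\<omega>. f (x \<omega>) * ?F \<omega>)" by (rule expectation_response(2)[OF f int])
  have int_g: "integrable M (\<lambda>\<omega>. f (x \<omega>) * (1 - 2 * ?F \<omega>))"
    using Bochner_Integration.integrable_diff[OF int integrable_mult_right[OF int_F, of 2]]
    by (simp add: algebra_simps)
  note res = expectation_residual[OF g int_g]
  have int_FF: "integrable M (\<lambda>\<omega>. f (x \<omega>) * (?F \<omega> * (1 - ?F \<omega>)))"
  proof (rule Bochner_Integration.integrable_bound[OF int_F])
    show "AE \<omega> in M. norm (f (x \<omega>) * (?F \<omega> * (1 - ?F \<omega>))) \<le> norm (f (x \<omega>) * ?F \<omega>)"
    proof (rule AE_I2)
      fix \<omega>
      have "\<bar>?F \<omega> * (1 - ?F \<omega>)\<bar> \<le> \<bar>?F \<omega>\<bar>"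
        using logistic_gt_0[of "x \<omega> \<bullet> \<beta>0"] logistic_lt_1[of "x \<omega> \<bullet> \<beta>0"] by (simp add: abs_mult mult_left_le)
      then show "norm (f (x \<omega>) * (?F \<omega> * (1 - ?F \<omega>))) \<le> norm (f (x \<omega>) * ?F \<omega>)"
        unfolding real_norm_def abs_mult[of "f (x \<omega>)"] by (intro mult_left_mono) auto
    qed
  qed measurable
  \<comment> \<open>since \<open>y\<^sup>2 = y\<close>\<close>
  have eq: "f (x \<omega>) * (y \<omega> - ?F \<omega>)\<^sup>2
    = f (x \<omega>) * (1 - 2 * ?F \<omega>) * (y \<omega> - ?F \<omega>) + f (x \<omega>) * (?F \<omega> * (1 - ?F \<omega>))" if "\<omega> \<in> space M" for \<omega>
    using binary[OF that] by (auto simp: power2_eq_square algebra_simps)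
  show "integrable M (\<lambda>\<omega>. f (x \<omega>) * (y \<omega> - ?F \<omega>)\<^sup>2)"
    by (rule iffD2[OF Bochner_Integration.integrable_cong[OF refl eq]
        Bochner_Integration.integrable_add[OF res(1) int_FF]])
  have "expectation (\<lambda>\<omega>. f (x \<omega>) * (y \<omega> - ?F \<omega>)\<^sup>2)
    = expectation (\<lambda>\<omega>. f (x \<omega>) * (1 - 2 * ?F \<omega>) * (y \<omega> - ?F \<omega>) + f (x \<omega>) * (?F \<omega> * (1 - ?F \<omega>)))"
    by (intro Bochner_Integration.integral_cong refl eq)
  then show "expectation (\<lambda>\<omega>. f (x \<omega>) * (y \<omega> - ?F \<omega>)\<^sup>2) = expectation (\<lambda>\<omega>. f (x \<omega>) * (?F \<omega> * (1 - ?F \<omega>)))"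
    using res int_FF by simp
qed

lemma integrable_weighted:
  fixes f :: "real ^ 'p \<Rightarrow> real"
  assumes [measurable]: "f \<in> borel_measurable borel" and C: "\<And>v. \<bar>f v\<bar> \<le> C * (1 + w v * (norm v)\<^sup>2)"
  shows "integrable M (\<lambda>\<omega>. f (x \<omega>))"
proof (rule Bochner_Integration.integrable_bound)
  show "integrable M (\<lambda>\<omega>. C * (1 + w (x \<omega>) * (norm (x \<omega>))\<^sup>2))"
    using moment by simp
  show "AE \<omega> in M. norm (f (x \<omega>)) \<le> norm (C * (1 + w (x \<omega>) * (norm (x \<omega>))\<^sup>2))"
    using C by (auto intro: order_trans[OF _ abs_ge_self])
qed measurable

lemma weighted_product_le: "\<bar>w v * (v $ j * v $ k)\<bar> \<le> w v * (norm v)\<^sup>2"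
  using mult_mono[OF component_le_norm_cart[of v j] component_le_norm_cart[of v k]] w_nonneg[of v]
  by (auto simp: abs_mult power2_eq_square intro!: mult_left_mono)

lemma weighted_norm_le: "w v * norm v \<le> 1 + w v * (norm v)\<^sup>2"
proof -
  \<comment> \<open>Completing the square: (|v| - 1/2)^2 >= 0.\<close>
  have "norm v \<le> 1 + (norm v)\<^sup>2"
    using zero_le_power2[of "norm v - 1 / 2"] by (simp add: power2_eq_square algebra_simps)
  from mult_left_mono[OF this w_nonneg[of v]] show ?thesis
    using w_le_1[of v] by (simp add: algebra_simps)
qed

lemma integrable_weighted_product:
  fixes k :: "real \<Rightarrow> real"
  assumes [measurable]: "k \<in> borel_measurable borel" and C: "\<And>t. \<bar>k t\<bar> \<le> C"
  shows "integrable M (\<lambda>\<omega>. k (x \<omega> \<bullet> \<beta>0) * w (x \<omega>) * (x \<omega> $ i * x \<omega> $ j))"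
proof (rule integrable_weighted[where f = "\<lambda>v. k (v \<bullet> \<beta>0) * w v * (v $ i * v $ j)" and C = C])
  fix v
  have "\<bar>k (v \<bullet> \<beta>0)\<bar> * \<bar>w v * (v $ i * v $ j)\<bar> \<le> C * (1 + w v * (norm v)\<^sup>2)"
    using weighted_product_le[of v i j] C[of "v \<bullet> \<beta>0"] w_nonneg[of v] by (intro mult_mono) auto
  then show "\<bar>k (v \<bullet> \<beta>0) * w v * (v $ i * v $ j)\<bar> \<le> C * (1 + w v * (norm v)\<^sup>2)"
    by (simp add: abs_mult mult.assoc)
qed measurable

definition fisher :: "real \<Rightarrow> real" where
  "fisher t = logistic t * (1 - logistic t) * nu_fun \<psi> t"

lemma fisher_nonneg: "0 \<le> fisher t"
  using nu_nonneg[of t] logistic_gt_0[of t] logistic_lt_1[of t] by (simp add: fisher_def)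

lemma borel_measurable_fisher [measurable]: "fisher \<in> borel_measurable borel"
  unfolding fisher_def [abs_def] by measurable

lemma fisher_bounded: "\<exists>C. \<forall>t. \<bar>fisher t\<bar> \<le> C"
proof -
  obtain C where C: "0 \<le> C" "\<And>t. \<bar>nu_fun \<psi> t\<bar> \<le> C" using loss_bounds by metis
  have "\<bar>fisher t\<bar> \<le> C" for t
  proof -
    have "\<bar>fisher t\<bar> = (logistic t * (1 - logistic t)) * \<bar>nu_fun \<psi> t\<bar>"
      using logistic_gt_0[of t] logistic_lt_1[of t] by (simp add: fisher_def abs_mult)
    also have "\<dots> \<le> 1 * C"
      using logistic_gt_0[of t] logistic_lt_1[of t] C by (intro mult_mono mult_le_one) auto
    finally show ?thesis by simp
  qed
  then show ?thesis by blast
qed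

lemma A_matrix_eq: "A_matrix M x \<psi> w \<beta>0 =
  (\<chi> j k. \<integral>\<omega>. (fisher (x \<omega> \<bullet> \<beta>0) * w (x \<omega>)) * (x \<omega> $ j * x \<omega> $ k) \<partial>M)"
  by (simp add: A_matrix_def fisher_def)

text \<open>The form of A integrates a nonnegative kernel times (z.x)^2. If it vanished at z, the
  kernel times (z.x)^2 would be 0 almost surely, so u.(A z) = 0 for every u, that is A z = 0, and
  invertibility would force z = 0.\<close>

lemma A_matrix_coercive:
  assumes inv: "invertible (A_matrix M x \<psi> w \<beta>0)"
  obtains c where "0 < c" "\<And>z. c * (norm z)\<^sup>2 \<le> z \<bullet> (A_matrix M x \<psi> w \<beta>0 *v z)"
proof (rule quadratic_form_coercive[of "A_matrix M x \<psi> w \<beta>0"])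
  let ?A = "A_matrix M x \<psi> w \<beta>0"
  let ?k = "\<lambda>\<omega>. fisher (x \<omega> \<bullet> \<beta>0) * w (x \<omega>)"
  obtain C where "\<And>t. \<bar>fisher t\<bar> \<le> C" using fisher_bounded by auto
  note form = inner_integral_matrix[OF integrable_weighted_product[OF borel_measurable_fisher this]]
  have k: "0 \<le> ?k \<omega>" for \<omega> using fisher_nonneg w_nonneg by simp
  fix z :: "real ^ 'p" assume "z \<noteq> 0"
  show "0 < z \<bullet> (?A *v z)"
  proof (rule ccontr)
    assume "\<not> 0 < z \<bullet> (?A *v z)"
    moreover have "0 \<le> z \<bullet> (?A *v z)"
      unfolding A_matrix_eq form(2) using k by (intro integral_nonneg_AE) auto
    ultimately have "(\<integral>\<omega>. ?k \<omega> * ((z \<bullet> x \<omega>) * (z \<bullet> x \<omega>)) \<partial>M) = 0"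
      unfolding A_matrix_eq form(2) by linarith
    moreover have "AE \<omega> in M. 0 \<le> ?k \<omega> * ((z \<bullet> x \<omega>) * (z \<bullet> x \<omega>))" using k by simp
    ultimately have AE0: "AE \<omega> in M. ?k \<omega> * ((z \<bullet> x \<omega>) * (z \<bullet> x \<omega>)) = 0"
      using integral_nonneg_eq_0_iff_AE[OF form(1)] by simp
    have "u \<bullet> (?A *v z) = 0" for u
    proof -
      have "(\<integral>\<omega>. ?k \<omega> * ((u \<bullet> x \<omega>) * (z \<bullet> x \<omega>)) \<partial>M) = (\<integral>\<omega>. 0 \<partial>M)"
        by (rule integral_cong_AE) (use AE0 in \<open>auto elim!: eventually_mono\<close>)
      then show ?thesis unfolding A_matrix_eq form(2) by simp
    qed
    from this[of "?A *v z"] have Az: "?A *v z = 0" by simp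
    obtain A' where "A' ** ?A = mat 1" using inv by (auto simp: invertible_def)
    then have "z = A' *v (?A *v z)" by (simp add: matrix_vector_mul_assoc)
    also have "\<dots> = 0" unfolding Az by simp
    finally have "z = 0" .
    with \<open>z \<noteq> 0\<close> show False by simp
  qed
qed (use that in blast)

section \<open>Moments of the score and of the Hessian\<close>

definition score_vec :: "real \<times> (real ^ 'p) \<Rightarrow> real ^ 'p" where
  "score_vec u = (score \<psi> (fst u) (snd u \<bullet> \<beta>0) * w (snd u)) *\<^sub>R snd u"

definition hessian :: "'p \<Rightarrow> 'p \<Rightarrow> real \<times> (real ^ 'p) \<Rightarrow> real" where
  "hessian j k u = curvature \<psi> \<psi>' (fst u) (snd u \<bullet> \<beta>0) * w (snd u) * (snd u $ j * snd u $ k)"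

lemma borel_measurable_hessian [measurable]: "hessian j k \<in> borel_measurable borel"
proof -
  have nth: "(\<lambda>u :: real \<times> (real ^ 'p). snd u $ i) \<in> borel_measurable (borel \<Otimes>\<^sub>M borel)" for i
    by (rule measurable_compose[OF measurable_snd borel_measurable_nth])
  show ?thesis
    unfolding hessian_def [abs_def] curvature_def borel_prod[symmetric] using nth by measurable
qed

lemma borel_measurable_score_vec [measurable]: "score_vec \<in> borel_measurable borel"
  unfolding score_vec_def [abs_def] score_def borel_prod[symmetric] by measurable

lemma expectation_score_vec: "expectation (\<lambda>\<omega>. a \<bullet> score_vec (y \<omega>, x \<omega>)) = 0"
proof -
  obtain C where C: "0 \<le> C" "\<And>t. \<bar>nu_fun \<psi> t\<bar> \<le> C" using loss_bounds by metis
  let ?f = "\<lambda>v. - nu_fun \<psi> (v \<bullet> \<beta>0) * w v * (a \<bullet> v)"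
  have "integrable M (\<lambda>\<omega>. ?f (x \<omega>))"
  proof (rule integrable_weighted[where C = "C * norm a"])
    fix v
    have "\<bar>?f v\<bar> = \<bar>nu_fun \<psi> (v \<bullet> \<beta>0)\<bar> * (w v * \<bar>a \<bullet> v\<bar>)"
      using w_nonneg[of v] by (simp add: abs_mult)
    also have "\<dots> \<le> C * (w v * (norm a * norm v))"
      using C w_nonneg[of v] by (intro mult_mono Cauchy_Schwarz_ineq2) auto
    also have "\<dots> = C * norm a * (w v * norm v)" by simp
    also have "\<dots> \<le> C * norm a * (1 + w v * (norm v)\<^sup>2)"
      using C(1) by (intro mult_left_mono weighted_norm_le) auto
    finally show "\<bar>?f v\<bar> \<le> C * norm a * (1 + w v * (norm v)\<^sup>2)" .
  qed measurable
  then have "expectation (\<lambda>\<omega>. ?f (x \<omega>) * (y \<omega> - logistic (x \<omega> \<bullet> \<beta>0))) = 0"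
    by (rule expectation_residual(2)[rotated]) measurable
  moreover have "a \<bullet> score_vec (y \<omega>, x \<omega>) = ?f (x \<omega>) * (y \<omega> - logistic (x \<omega> \<bullet> \<beta>0))" for \<omega>
    by (simp add: score_vec_def score_def algebra_simps)
  ultimately show ?thesis by simp
qed

text \<open>Since 0 <= w <= 1 gives w^2 <= w, the second moment of the score is dominated by the
  moment of w(x)|x|^2. The squared residual has conditional mean F (1 - F), which produces
  B.\<close>

lemma B_matrix_form:
  shows "integrable M (\<lambda>\<omega>. (norm (score_vec (y \<omega>, x \<omega>)))\<^sup>2)"
    and "expectation (\<lambda>\<omega>. (a \<bullet> score_vec (y \<omega>, x \<omega>))\<^sup>2) = a \<bullet> (B_matrix M x \<psi> w \<beta>0 *v a)"
proof -
  obtain C where C: "0 \<le> C" "\<And>t. \<bar>nu_fun \<psi> t\<bar> \<le> C" "\<And>y t. y \<in> {0, 1} \<Longrightarrow> \<bar>score \<psi> y t\<bar> \<le> C"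
    using loss_bounds by metis
  have w2: "(w v)\<^sup>2 \<le> w v" for v
    using w_nonneg[of v] w_le_1[of v] by (simp add: power2_eq_square mult_left_le)
  show "integrable M (\<lambda>\<omega>. (norm (score_vec (y \<omega>, x \<omega>)))\<^sup>2)"
  proof (rule Bochner_Integration.integrable_bound[OF integrable_mult_right[OF moment, of "C\<^sup>2"]])
    show "AE \<omega> in M. norm ((norm (score_vec (y \<omega>, x \<omega>)))\<^sup>2) \<le> norm (C\<^sup>2 * (w (x \<omega>) * (norm (x \<omega>))\<^sup>2))"
    proof (rule AE_I2)
      fix \<omega> assume "\<omega> \<in> space M"
      from C(3)[OF binary[OF this]] have "(score \<psi> (y \<omega>) (x \<omega> \<bullet> \<beta>0))\<^sup>2 \<le> C\<^sup>2"
        by (rule abs_le_square_iff[THEN iffD1, OF order_trans[OF _ abs_ge_self]])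
      then have "(score \<psi> (y \<omega>) (x \<omega> \<bullet> \<beta>0))\<^sup>2 * ((w (x \<omega>))\<^sup>2 * (norm (x \<omega>))\<^sup>2) \<le> C\<^sup>2 * (w (x \<omega>) * (norm (x \<omega>))\<^sup>2)"
        using w2 w_nonneg by (intro mult_mono) auto
      then show "norm ((norm (score_vec (y \<omega>, x \<omega>)))\<^sup>2) \<le> norm (C\<^sup>2 * (w (x \<omega>) * (norm (x \<omega>))\<^sup>2))"
        using w_nonneg by (simp add: score_vec_def power_mult_distrib abs_mult mult.assoc)
    qed
  qed measurable
  let ?f = "\<lambda>v. (nu_fun \<psi> (v \<bullet> \<beta>0))\<^sup>2 * (w v)\<^sup>2 * (a \<bullet> v)\<^sup>2"
  let ?k = "\<lambda>\<omega>. logistic (x \<omega> \<bullet> \<beta>0) * (1 - logistic (x \<omega> \<bullet> \<beta>0)) * (nu_fun \<psi> (x \<omega> \<bullet> \<beta>0))\<^sup>2 * (w (x \<omega>))\<^sup>2"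
  have nu2: "(nu_fun \<psi> t)\<^sup>2 \<le> C\<^sup>2" for t
    by (rule abs_le_square_iff[THEN iffD1, OF order_trans[OF C(2) abs_ge_self]])
  have int_f: "integrable M (\<lambda>\<omega>. ?f (x \<omega>))"
  proof (rule integrable_weighted[where C = "C\<^sup>2 * (norm a)\<^sup>2"])
    fix v
    have "(a \<bullet> v)\<^sup>2 \<le> (norm a)\<^sup>2 * (norm v)\<^sup>2"
      using Cauchy_Schwarz_ineq[of a v] by (simp add: power2_norm_eq_inner)
    then have "?f v \<le> C\<^sup>2 * w v * ((norm a)\<^sup>2 * (norm v)\<^sup>2)"
      using nu2 w2 w_nonneg by (intro mult_mono) auto
    also have "\<dots> \<le> C\<^sup>2 * (norm a)\<^sup>2 * (1 + w v * (norm v)\<^sup>2)"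
      by (simp add: algebra_simps)
    finally show "\<bar>?f v\<bar> \<le> C\<^sup>2 * (norm a)\<^sup>2 * (1 + w v * (norm v)\<^sup>2)" by simp
  qed measurable
  have int_k: "integrable M (\<lambda>\<omega>. ?k \<omega> * (x \<omega> $ i * x \<omega> $ j))" for i j
  proof (rule integrable_weighted[where C = "C\<^sup>2" and
      f = "\<lambda>v. logistic (v \<bullet> \<beta>0) * (1 - logistic (v \<bullet> \<beta>0)) * (nu_fun \<psi> (v \<bullet> \<beta>0))\<^sup>2 * (w v)\<^sup>2 * (v $ i * v $ j)"])
    fix v
    let ?t = "v \<bullet> \<beta>0"
    note F = logistic_gt_0[of ?t] logistic_lt_1[of ?t]
    have 1: "logistic ?t * (1 - logistic ?t) * (nu_fun \<psi> ?t)\<^sup>2 \<le> 1 * C\<^sup>2"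
      using F nu2 by (intro mult_mono mult_le_one) auto
    have 2: "w v * \<bar>w v * (v $ i * v $ j)\<bar> \<le> 1 * (1 + w v * (norm v)\<^sup>2)"
      using w_nonneg[of v] w_le_1[of v] weighted_product_le[of v i j] by (intro mult_mono) auto
    have "(logistic ?t * (1 - logistic ?t) * (nu_fun \<psi> ?t)\<^sup>2) * (w v * \<bar>w v * (v $ i * v $ j)\<bar>)
        \<le> (1 * C\<^sup>2) * (1 * (1 + w v * (norm v)\<^sup>2))"
      by (rule mult_mono[OF 1 2]) (use w_nonneg[of v] in simp_all)
    then show "\<bar>logistic ?t * (1 - logistic ?t) * (nu_fun \<psi> ?t)\<^sup>2 * (w v)\<^sup>2 * (v $ i * v $ j)\<bar>
        \<le> C\<^sup>2 * (1 + w v * (norm v)\<^sup>2)"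
      using F w_nonneg[of v] by (simp add: abs_mult power2_eq_square mult_ac)
  qed measurable
  have "expectation (\<lambda>\<omega>. (a \<bullet> score_vec (y \<omega>, x \<omega>))\<^sup>2)
    = expectation (\<lambda>\<omega>. ?f (x \<omega>) * (y \<omega> - logistic (x \<omega> \<bullet> \<beta>0))\<^sup>2)"
    by (intro Bochner_Integration.integral_cong)
      (auto simp: score_vec_def score_def power_mult_distrib power2_commute)
  also have "\<dots> = expectation (\<lambda>\<omega>. ?f (x \<omega>) * (logistic (x \<omega> \<bullet> \<beta>0) * (1 - logistic (x \<omega> \<bullet> \<beta>0))))"
    by (rule expectation_residual_square(2)[OF _ int_f]) measurable
  also have "\<dots> = expectation (\<lambda>\<omega>. ?k \<omega> * ((a \<bullet> x \<omega>) * (a \<bullet> x \<omega>)))"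
    by (intro Bochner_Integration.integral_cong) (auto simp: power2_eq_square)
  also have "\<dots> = a \<bullet> (B_matrix M x \<psi> w \<beta>0 *v a)"
    unfolding B_matrix_def by (rule inner_integral_matrix(2)[symmetric, OF int_k])
  finally show "expectation (\<lambda>\<omega>. (a \<bullet> score_vec (y \<omega>, x \<omega>))\<^sup>2) = a \<bullet> (B_matrix M x \<psi> w \<beta>0 *v a)" .
qed

text \<open>The curvature is the kernel of A minus a function of \<open>x\<close> times the
  residual, and the latter integrates to 0.\<close>

lemma A_matrix_hessian:
  shows "integrable M (\<lambda>\<omega>. hessian j k (y \<omega>, x \<omega>))"
    and "expectation (\<lambda>\<omega>. hessian j k (y \<omega>, x \<omega>)) = A_matrix M x \<psi> w \<beta>0 $ j $ k"
proof -
  obtain C where C: "\<And>t. \<bar>nu_deriv \<psi> \<psi>' t\<bar> \<le> C" using loss_bounds by metis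
  obtain C' where C': "\<And>t. \<bar>fisher t\<bar> \<le> C'" using fisher_bounded by auto
  let ?f = "\<lambda>v. nu_deriv \<psi> \<psi>' (v \<bullet> \<beta>0) * w v * (v $ j * v $ k)"
  have "?f \<in> borel_measurable borel" by measurable
  from expectation_residual[OF this integrable_weighted_product[OF borel_measurable_nu_deriv C, of j k]]
  have f: "integrable M (\<lambda>\<omega>. ?f (x \<omega>) * (y \<omega> - logistic (x \<omega> \<bullet> \<beta>0)))"
    "expectation (\<lambda>\<omega>. ?f (x \<omega>) * (y \<omega> - logistic (x \<omega> \<bullet> \<beta>0))) = 0" .
  note g = integrable_weighted_product[OF borel_measurable_fisher C', of j k]
  have eq: "hessian j k (y \<omega>, x \<omega>) = fisher (x \<omega> \<bullet> \<beta>0) * w (x \<omega>) * (x \<omega> $ j * x \<omega> $ k)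
      - ?f (x \<omega>) * (y \<omega> - logistic (x \<omega> \<bullet> \<beta>0))" for \<omega>
    by (simp add: hessian_def curvature_def fisher_def algebra_simps)
  show "integrable M (\<lambda>\<omega>. hessian j k (y \<omega>, x \<omega>))"
    unfolding eq using f(1) g by (intro Bochner_Integration.integrable_diff) simp_all
  show "expectation (\<lambda>\<omega>. hessian j k (y \<omega>, x \<omega>)) = A_matrix M x \<psi> w \<beta>0 $ j $ k"
    unfolding eq A_matrix_eq using f g by simp
qed

end

subsection \<open>Events of asymptotically large probability\<close>

text \<open>The exceptional set is measurable, but \<open>P n\<close> itself need not be: it will be
  quantified over uncountably many z or assert global minimality. Stating a fixed level
  \<open>e\<close> lets the levels of several events simply be added.\<close>

definition eventually_prob :: "'w measure \<Rightarrow> real \<Rightarrow> (nat \<Rightarrow> 'w \<Rightarrow> bool) \<Rightarrow> bool" where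
  "eventually_prob M e P \<longleftrightarrow>
     (\<forall>\<^sub>F n in sequentially. \<exists>E\<in>sets M. measure M E \<le> e \<and> (\<forall>\<omega>\<in>space M - E. P n \<omega>))"

lemma eventually_prob_mono:
  assumes "eventually_prob M e P" "\<forall>\<^sub>F n in sequentially. \<forall>\<omega>\<in>space M. P n \<omega> \<longrightarrow> Q n \<omega>"
  shows "eventually_prob M e Q"
  using assms unfolding eventually_prob_def by eventually_elim blast

lemma (in prob_space) eventually_prob_conj:
  assumes "eventually_prob M d P" "eventually_prob M e Q"
  shows "eventually_prob M (d + e) (\<lambda>n \<omega>. P n \<omega> \<and> Q n \<omega>)"
  using assms unfolding eventually_prob_def
proof eventually_elim
  case (elim n)
  then obtain E E' where E: "E \<in> events" "prob E \<le> d" "\<forall>\<omega>\<in>space M - E. P n \<omega>"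
    and E': "E' \<in> events" "prob E' \<le> e" "\<forall>\<omega>\<in>space M - E'. Q n \<omega>" by blast
  have "prob (E \<union> E') \<le> d + e"
    using measure_Un_le[OF E(1) E'(1)] E(2) E'(2) by linarith
  then show ?case
    using E E' by (intro bexI[of _ "E \<union> E'"]) auto
qed

lemma (in prob_space) eventually_prob_tendsto_0:
  assumes "(\<lambda>n. prob {\<omega> \<in> space M. \<not> P n \<omega>}) \<longlonglongrightarrow> 0" "\<And>n. {\<omega> \<in> space M. \<not> P n \<omega>} \<in> events" "0 < e"
  shows "eventually_prob M e P"
proof -
  have "\<forall>\<^sub>F n in sequentially. prob {\<omega> \<in> space M. \<not> P n \<omega>} < e"
    using assms by (auto dest: order_tendstoD(2))
  then show ?thesis
    unfolding eventually_prob_def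
  proof eventually_elim
    case (elim n)
    then show ?case using assms(2)[of n] by (intro bexI[of _ "{\<omega> \<in> space M. \<not> P n \<omega>}"]) auto
  qed
qed

lemma (in prob_space) eventually_prob_AE:
  assumes "AE \<omega> in M. P \<omega>"
  shows "eventually_prob M 0 (\<lambda>n. P)"
proof -
  obtain E where "{\<omega> \<in> space M. \<not> P \<omega>} \<subseteq> E" "emeasure M E = 0" "E \<in> events"
    using assms by (rule AE_E)
  then show ?thesis
    unfolding eventually_prob_def by (intro always_eventually allI bexI[of _ E]) (auto simp: measure_def)
qed

lemma (in prob_space) eventually_prob_all:
  fixes P :: "'i::finite \<Rightarrow> nat \<Rightarrow> 'a \<Rightarrow> bool"
  assumes "\<And>i e. 0 < e \<Longrightarrow> eventually_prob M e (P i)" and e: "0 < e"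
  shows "eventually_prob M e (\<lambda>n \<omega>. \<forall>i. P i n \<omega>)"
proof -
  have "\<exists>E\<in>events. prob E \<le> e \<and> (\<forall>\<omega>\<in>space M - E. \<forall>i. P i n \<omega>)"
    if all: "\<forall>i. \<exists>E\<in>events. prob E \<le> e / CARD('i) \<and> (\<forall>\<omega>\<in>space M - E. P i n \<omega>)" for n
  proof -
    obtain E where E: "\<forall>i. E i \<in> events \<and> prob (E i) \<le> e / CARD('i) \<and> (\<forall>\<omega>\<in>space M - E i. P i n \<omega>)"
      using choice[OF all[unfolded Bex_def]] by blast
    have "prob (\<Union>i. E i) \<le> (\<Sum>i\<in>UNIV. prob (E i))"
      using E by (intro measure_UNION_le) auto
    also have "\<dots> \<le> (\<Sum>i::'i\<in>UNIV. e / CARD('i))" using E by (intro sum_mono) blast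
    finally have "prob (\<Union>i. E i) \<le> e" by simp
    then show ?thesis using E by (intro bexI[of _ "\<Union>i. E i"]) auto
  qed
  moreover have "\<forall>\<^sub>F n in sequentially. \<forall>i. \<exists>E\<in>events. prob E \<le> e / CARD('i) \<and> (\<forall>\<omega>\<in>space M - E. P i n \<omega>)"
    using assms(1)[of "e / CARD('i)"] e unfolding eventually_prob_def
    by (intro eventually_all_finite) simp
  ultimately show ?thesis
    unfolding eventually_prob_def by (auto elim: eventually_mono)
qed

lemma (in prob_space) eventually_prob_bounded:
  fixes Z :: "nat \<Rightarrow> 'a \<Rightarrow> 'b::{real_normed_vector, second_countable_topology}"
  assumes Z [measurable]: "\<And>n. Z n \<in> borel_measurable M" and b: "bounded_in_probability M Z" and e: "0 < e"
  obtains K where "eventually_prob M e (\<lambda>n \<omega>. norm (Z n \<omega>) \<le> K)"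
proof -
  obtain K where "\<forall>\<^sub>F n in sequentially. prob {\<omega> \<in> space M. norm (Z n \<omega>) > K} < e"
    using b e unfolding bounded_in_probability_def by blast
  then have "eventually_prob M e (\<lambda>n \<omega>. norm (Z n \<omega>) \<le> K)"
    unfolding eventually_prob_def
  proof eventually_elim
    case (elim n)
    then show ?case by (intro bexI[of _ "{\<omega> \<in> space M. norm (Z n \<omega>) > K}"]) auto
  qed
  then show ?thesis by (rule that)
qed

lemma (in prob_space) eventually_prob_converges:
  fixes Z :: "nat \<Rightarrow> 'a \<Rightarrow> 'b::{second_countable_topology, metric_space}"
  assumes Z [measurable]: "\<And>n. Z n \<in> borel_measurable M" and "converges_in_probability M Z c"
    and "0 < r" "0 < e"
  shows "eventually_prob M e (\<lambda>n \<omega>. dist (Z n \<omega>) c \<le> r)"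
proof (rule eventually_prob_tendsto_0)
  show "(\<lambda>n. prob {\<omega> \<in> space M. \<not> dist (Z n \<omega>) c \<le> r}) \<longlonglongrightarrow> 0"
    using assms unfolding converges_in_probability_def by (simp add: not_le)
qed (use assms in auto)

text \<open>A continuous test function is uniformly continuous only on compact sets. Tightness
  confines \<open>X n\<close> to the ball of radius K, and the ball of radius K + 1 leaves room for
  \<open>Y n\<close>, which is within distance 1.\<close>

lemma converges_in_distribution_slutsky:
  fixes X Y :: "nat \<Rightarrow> 'w \<Rightarrow> 'b::euclidean_space"
  assumes "prob_space M" and X: "converges_in_distribution M X N Z0"
    and Y: "\<And>n. Y n \<in> borel_measurable M"
    and tight: "\<And>e. 0 < e \<Longrightarrow> \<exists>K. eventually_prob M e (\<lambda>n \<omega>. norm (X n \<omega>) \<le> K)"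
    and close: "\<And>e r. 0 < e \<Longrightarrow> 0 < r \<Longrightarrow> eventually_prob M e (\<lambda>n \<omega>. dist (Y n \<omega>) (X n \<omega>) \<le> r)"
  shows "converges_in_distribution M Y N Z0"
  unfolding converges_in_distribution_def
proof (intro conjI allI impI)
  interpret prob_space M by fact
  show "Y n \<in> borel_measurable M" for n by fact
  show "Z0 \<in> borel_measurable N" using X by (simp add: converges_in_distribution_def)
  have X_meas: "X n \<in> borel_measurable M" for n using X by (simp add: converges_in_distribution_def)
  fix f :: "'b \<Rightarrow> real" assume f: "continuous_on UNIV f" and "bounded (range f)"
  then obtain B where B: "\<And>v. \<bar>f v\<bar> \<le> B" unfolding bounded_iff real_norm_def by blast
  have "0 \<le> B" using abs_ge_zero[of "f 0"] B[of 0] by linarith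
  have "(\<lambda>n. expectation (\<lambda>\<omega>. f (Y n \<omega>)) - expectation (\<lambda>\<omega>. f (X n \<omega>))) \<longlonglongrightarrow> 0"
  proof (rule tendstoI)
    fix r :: real assume r: "0 < r"
    define c where "c = 2 + 2 * B"
    have "0 < c" using \<open>0 \<le> B\<close> unfolding c_def by linarith
    define e where "e = r / 2 / c"
    have e: "0 < e" "e * c < r"
      using r \<open>0 < c\<close> by (simp_all add: e_def)
    obtain K where K: "eventually_prob M (e / 2) (\<lambda>n \<omega>. norm (X n \<omega>) \<le> K)"
      using tight[of "e / 2"] e(1) by auto
    have "uniformly_continuous_on (cball 0 (K + 1)) f"
      by (intro compact_uniformly_continuous continuous_on_subset[OF f]) auto
    then obtain d where d: "0 < d" "\<And>u v. u \<in> cball 0 (K + 1) \<Longrightarrow> v \<in> cball 0 (K + 1) \<Longrightarrow>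
        dist u v < d \<Longrightarrow> dist (f u) (f v) < e"
      using e(1) unfolding uniformly_continuous_on_def by metis
    have "eventually_prob M (e / 2) (\<lambda>n \<omega>. dist (Y n \<omega>) (X n \<omega>) \<le> min 1 (d / 2))"
      using e(1) d(1) by (intro close) auto
    from eventually_prob_conj[OF K this]
    show "\<forall>\<^sub>F n in sequentially. dist (expectation (\<lambda>\<omega>. f (Y n \<omega>)) - expectation (\<lambda>\<omega>. f (X n \<omega>))) 0 < r"
      unfolding eventually_prob_def
    proof eventually_elim
      case (elim n)
      then obtain E where E: "E \<in> events" "prob E \<le> e"
        "\<And>\<omega>. \<omega> \<in> space M - E \<Longrightarrow> norm (X n \<omega>) \<le> K"
        "\<And>\<omega>. \<omega> \<in> space M - E \<Longrightarrow> dist (Y n \<omega>) (X n \<omega>) \<le> min 1 (d / 2)" by auto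
      have "\<bar>f (Y n \<omega>) - f (X n \<omega>)\<bar> \<le> e + 2 * B * indicator E \<omega>" if "\<omega> \<in> space M" for \<omega>
      proof (cases "\<omega> \<in> E")
        case True
        have "\<bar>f (Y n \<omega>) - f (X n \<omega>)\<bar> \<le> 2 * B" using B[of "Y n \<omega>"] B[of "X n \<omega>"] by linarith
        then show ?thesis using True e(1) by simp
      next
        case False
        have *: "norm (X n \<omega>) \<le> K" "dist (Y n \<omega>) (X n \<omega>) \<le> min 1 (d / 2)"
          using E(3,4)[of \<omega>] that False by simp_all
        have "norm (Y n \<omega>) \<le> norm (X n \<omega>) + dist (Y n \<omega>) (X n \<omega>)"
          using norm_triangle_sub[of "Y n \<omega>" "X n \<omega>"] by (simp add: dist_norm)
        with * have "dist (f (Y n \<omega>)) (f (X n \<omega>)) < e"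
          using d(1) by (intro d(2)) auto
        then show ?thesis using False by (simp add: dist_real_def)
      qed
      then have "\<bar>expectation (\<lambda>\<omega>. f (Y n \<omega>)) - expectation (\<lambda>\<omega>. f (X n \<omega>))\<bar> \<le> e + 2 * B * prob E"
        by (intro expectation_close integrable_continuous_bounded[OF f B Y]
            integrable_continuous_bounded[OF f B X_meas] E(1))
      also have "\<dots> \<le> e + 2 * B * e"
        using E(2) \<open>0 \<le> B\<close> by (intro add_left_mono mult_left_mono) auto
      also have "\<dots> \<le> e * c" using e(1) by (simp add: c_def algebra_simps)
      also have "\<dots> < r" by (rule e)
      finally show ?case by (simp add: dist_real_def)
    qed
  qed
  from tendsto_add[OF this, of "\<lambda>n. expectation (\<lambda>\<omega>. f (X n \<omega>))" "\<integral>\<omega>. f (Z0 \<omega>) \<partial>N"]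
  show "(\<lambda>n. expectation (\<lambda>\<omega>. f (Y n \<omega>))) \<longlonglongrightarrow> (\<integral>\<omega>. f (Z0 \<omega>) \<partial>N)"
    using X f \<open>bounded (range f)\<close> by (simp add: converges_in_distribution_def)
qed

subsection \<open>The penalized objective near the true parameter\<close>

locale logistic_sample = logistic_model \<rho> \<psi> \<psi>' M y x \<beta>0 w
  for \<rho> \<psi> \<psi>' :: "real \<Rightarrow> real" and M :: "'w measure" and y :: "'w \<Rightarrow> real"
    and x :: "'w \<Rightarrow> real ^ 'p" and \<beta>0 :: "real ^ 'p" and w :: "real ^ 'p \<Rightarrow> real" +
  fixes ys :: "nat \<Rightarrow> 'w \<Rightarrow> real" and xs :: "nat \<Rightarrow> 'w \<Rightarrow> real ^ 'p"
  assumes sample_indep: "indep_vars (\<lambda>_. borel) (\<lambda>i \<omega>. (ys i \<omega>, xs i \<omega>)) {1..}"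
    and sample_copies: "\<And>i. i \<ge> 1 \<Longrightarrow>
      distr M borel (\<lambda>\<omega>. (ys i \<omega>, xs i \<omega>)) = distr M borel (\<lambda>\<omega>. (y \<omega>, x \<omega>))"
begin

text \<open>The shift by one matches sums over \<open>i < n\<close>, while the original sample
  starts at index 1.\<close>

definition obs :: "nat \<Rightarrow> 'w \<Rightarrow> real \<times> (real ^ 'p)" where
  "obs i \<omega> = (ys (Suc i) \<omega>, xs (Suc i) \<omega>)"

abbreviation D :: "(real \<times> (real ^ 'p)) measure" where
  "D \<equiv> distr M borel (\<lambda>\<omega>. (y \<omega>, x \<omega>))"

sublocale iid_sample M obs D
proof
  have eq: "range Suc = {1::nat..}"
    by (simp add: atLeast_Suc_greaterThan greaterThan_0)
  show "indep_vars (\<lambda>_. borel) obs UNIV"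
    unfolding obs_def [abs_def]
    by (rule indep_vars_reindex[where f = Suc and X = "\<lambda>i \<omega>. (ys i \<omega>, xs i \<omega>)" and M' = "\<lambda>_. borel"])
      (use sample_indep eq in auto)
  show "distr M borel (obs i) = D" for i
    unfolding obs_def [abs_def] by (rule sample_copies) simp
qed

lemma pair_measurable [measurable]: "(\<lambda>\<omega>. (y \<omega>, x \<omega>)) \<in> borel_measurable M"
  by (simp add: borel_prod[symmetric])

lemma integrable_D_iff:
  fixes h :: "real \<times> (real ^ 'p) \<Rightarrow> real"
  assumes "h \<in> borel_measurable borel"
  shows "integrable D h \<longleftrightarrow> integrable M (\<lambda>\<omega>. h (y \<omega>, x \<omega>))"
  by (rule integrable_distr_eq) (use assms in auto)

lemma integral_D:
  fixes h :: "real \<times> (real ^ 'p) \<Rightarrow> real"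
  assumes "h \<in> borel_measurable borel"
  shows "integral\<^sup>L D h = expectation (\<lambda>\<omega>. h (y \<omega>, x \<omega>))"
  by (rule integral_distr) (use assms in auto)

text \<open>Only the generic pair is binary at every outcome. The sample shares its law alone, so
  for the sample this holds almost surely.\<close>

lemma AE_binary: "AE \<omega> in M. \<forall>i. fst (obs i \<omega>) \<in> {0, 1}"
proof -
  have "Measurable.pred borel (\<lambda>u :: real \<times> (real ^ 'p). fst u \<in> {0, 1})"
    unfolding borel_prod[symmetric] by measurable
  moreover from this have "AE u in D. fst u \<in> {0, 1}"
    by (subst AE_distr_iff) (use binary in auto)
  ultimately show ?thesis
    unfolding AE_all_countable by (intro allI AE_U) auto
qed

definition score_sum :: "nat \<Rightarrow> 'w \<Rightarrow> real ^ 'p" where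
  "score_sum n \<omega> = (\<Sum>i<n. score_vec (obs i \<omega>)) /\<^sub>R sqrt n"

lemma
  shows score_sum_measurable [measurable]: "score_sum n \<in> borel_measurable M"
    and score_sum_bounded: "bounded_in_probability M score_sum"
    and score_sum_clt: "prob_space N \<Longrightarrow> multivariate_normal N W 0 (B_matrix M x \<psi> w \<beta>0) \<Longrightarrow>
      converges_in_distribution M score_sum N W"
proof -
  have sq: "integrable D (\<lambda>u. (norm (score_vec u))\<^sup>2)"
    by (subst integrable_D_iff) (use B_matrix_form(1) in auto)
  have mean: "(\<integral>u. a \<bullet> score_vec u \<partial>D) = 0" for a
    by (subst integral_D) (use expectation_score_vec in auto)
  have cov: "(\<integral>u. (a \<bullet> score_vec u)\<^sup>2 \<partial>D) = a \<bullet> (B_matrix M x \<psi> w \<beta>0 *v a)" for a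
    by (subst integral_D) (use B_matrix_form(2) in auto)
  show "score_sum n \<in> borel_measurable M"
    unfolding score_sum_def [abs_def] by measurable
  show "bounded_in_probability M score_sum"
    unfolding score_sum_def [abs_def]
    by (rule bounded_in_probability_vector_sum[OF borel_measurable_score_vec sq mean])
  show "converges_in_distribution M score_sum N W"
    if "prob_space N" "multivariate_normal N W 0 (B_matrix M x \<psi> w \<beta>0)"
    unfolding score_sum_def [abs_def]
    by (rule vector_clt[OF borel_measurable_score_vec sq mean that cov])
qed

definition hessian_mean :: "nat \<Rightarrow> 'w \<Rightarrow> real ^ 'p ^ 'p" where
  "hessian_mean n \<omega> = (\<chi> j k. (\<Sum>i<n. hessian j k (obs i \<omega>)) / n)"

lemma hessian_mean_tendsto:
  assumes "0 < e" "0 < r"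
  shows "eventually_prob M e (\<lambda>n \<omega>. \<forall>j k. \<bar>hessian_mean n \<omega> $ j $ k - A_matrix M x \<psi> w \<beta>0 $ j $ k\<bar> \<le> r)"
proof (intro eventually_prob_all)
  fix j k :: 'p and e :: real assume e: "0 < e"
  have "integrable D (hessian j k)" "integral\<^sup>L D (hessian j k) = A_matrix M x \<psi> w \<beta>0 $ j $ k"
    by (subst integrable_D_iff integral_D; use A_matrix_hessian in auto)+
  from weak_law[OF borel_measurable_hessian this(1)] this(2)
  have "converges_in_probability M (\<lambda>n \<omega>. hessian_mean n \<omega> $ j $ k) (A_matrix M x \<psi> w \<beta>0 $ j $ k)"
    by (simp add: hessian_mean_def)
  from eventually_prob_converges[OF _ this \<open>0 < r\<close> e]
  show "eventually_prob M e (\<lambda>n \<omega>. \<bar>hessian_mean n \<omega> $ j $ k - A_matrix M x \<psi> w \<beta>0 $ j $ k\<bar> \<le> r)"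
    by (simp add: hessian_mean_def dist_real_def)
qed (use assms in auto)

lemma inner_hessian_mean:
  "z \<bullet> (hessian_mean n \<omega> *v z)
    = (\<Sum>i<n. curvature \<psi> \<psi>' (fst (obs i \<omega>)) (snd (obs i \<omega>) \<bullet> \<beta>0) * w (snd (obs i \<omega>)) / n
        * (z \<bullet> snd (obs i \<omega>))\<^sup>2)"
proof -
  let ?k = "\<lambda>i. curvature \<psi> \<psi>' (fst (obs i \<omega>)) (snd (obs i \<omega>) \<bullet> \<beta>0) * w (snd (obs i \<omega>)) / n"
  \<comment> \<open>For a fixed outcome the sum over observations is an integral for counting
    measure, so the identity for matrices of integrals applies.\<close>
  have "integrable (count_space {..<n}) (\<lambda>i. ?k i * (snd (obs i \<omega>) $ j * snd (obs i \<omega>) $ k))" for j k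
    by (simp add: integrable_count_space)
  from inner_integral_matrix(2)[OF this, of z z] show ?thesis
    by (simp add: lebesgue_integral_count_space_finite hessian_mean_def hessian_def
        sum_divide_distrib power2_eq_square)
qed

text \<open>Subtracting the value at \<open>\<beta>0\<close> and multiplying by n keep the
  minimizers for n > 0; n is the scale on which the change has a nondegenerate limit in the local
  variable \<open>z\<close>.\<close>

definition penalized_change :: "real \<Rightarrow> nat \<Rightarrow> 'w \<Rightarrow> real ^ 'p \<Rightarrow> real" where
  "penalized_change l n \<omega> z = n *
    (empirical_loss \<rho> \<psi> w (\<lambda>i. ys i \<omega>) (\<lambda>i. xs i \<omega>) n (\<beta>0 + z /\<^sub>R sqrt n) + sign_penalty l (\<beta>0 + z /\<^sub>R sqrt n)
    - (empirical_loss \<rho> \<psi> w (\<lambda>i. ys i \<omega>) (\<lambda>i. xs i \<omega>) n \<beta>0 + sign_penalty l \<beta>0))"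

lemma empirical_loss_obs:
  "n * empirical_loss \<rho> \<psi> w (\<lambda>i. ys i \<omega>) (\<lambda>i. xs i \<omega>) n \<beta>
    = (\<Sum>i<n. phi_loss \<rho> \<psi> (fst (obs i \<omega>)) (snd (obs i \<omega>) \<bullet> \<beta>) * w (snd (obs i \<omega>)))"
  by (cases "n = 0") (simp_all add: empirical_loss_def obs_def sum.atLeast1_atMost_eq)

text \<open>A deterministic statement about one outcome. With h = z / sqrt n one has |h|^2 = |z|^2 /
  n, so the sum of n remainders becomes |z|^2 times an average, to which Markov's inequality can be
  applied.\<close>

lemma empirical_loss_expansion:
  assumes n: "0 < n" and e: "0 \<le> e" "0 \<le> C"
    and rem: "\<And>y x h. y \<in> {0, 1} \<Longrightarrow> norm h \<le> d \<Longrightarrow>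
      \<bar>loss_remainder \<beta>0 y x h\<bar>
      \<le> (e + C * indicator {x. norm x > T} x) * (norm x)\<^sup>2 * (norm h)\<^sup>2"
    and bin: "\<And>i. fst (obs i \<omega>) \<in> {0, 1}" and z: "norm z \<le> d * sqrt n"
  shows "\<bar>n * (empirical_loss \<rho> \<psi> w (\<lambda>i. ys i \<omega>) (\<lambda>i. xs i \<omega>) n (\<beta>0 + z /\<^sub>R sqrt n)
        - empirical_loss \<rho> \<psi> w (\<lambda>i. ys i \<omega>) (\<lambda>i. xs i \<omega>) n \<beta>0)
      - (z \<bullet> score_sum n \<omega> + (1 / 2) * (z \<bullet> (hessian_mean n \<omega> *v z)))\<bar>
    \<le> (norm z)\<^sup>2 * ((\<Sum>i<n. (e + C * indicator {x. norm x > T} (snd (obs i \<omega>)))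
        * (w (snd (obs i \<omega>)) * (norm (snd (obs i \<omega>)))\<^sup>2)) / n)"
proof -
  define h where "h = z /\<^sub>R sqrt n"
  have h: "norm h \<le> d" using z n by (simp add: h_def field_simps)
  have hh: "(norm h)\<^sup>2 = (norm z)\<^sup>2 / n"
    by (simp add: h_def power_mult_distrib power_inverse divide_inverse mult.commute)
  have hX: "(v \<bullet> h)\<^sup>2 = (z \<bullet> v)\<^sup>2 / n" for v
    by (simp add: h_def inner_commute power_mult_distrib power_inverse divide_inverse mult.commute)
  let ?Y = "\<lambda>i. fst (obs i \<omega>)" and ?X = "\<lambda>i. snd (obs i \<omega>)"
  let ?I = "\<lambda>i. e + C * indicator {x. norm x > T} (?X i)"
  let ?r = "\<lambda>i. loss_remainder \<beta>0 (?Y i) (?X i) h"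
  have S: "z \<bullet> score_sum n \<omega> = (\<Sum>i<n. score \<psi> (?Y i) (?X i \<bullet> \<beta>0) * (?X i \<bullet> h) * w (?X i))"
    unfolding score_sum_def inner_scaleR_right inner_sum_right sum_distrib_left
    by (intro sum.cong refl) (simp add: score_vec_def h_def inner_commute)
  have Q: "z \<bullet> (hessian_mean n \<omega> *v z)
      = (\<Sum>i<n. curvature \<psi> \<psi>' (?Y i) (?X i \<bullet> \<beta>0) * (?X i \<bullet> h)\<^sup>2 * w (?X i))"
    unfolding inner_hessian_mean
    by (intro sum.cong refl) (simp add: hX)
  have scale: "(\<Sum>i<n. (norm h)\<^sup>2 * g i) = (norm z)\<^sup>2 * ((\<Sum>i<n. g i) / n)" for g :: "nat \<Rightarrow> real"
    unfolding hh by (simp add: sum_distrib_left sum_divide_distrib)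
  have aux: "p * v - q * v - r * v - 1 / 2 * (k * t * v) = (p - q - r - k / 2 * t) * v"
    for p q r k t v :: real by (simp add: algebra_simps)
  have eq: "n * (empirical_loss \<rho> \<psi> w (\<lambda>i. ys i \<omega>) (\<lambda>i. xs i \<omega>) n (\<beta>0 + h)
        - empirical_loss \<rho> \<psi> w (\<lambda>i. ys i \<omega>) (\<lambda>i. xs i \<omega>) n \<beta>0)
      - (z \<bullet> score_sum n \<omega> + (1 / 2) * (z \<bullet> (hessian_mean n \<omega> *v z)))
    = (\<Sum>i<n. ?r i * w (?X i))"
    unfolding right_diff_distrib empirical_loss_obs S Q diff_diff_eq[symmetric]
      sum_distrib_left sum_subtractf[symmetric] loss_remainder_def
    by (intro sum.cong refl aux)
  have "\<bar>\<Sum>i<n. ?r i * w (?X i)\<bar> \<le> (\<Sum>i<n. (norm h)\<^sup>2 * (?I i * (w (?X i) * (norm (?X i))\<^sup>2)))"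
  proof (intro order_trans[OF sum_abs] sum_mono)
    fix i
    have "\<bar>?r i * w (?X i)\<bar> = \<bar>?r i\<bar> * w (?X i)"
      by (simp only: abs_mult abs_of_nonneg[OF w_nonneg])
    also have "\<dots> \<le> (?I i * (norm (?X i))\<^sup>2 * (norm h)\<^sup>2) * w (?X i)"
      by (rule mult_right_mono[OF rem[OF bin h] w_nonneg])
    also have "\<dots> = (norm h)\<^sup>2 * (?I i * (w (?X i) * (norm (?X i))\<^sup>2))"
      by (simp only: mult_ac)
    finally show "\<bar>?r i * w (?X i)\<bar> \<le> (norm h)\<^sup>2 * (?I i * (w (?X i) * (norm (?X i))\<^sup>2))" .
  qed
  also have "\<dots> = (norm z)\<^sup>2 * ((\<Sum>i<n. ?I i * (w (?X i) * (norm (?X i))\<^sup>2)) / n)"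
    by (rule scale)
  finally show ?thesis unfolding eq[unfolded h_def] h_def .
qed

text \<open>The tolerance \<eta> is spent in quarters: Taylor remainder, Hessian average against A,
  expansion of the penalty, and sqrt n \<lambda> against \<open>b\<close>. The probability
  \<epsilon> is shared by the three random events for the remainder, the Hessian and the tuning
  parameter.\<close>

lemma penalized_change_approx:
  assumes \<beta>0: "\<beta>0 \<noteq> 0" and l_meas: "\<And>n. l n \<in> borel_measurable M" and l_pos: "\<And>n \<omega>. \<omega> \<in> space M \<Longrightarrow> 0 < l n \<omega>"
    and l_lim: "converges_in_probability M (\<lambda>n \<omega>. sqrt n * l n \<omega>) b"
    and K: "0 < K" and \<eta>: "0 < \<eta>" and \<epsilon>: "0 < \<epsilon>"
  shows "eventually_prob M \<epsilon> (\<lambda>n \<omega>. \<forall>z. norm z \<le> K \<longrightarrow>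
    \<bar>penalized_change (l n \<omega>) n \<omega> z - R_process (A_matrix M x \<psi> w \<beta>0) b \<beta>0 (score_sum n \<omega>) z\<bar> \<le> \<eta>)"
proof -
  let ?A = "A_matrix M x \<psi> w \<beta>0"
  let ?p = "real CARD('p)"
  obtain C where C: "0 \<le> C"
    and exp: "\<forall>T. \<forall>e>0. \<exists>d>0. \<forall>y\<in>{0, 1}. \<forall>x h. norm h \<le> d \<longrightarrow>
      \<bar>loss_remainder \<beta>0 y x h\<bar>
      \<le> (e + C * indicator {x. norm x > T} x) * (norm x)\<^sup>2 * (norm h)\<^sup>2"
    using loss_quadratic_expansion[of \<beta>0] by (elim exE conjE)
  define s where "s u = w (snd u) * (norm (snd u))\<^sup>2" for u :: "real \<times> (real ^ 'p)"
  have s_meas [measurable]: "s \<in> borel_measurable borel"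
    unfolding s_def [abs_def] borel_prod[symmetric] by measurable
  have snd_meas [measurable]: "(\<lambda>u :: real \<times> (real ^ 'p). norm (snd u)) \<in> borel_measurable borel"
    unfolding borel_prod[symmetric] by measurable
  have s_int: "integrable D s"
    by (subst integrable_D_iff) (use moment in \<open>auto simp: s_def\<close>)
  have s_nonneg: "0 \<le> s u" for u using w_nonneg by (simp add: s_def)
  define m where "m = integral\<^sup>L D s"
  have m: "0 \<le> m" using s_nonneg by (simp add: m_def integral_nonneg_AE)
  define \<eta>1 where "\<eta>1 = \<eta> / (4 * K\<^sup>2)"
  have \<eta>1: "0 < \<eta>1" "K\<^sup>2 * \<eta>1 = \<eta> / 4" using \<eta> K by (simp_all add: \<eta>1_def)
  \<comment> \<open>If the mean of the remainder function \<open>\<xi>\<close> is at most \<tau>,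
    Markov's inequality at level \<open>\<eta>1\<close> has bound \<tau> / \<eta>1 = \<epsilon> / 3.
    Half of \<tau> goes to \<open>e * m\<close>, the other half to \<open>C\<close> times the tail
    moment, through the choice of \<open>T\<close>; m + 1 and C + 1 avoid division by zero.\<close>
  define \<tau> where "\<tau> = \<epsilon> / 3 * \<eta>1"
  have \<tau>: "0 < \<tau>" using \<epsilon> \<eta>1 by (simp add: \<tau>_def)
  define e where "e = \<tau> / 2 / (m + 1)"
  have e: "0 < e" "e * m \<le> \<tau> / 2"
  proof -
    show e0: "0 < e" using \<tau> m by (simp add: e_def)
    have "e * m \<le> e * (m + 1)" using e0 by simp
    also have "\<dots> = \<tau> / 2"
      by (rule iffD1[OF nonzero_eq_divide_eq e_def]) (use m in linarith)
    finally show "e * m \<le> \<tau> / 2" .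
  qed
  have "0 < \<tau> / 2 / (C + 1)" using \<tau> C by simp
  from truncated_tail_small[OF s_meas snd_meas s_int this] obtain T
    where "(\<integral>u. \<bar>s u\<bar> * indicator {u. norm (snd u) > T} u \<partial>D) < \<tau> / 2 / (C + 1)" by blast
  then have T: "(\<integral>u. s u * indicator {u. norm (snd u) > T} u \<partial>D) < \<tau> / 2 / (C + 1)"
    using s_nonneg by simp
  define \<xi> where "\<xi> u = (e + C * indicator {x. norm x > T} (snd u)) * s u" for u :: "real \<times> (real ^ 'p)"
  have \<xi>_eq: "\<xi> u = e * s u + C * (s u * indicator {u. norm (snd u) > T} u)" for u
    by (simp add: \<xi>_def indicator_def algebra_simps)
  have \<xi>_meas: "\<xi> \<in> borel_measurable borel" unfolding \<xi>_eq [abs_def] by measurable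
  have s_ind_int: "integrable D (\<lambda>u. s u * indicator {u. norm (snd u) > T} u)"
    by (rule integrable_real_mult_indicator[OF _ s_int]) measurable
  have \<xi>_int: "integrable D \<xi>"
    unfolding \<xi>_eq [abs_def] using s_int s_ind_int by simp
  have \<xi>_nonneg: "0 \<le> \<xi> u" for u using e C s_nonneg by (simp add: \<xi>_def)
  have "integral\<^sup>L D \<xi> = e * m + C * (\<integral>u. s u * indicator {u. norm (snd u) > T} u \<partial>D)"
    unfolding \<xi>_eq [abs_def] using s_int s_ind_int by (simp add: m_def)
  also have "\<dots> \<le> \<tau> / 2 + (C + 1) * (\<tau> / 2 / (C + 1))"
    using e T C \<tau> by (intro add_mono mult_mono) (auto intro!: integral_nonneg_AE simp: s_nonneg)
  also have "\<dots> = \<tau>"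
  proof -
    have "k * (t / k) = t" if "0 < k" for k t :: real using that by simp
    from this[of "C + 1" "\<tau> / 2"] show ?thesis using C by linarith
  qed
  finally have \<xi>_mean: "integral\<^sup>L D \<xi> / \<eta>1 \<le> \<epsilon> / 3"
    using \<eta>1 by (simp add: \<tau>_def pos_divide_le_eq)
  have ep1: "eventually_prob M (\<epsilon> / 3) (\<lambda>n \<omega>. (\<Sum>i<n. \<xi> (obs i \<omega>)) / n \<le> \<eta>1)"
    unfolding eventually_prob_def
  proof (intro always_eventually allI)
    fix n
    note [measurable] = \<xi>_meas
    let ?E = "{\<omega> \<in> space M. (\<Sum>i<n. \<xi> (obs i \<omega>)) / n > \<eta>1}"
    have "prob ?E \<le> \<epsilon> / 3"
      by (rule order_trans[OF prob_mean_gt_le[OF \<xi>_meas \<xi>_nonneg \<xi>_int \<eta>1(1)] \<xi>_mean])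
    moreover have "?E \<in> events" by measurable
    ultimately show "\<exists>E\<in>events. prob E \<le> \<epsilon> / 3 \<and> (\<forall>\<omega>\<in>space M - E. (\<Sum>i<n. \<xi> (obs i \<omega>)) / n \<le> \<eta>1)"
      by (intro bexI[of _ ?E]) auto
  qed
  obtain d where d: "0 < d" and rem: "\<And>y x h. y \<in> {0, 1} \<Longrightarrow> norm h \<le> d \<Longrightarrow>
      \<bar>loss_remainder \<beta>0 y x h\<bar>
      \<le> (e + C * indicator {x. norm x > T} x) * (norm x)\<^sup>2 * (norm h)\<^sup>2"
    using exp[rule_format, OF e(1), of T] by blast
  \<comment> \<open>The quadratic form is a sum of p^2 entries of size at most K \<eta>2 K, hence at
    most \<eta> / 2; the factor 1/2 in front of the form gives \<eta> / 4.\<close>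
  define \<eta>2 where "\<eta>2 = \<eta> / (2 * K\<^sup>2 * ?p\<^sup>2)"
  have \<eta>2: "0 < \<eta>2" using \<eta> K by (simp add: \<eta>2_def)
  have ep2: "eventually_prob M (\<epsilon> / 3) (\<lambda>n \<omega>. \<forall>j k. \<bar>hessian_mean n \<omega> $ j $ k - ?A $ j $ k\<bar> \<le> \<eta>2)"
    using \<epsilon> by (intro hessian_mean_tendsto \<eta>2) simp
  have hess: "\<bar>(1 / 2) * (z \<bullet> (H *v z)) - (1 / 2) * (z \<bullet> (?A *v z))\<bar> \<le> \<eta> / 4"
    if z: "norm z \<le> K" and H: "\<forall>j k. \<bar>H $ j $ k - ?A $ j $ k\<bar> \<le> \<eta>2" for z H
  proof -
    have eq: "z \<bullet> (H *v z) - z \<bullet> (?A *v z) = z \<bullet> ((H - ?A) *v z)"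
      by (simp add: matrix_vector_mult_diff_rdistrib inner_diff_right)
    have "\<bar>z \<bullet> ((H - ?A) *v z)\<bar> = \<bar>\<Sum>j\<in>UNIV. \<Sum>k\<in>UNIV. z $ j * ((H $ j $ k - ?A $ j $ k) * z $ k)\<bar>"
      by (simp add: inner_vec_def matrix_vector_mult_def sum_distrib_left)
    also have "\<dots> \<le> (\<Sum>j::'p\<in>UNIV. \<Sum>k::'p\<in>UNIV. K * (\<eta>2 * K))"
    proof (intro order_trans[OF sum_abs] sum_mono)
      fix j k
      show "\<bar>z $ j * ((H $ j $ k - ?A $ j $ k) * z $ k)\<bar> \<le> K * (\<eta>2 * K)"
        unfolding abs_mult using H z \<eta>2 K
        by (intro mult_mono order_trans[OF component_le_norm_cart z]) auto
    qed
    also have "\<dots> = \<eta> / 2" using K by (simp add: \<eta>2_def power2_eq_square)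
    finally have "\<bar>z \<bullet> (H *v z) - z \<bullet> (?A *v z)\<bar> \<le> \<eta> / 2" unfolding eq .
    then show ?thesis by linarith
  qed
  obtain G where G: "\<And>z. norm z \<le> K \<Longrightarrow> \<bar>z \<bullet> q_vec \<beta>0 z\<bar> \<le> G" "0 \<le> G"
  proof -
    have "compact ((\<lambda>z. z \<bullet> q_vec \<beta>0 z) ` cball 0 K)"
      by (intro compact_continuous_image continuous_inner_q_vec compact_cball)
    then obtain G where G: "\<forall>v\<in>(\<lambda>z. z \<bullet> q_vec \<beta>0 z) ` cball 0 K. norm v \<le> G"
      by (metis bounded_iff compact_imp_bounded)
    have "\<bar>z \<bullet> q_vec \<beta>0 z\<bar> \<le> max G 0" if "norm z \<le> K" for z
    proof -
      have "norm (z \<bullet> q_vec \<beta>0 z) \<le> G" using that by (intro G[rule_format] imageI) simp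
      then show ?thesis by simp
    qed
    then show ?thesis by (rule that) auto
  qed
  define e' where "e' = \<eta> / (4 * (\<bar>b\<bar> + 1) * K)"
  have e': "0 < e'" "(\<bar>b\<bar> + 1) * (e' * K) = \<eta> / 4"
  proof -
    show "0 < e'" using \<eta> K by (simp add: e'_def)
    have "k * (\<eta> / (4 * k * K) * K) = \<eta> / 4" if "0 < k" for k using that K by simp
    from this[of "\<bar>b\<bar> + 1"] show "(\<bar>b\<bar> + 1) * (e' * K) = \<eta> / 4" unfolding e'_def by simp
  qed
  obtain d' where d': "0 < d'" "\<And>h. norm h < d' \<Longrightarrow>
      \<bar>sign_penalty 1 (\<beta>0 + h) - sign_penalty 1 \<beta>0 - h \<bullet> q_vec \<beta>0 h\<bar> \<le> e' * norm h"
    using sign_penalty_expansion[OF \<beta>0 e'(1)] unfolding eventually_nhds_metric by (auto simp: dist_norm)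
  \<comment> \<open>The bound 1 keeps sqrt n \<lambda> below |b| + 1, the constant used in
    \<open>e'\<close>; the other bound makes the error (sqrt n \<lambda> - b) z.q(z) at most \<eta>
    / 4.\<close>
  define \<eta>3 where "\<eta>3 = min 1 (\<eta> / 4 / (G + 1))"
  have \<eta>3: "0 < \<eta>3" "\<eta>3 \<le> 1" "\<eta>3 * G \<le> \<eta> / 4"
  proof -
    show p: "0 < \<eta>3" using \<eta> G(2) by (simp add: \<eta>3_def)
    show "\<eta>3 \<le> 1" by (simp add: \<eta>3_def)
    have "\<eta>3 * G \<le> (\<eta> / 4 / (G + 1)) * (G + 1)"
      using G(2) p \<eta> by (intro mult_mono) (auto simp: \<eta>3_def)
    also have "\<dots> = \<eta> / 4"
      by (rule iffD1[OF nonzero_eq_divide_eq refl]) (use G(2) in linarith)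
    finally show "\<eta>3 * G \<le> \<eta> / 4" .
  qed
  have ep3: "eventually_prob M (\<epsilon> / 3) (\<lambda>n \<omega>. dist (sqrt n * l n \<omega>) b \<le> \<eta>3)"
    using \<epsilon> l_meas by (intro eventually_prob_converges[OF _ l_lim \<eta>3(1)]) auto
  have pen: "\<bar>n * (sign_penalty t (\<beta>0 + z /\<^sub>R sqrt n) - sign_penalty t \<beta>0) - b * (z \<bullet> q_vec \<beta>0 z)\<bar> \<le> \<eta> / 2"
    if n: "0 < n" "K / sqrt n < d'" and z: "norm z \<le> K" and t: "0 < t" "dist (sqrt n * t) b \<le> \<eta>3"
    for n :: nat and z t
  proof -
    define h where "h = z /\<^sub>R sqrt n"
    define g where "g = z \<bullet> q_vec \<beta>0 z"
    have h: "norm h = norm z / sqrt n" by (simp add: h_def divide_inverse mult.commute)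
    then have "norm h \<le> K / sqrt n" using z by (simp add: divide_right_mono)
    then have "norm h < d'" using n(2) by linarith
    from d'(2)[OF this] have r: "\<bar>sign_penalty 1 (\<beta>0 + h) - sign_penalty 1 \<beta>0 - h \<bullet> q_vec \<beta>0 h\<bar> \<le> e' * norm h" .
    have nn: "real n = sqrt n * sqrt n" by simp
    have hq: "h \<bullet> q_vec \<beta>0 h = g / sqrt n"
      unfolding h_def g_def by (subst inner_q_vec_scale) (auto simp: divide_inverse mult.commute)
    have 1: "n * t * (h \<bullet> q_vec \<beta>0 h) = (sqrt n * t) * g"
      using n(1) unfolding hq by (subst nn) (simp del: real_sqrt_mult_self)
    have 2: "n * t * (e' * norm h) = (sqrt n * t) * (e' * norm z)"
      using n(1) unfolding h by (subst nn) (simp del: real_sqrt_mult_self)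
    have "\<bar>n * t * (sign_penalty 1 (\<beta>0 + h) - sign_penalty 1 \<beta>0 - h \<bullet> q_vec \<beta>0 h)\<bar> \<le> n * t * (e' * norm h)"
      using r t(1) by (simp add: abs_mult mult_left_mono)
    also have "\<dots> \<le> (\<bar>b\<bar> + 1) * (e' * K)"
      unfolding 2 using t \<eta>3(2) e'(1) z by (intro mult_mono) (auto simp: dist_real_def)
    finally have 3: "\<bar>n * t * (sign_penalty 1 (\<beta>0 + h) - sign_penalty 1 \<beta>0) - (sqrt n * t) * g\<bar> \<le> \<eta> / 4"
      unfolding e'(2) right_diff_distrib 1 .
    have "\<bar>(sqrt n * t - b) * g\<bar> \<le> \<eta>3 * G"
      unfolding abs_mult g_def using t(2) G(1)[OF z] \<eta>3(1) by (intro mult_mono) (auto simp: dist_real_def)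
    then have 4: "\<bar>(sqrt n * t) * g - b * g\<bar> \<le> \<eta> / 4"
      using \<eta>3(3) by (simp add: left_diff_distrib)
    have 5: "n * (sign_penalty t (\<beta>0 + h) - sign_penalty t \<beta>0) = n * t * (sign_penalty 1 (\<beta>0 + h) - sign_penalty 1 \<beta>0)"
      by (subst (1 2) sign_penalty_scale) (simp add: right_diff_distrib)
    show ?thesis
      unfolding h_def[symmetric] g_def[symmetric] 5 using 3 4 by linarith
  qed

  have "eventually_prob M (\<epsilon> / 3 + (\<epsilon> / 3 + (\<epsilon> / 3 + 0))) (\<lambda>n \<omega>.
      (\<Sum>i<n. \<xi> (obs i \<omega>)) / n \<le> \<eta>1 \<and> (\<forall>j k. \<bar>hessian_mean n \<omega> $ j $ k - ?A $ j $ k\<bar> \<le> \<eta>2)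
      \<and> dist (sqrt n * l n \<omega>) b \<le> \<eta>3 \<and> (\<forall>i. fst (obs i \<omega>) \<in> {0, 1}))"
    by (intro eventually_prob_conj ep1 ep2 ep3 eventually_prob_AE AE_binary)
  \<comment> \<open>For such n all increments z / sqrt n with |z| <= K lie in the neighbourhoods
    where the expansions of the loss and of the penalty hold.\<close>
  moreover have "\<forall>\<^sub>F n in sequentially. K / sqrt n < min d d'"
  proof -
    have "(\<lambda>n. K / sqrt (real n)) \<longlonglongrightarrow> 0"
      by (intro tendsto_divide_0[OF tendsto_const] filterlim_at_top_imp_at_infinity
          filterlim_compose[OF sqrt_at_top filterlim_real_sequentially])
    moreover have "0 < min d d'" using d d'(1) by simp
    ultimately show ?thesis by (rule order_tendstoD(2))
  qed
  with eventually_gt_at_top[of 0]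
  have "\<forall>\<^sub>F n in sequentially. \<forall>\<omega>\<in>space M.
      (\<Sum>i<n. \<xi> (obs i \<omega>)) / n \<le> \<eta>1 \<and> (\<forall>j k. \<bar>hessian_mean n \<omega> $ j $ k - ?A $ j $ k\<bar> \<le> \<eta>2)
      \<and> dist (sqrt n * l n \<omega>) b \<le> \<eta>3 \<and> (\<forall>i. fst (obs i \<omega>) \<in> {0, 1}) \<longrightarrow>
    (\<forall>z. norm z \<le> K \<longrightarrow>
      \<bar>penalized_change (l n \<omega>) n \<omega> z - R_process ?A b \<beta>0 (score_sum n \<omega>) z\<bar> \<le> \<eta>)"
  proof eventually_elim
    case (elim n)
    show ?case
    proof (intro ballI impI allI; elim conjE)
      fix \<omega> and z :: "real ^ 'p"
      assume \<omega>: "\<omega> \<in> space M" and z: "norm z \<le> K"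
        and good: "(\<Sum>i<n. \<xi> (obs i \<omega>)) / n \<le> \<eta>1" "\<forall>j k. \<bar>hessian_mean n \<omega> $ j $ k - ?A $ j $ k\<bar> \<le> \<eta>2"
          "dist (sqrt n * l n \<omega>) b \<le> \<eta>3" "\<forall>i. fst (obs i \<omega>) \<in> {0, 1}"
      let ?L = "empirical_loss \<rho> \<psi> w (\<lambda>i. ys i \<omega>) (\<lambda>i. xs i \<omega>) n"
      let ?h = "z /\<^sub>R sqrt (real n)"
      have "K < d * sqrt n" using elim by (simp add: pos_divide_less_eq)
      then have zd: "norm z \<le> d * sqrt n" using z by linarith
      have "\<bar>n * (?L (\<beta>0 + ?h) - ?L \<beta>0)
          - (z \<bullet> score_sum n \<omega> + (1 / 2) * (z \<bullet> (hessian_mean n \<omega> *v z)))\<bar>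
        \<le> (norm z)\<^sup>2 * ((\<Sum>i<n. \<xi> (obs i \<omega>)) / n)"
        unfolding \<xi>_def s_def
        by (rule empirical_loss_expansion[OF elim(1) less_imp_le[OF e(1)] C, where d = d])
          (assumption | rule rem good(4)[rule_format] zd)+
      also have "\<dots> \<le> K\<^sup>2 * \<eta>1"
        by (rule mult_mono[OF power_mono[OF z norm_ge_zero] good(1)])
          (auto intro!: divide_nonneg_nonneg sum_nonneg \<xi>_nonneg)
      finally have 1: "\<bar>n * (?L (\<beta>0 + ?h) - ?L \<beta>0)
          - (z \<bullet> score_sum n \<omega> + (1 / 2) * (z \<bullet> (hessian_mean n \<omega> *v z)))\<bar> \<le> \<eta> / 4"
        unfolding \<eta>1(2) .
      have 3: "\<bar>n * (sign_penalty (l n \<omega>) (\<beta>0 + ?h) - sign_penalty (l n \<omega>) \<beta>0) - b * (z \<bullet> q_vec \<beta>0 z)\<bar> \<le> \<eta> / 2"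
        using elim l_pos[OF \<omega>] good(3) z by (intro pen) auto
      have "penalized_change (l n \<omega>) n \<omega> z = n * (?L (\<beta>0 + ?h) - ?L \<beta>0)
          + n * (sign_penalty (l n \<omega>) (\<beta>0 + ?h) - sign_penalty (l n \<omega>) \<beta>0)"
        by (simp add: penalized_change_def algebra_simps)
      then show "\<bar>penalized_change (l n \<omega>) n \<omega> z - R_process ?A b \<beta>0 (score_sum n \<omega>) z\<bar> \<le> \<eta>"
        using 1 hess[OF z good(2)] 3 unfolding R_process_def by linarith
    qed
  qed
  ultimately have "eventually_prob M (\<epsilon> / 3 + (\<epsilon> / 3 + (\<epsilon> / 3 + 0))) (\<lambda>n \<omega>. \<forall>z. norm z \<le> K \<longrightarrow>
    \<bar>penalized_change (l n \<omega>) n \<omega> z - R_process ?A b \<beta>0 (score_sum n \<omega>) z\<bar> \<le> \<eta>)"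
    by (rule eventually_prob_mono)
  then show ?thesis by simp
qed

text \<open>Let Z be the rescaled estimator and S the score sum. On the good event both Z and
  \<Phi>(S) lie in the ball of radius \<open>K\<close>, so minimality of the estimator gives R(Z) <=
  R(\<Phi>(S)) + 2\<eta>, and quadratic growth around \<Phi>(S) bounds the distance.\<close>

lemma penalized_estimator_asymptotics:
  assumes \<beta>0: "\<beta>0 \<noteq> 0" and l_meas: "\<And>n. l n \<in> borel_measurable M"
    and l_pos: "\<And>n \<omega>. \<omega> \<in> space M \<Longrightarrow> 0 < l n \<omega>"
    and l_lim: "converges_in_probability M (\<lambda>n \<omega>. sqrt n * l n \<omega>) b" and b: "0 \<le> b"
    and est: "penalized_estimator M \<rho> \<psi> w ys xs l \<beta>hat"
    and root_n: "bounded_in_probability M (\<lambda>n \<omega>. sqrt n *\<^sub>R (\<beta>hat n \<omega> - \<beta>0))"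
    and c: "0 < c" and coer: "\<And>z. c * (norm z)\<^sup>2 \<le> z \<bullet> (A_matrix M x \<psi> w \<beta>0 *v z)"
    and \<epsilon>: "0 < \<epsilon>" and r: "0 < r"
  defines "\<Phi> \<equiv> \<lambda>u. ARG_MIN (R_process (A_matrix M x \<psi> w \<beta>0) b \<beta>0 u) z. True"
  shows "eventually_prob M \<epsilon> (\<lambda>n \<omega>. dist (sqrt n *\<^sub>R (\<beta>hat n \<omega> - \<beta>0)) (\<Phi> (score_sum n \<omega>)) \<le> r)"
proof -
  let ?R = "R_process (A_matrix M x \<psi> w \<beta>0) b \<beta>0"
  let ?Z = "\<lambda>n \<omega>. sqrt (real n) *\<^sub>R (\<beta>hat n \<omega> - \<beta>0)"
  have [measurable]: "\<beta>hat n \<in> borel_measurable M" for n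
    using est by (simp add: penalized_estimator_def)
  have growth: "?R u (\<Phi> u) + c / 2 * (norm (z - \<Phi> u))\<^sup>2 \<le> ?R u z" for u z
    unfolding \<Phi>_def by (rule R_process_growth[OF c coer b])
  have lipschitz: "norm (\<Phi> u - \<Phi> v) \<le> norm (u - v) / c" for u v
    unfolding \<Phi>_def by (rule R_process_lipschitz[OF c coer b])
  have \<epsilon>4: "0 < \<epsilon> / 4" using \<epsilon> by simp
  obtain K1 where K1: "eventually_prob M (\<epsilon> / 4) (\<lambda>n \<omega>. norm (?Z n \<omega>) \<le> K1)"
    using eventually_prob_bounded[OF _ root_n \<epsilon>4] by auto
  obtain K2 where K2: "eventually_prob M (\<epsilon> / 4) (\<lambda>n \<omega>. norm (score_sum n \<omega>) \<le> K2)"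
    using eventually_prob_bounded[OF score_sum_measurable score_sum_bounded \<epsilon>4] by auto
  \<comment> \<open>The last entry bounds |\<Phi>(S)| through the Lipschitz constant 1 / c whenever
    |S| <= K2.\<close>
  define K where "K = max 1 (max K1 (norm (\<Phi> 0) + K2 / c))"
  have K: "0 < K" "K1 \<le> K" "norm (\<Phi> 0) + K2 / c \<le> K" by (auto simp: K_def)
  \<comment> \<open>From c/2 d^2 <= 2\<eta> = c r^2 / 4 it follows that d^2 <= r^2 / 2.\<close>
  define \<eta> where "\<eta> = c * r\<^sup>2 / 8"
  have \<eta>: "0 < \<eta>" using c r by (simp add: \<eta>_def)
  note approx = penalized_change_approx[OF \<beta>0 l_meas l_pos l_lim K(1) \<eta> \<epsilon>4]
  let ?good = "\<lambda>n \<omega>. is_penalized_estimate \<rho> \<psi> w (\<lambda>i. ys i \<omega>) (\<lambda>i. xs i \<omega>) n (l n \<omega>) (\<beta>hat n \<omega>)"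
  have lim: "(\<lambda>n. prob {\<omega> \<in> space M. ?good n \<omega>}) \<longlonglongrightarrow> 1"
    using est by (simp add: penalized_estimator_def)
  have "eventually_prob M (\<epsilon> / 4) ?good"
  proof -
    \<comment> \<open>The maximum with 0 secures positive probability even for large \<epsilon>, and
      positivity is what yields measurability of the event.\<close>
    have "\<forall>\<^sub>F n in sequentially. max 0 (1 - \<epsilon> / 4) < prob {\<omega> \<in> space M. ?good n \<omega>}"
      using \<epsilon> by (intro order_tendstoD(1)[OF lim]) auto
    then show ?thesis
      unfolding eventually_prob_def
    proof eventually_elim
      case (elim n)
      \<comment> \<open>a non-measurable set would have measure \<open>0\<close>\<close>
      then have ev: "{\<omega> \<in> space M. ?good n \<omega>} \<in> events"
        using measure_notin_sets[of "{\<omega> \<in> space M. ?good n \<omega>}" M] by auto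
      from prob_compl[OF ev] elim show ?case
        by (intro bexI[of _ "space M - {\<omega> \<in> space M. ?good n \<omega>}"] conjI) (use ev in auto)
    qed
  qed
  from eventually_prob_conj[OF eventually_prob_conj[OF this K1] eventually_prob_conj[OF K2 approx]]
  have "eventually_prob M \<epsilon> (\<lambda>n \<omega>. (?good n \<omega> \<and> norm (?Z n \<omega>) \<le> K1) \<and> norm (score_sum n \<omega>) \<le> K2 \<and>
    (\<forall>z. norm z \<le> K \<longrightarrow> \<bar>penalized_change (l n \<omega>) n \<omega> z - ?R (score_sum n \<omega>) z\<bar> \<le> \<eta>))"
    by simp
  moreover have "\<forall>\<^sub>F n in sequentially. \<forall>\<omega>\<in>space M. (?good n \<omega> \<and> norm (?Z n \<omega>) \<le> K1) \<and> norm (score_sum n \<omega>) \<le> K2 \<and>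
      (\<forall>z. norm z \<le> K \<longrightarrow> \<bar>penalized_change (l n \<omega>) n \<omega> z - ?R (score_sum n \<omega>) z\<bar> \<le> \<eta>) \<longrightarrow>
    dist (?Z n \<omega>) (\<Phi> (score_sum n \<omega>)) \<le> r"
    using eventually_gt_at_top[of 0]
  proof eventually_elim
    case (elim n)
    show ?case
    proof (intro ballI impI; elim conjE)
      fix \<omega>
      assume good: "?good n \<omega>" and Z: "norm (?Z n \<omega>) \<le> K1" and S: "norm (score_sum n \<omega>) \<le> K2"
        and app: "\<forall>z. norm z \<le> K \<longrightarrow> \<bar>penalized_change (l n \<omega>) n \<omega> z - ?R (score_sum n \<omega>) z\<bar> \<le> \<eta>"
      let ?S = "score_sum n \<omega>"
      let ?\<Phi> = "\<Phi> ?S"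
      have "norm ?\<Phi> \<le> norm (\<Phi> 0) + norm (?\<Phi> - \<Phi> 0)"
        using norm_triangle_sub[of ?\<Phi> "\<Phi> 0"] by simp
      also have "\<dots> \<le> norm (\<Phi> 0) + K2 / c"
      proof -
        have "norm (?S - 0) / c \<le> K2 / c" using S c by (intro divide_right_mono) simp_all
        with lipschitz[of ?S 0] show ?thesis by linarith
      qed
      finally have \<Phi>K: "norm ?\<Phi> \<le> K" using K(3) by linarith
      have ZK: "norm (?Z n \<omega>) \<le> K" using Z K(2) by linarith
      have Z_eq: "\<beta>0 + ?Z n \<omega> /\<^sub>R sqrt n = \<beta>hat n \<omega>" using elim by simp
      have opt: "empirical_loss \<rho> \<psi> w (\<lambda>i. ys i \<omega>) (\<lambda>i. xs i \<omega>) n (\<beta>hat n \<omega>) + sign_penalty (l n \<omega>) (\<beta>hat n \<omega>)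
          \<le> empirical_loss \<rho> \<psi> w (\<lambda>i. ys i \<omega>) (\<lambda>i. xs i \<omega>) n \<beta> + sign_penalty (l n \<omega>) \<beta>" for \<beta>
        using good unfolding is_penalized_estimate_def is_arg_min_linorder by blast
      have "penalized_change (l n \<omega>) n \<omega> (?Z n \<omega>) \<le> penalized_change (l n \<omega>) n \<omega> ?\<Phi>"
        unfolding penalized_change_def Z_eq by (rule mult_left_mono[OF diff_right_mono[OF opt]]) simp
      then have "?R ?S (?Z n \<omega>) \<le> ?R ?S ?\<Phi> + 2 * \<eta>"
        using app[rule_format, OF ZK] app[rule_format, OF \<Phi>K] by linarith
      with growth[of ?S "?Z n \<omega>"] have "c / 2 * (norm (?Z n \<omega> - ?\<Phi>))\<^sup>2 \<le> 2 * \<eta>" by linarith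
      then have "c * (norm (?Z n \<omega> - ?\<Phi>))\<^sup>2 \<le> c * (r\<^sup>2 / 2)" unfolding \<eta>_def by linarith
      then have "(norm (?Z n \<omega> - ?\<Phi>))\<^sup>2 \<le> r\<^sup>2 / 2" by (rule mult_left_le_imp_le[OF _ c])
      also have "r\<^sup>2 / 2 \<le> r\<^sup>2" by simp
      finally show "dist (?Z n \<omega>) ?\<Phi> \<le> r"
        unfolding dist_norm using less_imp_le[OF r] by (rule power2_le_imp_le)
    qed
  qed
  ultimately show ?thesis by (rule eventually_prob_mono)
qed

end

section \<open>Continuous mapping and conclusion\<close>

lemma converges_in_distribution_continuous_map:
  assumes X: "converges_in_distribution M X N Z" and g: "continuous_on UNIV g"
  shows "converges_in_distribution M (\<lambda>n \<omega>. g (X n \<omega>)) N (\<lambda>\<omega>. g (Z \<omega>))"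
  unfolding converges_in_distribution_def
proof (intro conjI allI impI)
  have g_meas: "g \<in> borel_measurable borel" by (rule borel_measurable_continuous_onI[OF g])
  show "(\<lambda>\<omega>. g (X n \<omega>)) \<in> borel_measurable M" for n
    using X by (intro measurable_compose[OF _ g_meas]) (simp add: converges_in_distribution_def)
  show "(\<lambda>\<omega>. g (Z \<omega>)) \<in> borel_measurable N"
    using X by (intro measurable_compose[OF _ g_meas]) (simp add: converges_in_distribution_def)
  fix f :: "'d \<Rightarrow> real" assume f: "continuous_on UNIV f" and "bounded (range f)"
  have "continuous_on UNIV (\<lambda>v. f (g v))"
    by (rule continuous_on_compose2[OF f g]) auto
  moreover have "bounded (range (\<lambda>v. f (g v)))"
    using \<open>bounded (range f)\<close> by (rule bounded_subset) auto
  ultimately show "(\<lambda>n. \<integral>\<omega>. f (g (X n \<omega>)) \<partial>M) \<longlonglongrightarrow> (\<integral>\<omega>. f (g (Z \<omega>)) \<partial>N)"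
    using X unfolding converges_in_distribution_def by blast
qed

lemma (in prob_space) converges_in_probability_nonneg:
  assumes [measurable]: "\<And>n. Z n \<in> borel_measurable M" and "converges_in_probability M Z b"
    and pos: "\<And>n \<omega>. \<omega> \<in> space M \<Longrightarrow> 0 \<le> Z n \<omega>"
  shows "0 \<le> (b :: real)"
proof (rule ccontr)
  assume "\<not> 0 \<le> b"
  \<comment> \<open>Within distance -b/2 of a negative \<open>b\<close> all values are negative, and
    an exceptional set of probability at most 1/2 leaves some outcome at which this happens.\<close>
  then have "eventually_prob M (1 / 2) (\<lambda>n \<omega>. dist (Z n \<omega>) b \<le> - b / 2)"
    using assms by (intro eventually_prob_converges) auto
  then obtain n E where E: "E \<in> events" "prob E \<le> 1 / 2" "\<forall>\<omega>\<in>space M - E. dist (Z n \<omega>) b \<le> - b / 2"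
    unfolding eventually_prob_def by (auto dest: eventually_happens)
  have "E \<noteq> space M" using E(2) prob_space by auto
  then obtain \<omega> where "\<omega> \<in> space M - E" using sets.sets_into_space[OF E(1)] by blast
  then have "\<bar>Z n \<omega> - b\<bar> \<le> - b / 2" "0 \<le> Z n \<omega>"
    using bspec[OF E(3)] pos[of \<omega> n] by (simp_all add: dist_real_def)
  then show False using \<open>\<not> 0 \<le> b\<close> by linarith
qed

theorem theorem5p3:
  fixes M :: "'w measure" and N :: "'v measure"
    and y :: "'w \<Rightarrow> real" and x :: "'w \<Rightarrow> real ^ 'p"
    and ys :: "nat \<Rightarrow> 'w \<Rightarrow> real" and xs :: "nat \<Rightarrow> 'w \<Rightarrow> real ^ 'p"
    and \<beta>0 :: "real ^ 'p"
    and \<rho> \<psi> \<psi>' :: "real \<Rightarrow> real"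
    and w :: "real ^ 'p \<Rightarrow> real"
    and lam :: "nat \<Rightarrow> 'w \<Rightarrow> real" and b :: real
    and \<beta>hat :: "nat \<Rightarrow> 'w \<Rightarrow> real ^ 'p"
    and W :: "'v \<Rightarrow> real ^ 'p"
  assumes prob: "prob_space M" "prob_space N"
    and rv: "y \<in> borel_measurable M" "x \<in> borel_measurable M"
    and binary: "\<And>\<omega>. \<omega> \<in> space M \<Longrightarrow> y \<omega> \<in> {0, 1}"
    and model: "AE \<omega> in M.
      real_cond_exp M (vimage_algebra (space M) x borel)
        (indicator {\<omega>' \<in> space M. y \<omega>' = 1}) \<omega> = logistic (x \<omega> \<bullet> \<beta>0)"
    and sample_indep:
      "prob_space.indep_vars M (\<lambda>_. borel) (\<lambda>i \<omega>. (ys i \<omega>, xs i \<omega>)) {1..}"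
    and sample_copies: "\<And>i. i \<ge> 1 \<Longrightarrow>
      distr M borel (\<lambda>\<omega>. (ys i \<omega>, xs i \<omega>)) = distr M borel (\<lambda>\<omega>. (y \<omega>, x \<omega>))"
    and rho: "bounded (\<rho> ` {0..})" "mono_on {0..} \<rho>"
      "\<And>t. t \<ge> 0 \<Longrightarrow> (\<rho> has_real_derivative \<psi> t) (at t within {0..})"
    and R3: "\<And>t. t \<ge> 0 \<Longrightarrow> (\<psi> has_real_derivative \<psi>' t) (at t within {0..})"
      "continuous_on {0..} \<psi>'" "bounded (\<psi> ` {0..})" "bounded (\<psi>' ` {0..})"
    and H2: "w \<in> borel_measurable borel" "\<And>v. w v \<ge> 0" "bounded (range w)"
      "(SUP v. \<bar>w v\<bar>) = 1"
      "measure M {\<omega> \<in> space M. x \<omega> \<in> {v. w v > 0}} > 0"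
    and H3: "integrable M (\<lambda>\<omega>. w (x \<omega>) * (norm (x \<omega>))\<^sup>2)"
    and H4: "invertible (A_matrix M x \<psi> w \<beta>0)"
    and lam: "\<And>n. lam n \<in> borel_measurable M"
      "\<And>n \<omega>. \<omega> \<in> space M \<Longrightarrow> lam n \<omega> > 0"
    and estimator: "penalized_estimator M \<rho> \<psi> w ys xs lam \<beta>hat"
    and root_n: "bounded_in_probability M (\<lambda>n \<omega>. sqrt (real n) *\<^sub>R (\<beta>hat n \<omega> - \<beta>0))"
    and lam_lim: "converges_in_probability M (\<lambda>n \<omega>. sqrt (real n) * lam n \<omega>) b"
    and beta0: "norm \<beta>0 \<noteq> 0"
    and W: "multivariate_normal N W 0 (B_matrix M x \<psi> w \<beta>0)"
  shows "(\<forall>\<omega> \<in> space N. \<exists>!z.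
            is_arg_min (R_process (A_matrix M x \<psi> w \<beta>0) b \<beta>0 (W \<omega>)) (\<lambda>_. True) z)
       \<and> converges_in_distribution M (\<lambda>n \<omega>. sqrt (real n) *\<^sub>R (\<beta>hat n \<omega> - \<beta>0))
            N (\<lambda>\<omega>. ARG_MIN (R_process (A_matrix M x \<psi> w \<beta>0) b \<beta>0 (W \<omega>)) z. True)"
proof -
  let ?A = "A_matrix M x \<psi> w \<beta>0"
  \<comment> \<open>The only randomness of the limit process sits in its linear term, so the
    limiting minimizer is a fixed function of the Gaussian vector, to which the continuous mapping
    theorem applies.\<close>
  define \<Phi> where "\<Phi> = (\<lambda>u. ARG_MIN (R_process ?A b \<beta>0 u) z. True)"
  have w_le_1: "w v \<le> 1" for v
  proof -
    have "bdd_above (range (\<lambda>v. \<bar>w v\<bar>))"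
      using H2(3) by (auto simp: bounded_iff bdd_above_def)
    then have "\<bar>w v\<bar> \<le> (SUP v. \<bar>w v\<bar>)" by (rule cSUP_upper[OF UNIV_I])
    then show ?thesis using H2(4) by simp
  qed
  interpret logistic_sample \<rho> \<psi> \<psi>' M y x \<beta>0 w ys xs
    by (intro logistic_sample.intro logistic_model.intro logistic_model_axioms.intro smooth_loss.intro
        logistic_sample_axioms.intro prob(1)) (fact rho R3 rv binary model H2 H3 w_le_1 sample_indep sample_copies)+
  have b: "0 \<le> b"
  proof (rule converges_in_probability_nonneg[OF _ lam_lim])
    show "(\<lambda>\<omega>. sqrt (real n) * lam n \<omega>) \<in> borel_measurable M" for n
      using lam(1) by measurable
    show "0 \<le> sqrt (real n) * lam n \<omega>" if "\<omega> \<in> space M" for n \<omega>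
      using lam(2)[OF that, of n] by simp
  qed
  obtain c where c: "0 < c" and coer: "\<And>z. c * (norm z)\<^sup>2 \<le> z \<bullet> (?A *v z)"
    using A_matrix_coercive[OF H4] by blast
  have lipschitz: "norm (\<Phi> u - \<Phi> v) \<le> norm (u - v) / c" for u v
    unfolding \<Phi>_def by (rule R_process_lipschitz[OF c coer b])
  have nz: "\<beta>0 \<noteq> 0" using beta0 by simp
  have \<Phi>_cont: "continuous_on UNIV \<Phi>"
    unfolding continuous_on_iff
  proof (intro ballI allI impI)
    fix u :: "real ^ 'p" and e :: real assume "0 < e"
    show "\<exists>d>0. \<forall>v\<in>UNIV. dist v u < d \<longrightarrow> dist (\<Phi> v) (\<Phi> u) < e"
    proof (intro exI[of _ "c * e"] conjI ballI impI)
      show "0 < c * e" using c \<open>0 < e\<close> by simp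
      fix v assume "dist v u < c * e"
      then have "norm (v - u) / c < e" using c by (simp add: dist_norm field_simps)
      then show "dist (\<Phi> v) (\<Phi> u) < e" using lipschitz[of v u] by (simp add: dist_norm)
    qed
  qed
  have limit: "converges_in_distribution M (\<lambda>n \<omega>. \<Phi> (score_sum n \<omega>)) N (\<lambda>\<omega>. \<Phi> (W \<omega>))"
    by (rule converges_in_distribution_continuous_map[OF score_sum_clt[OF prob(2) W] \<Phi>_cont])
  have "converges_in_distribution M (\<lambda>n \<omega>. sqrt (real n) *\<^sub>R (\<beta>hat n \<omega> - \<beta>0)) N (\<lambda>\<omega>. \<Phi> (W \<omega>))"
  proof (rule converges_in_distribution_slutsky[OF prob(1) limit])
    have [measurable]: "\<beta>hat n \<in> borel_measurable M" for n
      using estimator by (simp add: penalized_estimator_def)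
    show "(\<lambda>\<omega>. sqrt (real n) *\<^sub>R (\<beta>hat n \<omega> - \<beta>0)) \<in> borel_measurable M" for n
      by measurable
    fix e :: real assume e: "0 < e"
    show "\<exists>K. eventually_prob M e (\<lambda>n \<omega>. norm (\<Phi> (score_sum n \<omega>)) \<le> K)"
    proof -
      obtain K where "eventually_prob M e (\<lambda>n \<omega>. norm (score_sum n \<omega>) \<le> K)"
        using eventually_prob_bounded[OF score_sum_measurable score_sum_bounded e] by auto
      then have "eventually_prob M e (\<lambda>n \<omega>. norm (\<Phi> (score_sum n \<omega>)) \<le> norm (\<Phi> 0) + K / c)"
      proof (rule eventually_prob_mono, intro always_eventually allI ballI impI)
        fix n \<omega> assume "norm (score_sum n \<omega>) \<le> K"
        then have "norm (score_sum n \<omega> - 0) / c \<le> K / c" using c by (simp add: divide_right_mono)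
        then show "norm (\<Phi> (score_sum n \<omega>)) \<le> norm (\<Phi> 0) + K / c"
          using lipschitz[of "score_sum n \<omega>" 0] norm_triangle_sub[of "\<Phi> (score_sum n \<omega>)" "\<Phi> 0"] by linarith
      qed
      then show ?thesis by blast
    qed
    show "eventually_prob M e (\<lambda>n \<omega>. dist (sqrt (real n) *\<^sub>R (\<beta>hat n \<omega> - \<beta>0)) (\<Phi> (score_sum n \<omega>)) \<le> r)"
      if "0 < r" for r
      unfolding \<Phi>_def
      by (rule penalized_estimator_asymptotics[OF nz lam lam_lim b estimator root_n c coer e that])
  qed
  moreover have "\<forall>\<omega>\<in>space N. \<exists>!z. is_arg_min (R_process ?A b \<beta>0 (W \<omega>)) (\<lambda>_. True) z"
    using R_process_unique[OF c coer b] by blast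
  ultimately show ?thesis unfolding \<Phi>_def by blast
qed

end
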